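(* Suppose the Jacobian conjecture over $\mathbb{C}$ is not true (i.e. $JC(\mathbb{C},m)$ fails for some integer $m>1$). Then for some (possibly large) integer $n>1$ there exists a Keller map $F=(F_1,\dots,F_n)\in\mathbb{Z}[X]^n$ of the quadratic-cubic linear form over $\mathbb{Z}$, $$F_i(X)=X_i+\langle a_i,X\rangle^{d_i},\qquad a_i\in\mathbb{Z}^n,\ d_i\in\{2,3\},\ i=1,\dots,n,$$ such that the affine curve $F_1(X)=F_2(X)=\dots=F_n(X)$ has no non-zero points in $\mathbb{Z}^n$.
   Context: Let $k$ be a field of characteristic zero and $X=(X_1,\dots,X_n)$. A polynomial map $F=(F_1,\dots,F_n)\in k[X]^n$ is called a Keller map if $\det DF\equiv 1$; a Keller map in $\mathbb{Z}[X]^n$ is an $F\in\mathbb{Z}[X]^n$ with $\det DF\equiv 1$. The $n$-dimensional Jacobian conjecture $JC(k,n)$, $n>1$, is the assertion that every Keller map $F\in k[X]^n$ has an inverse polynomial map in $k[X]^n$. The Jacobian conjecture over $\mathbb{C}$ is the assertion that $JC(\mathbb{C},n)$ holds for all $n>1$. For $a=(a_1,\dots,a_n)$, $\langle a,X\rangle:=a_1X_1+\dots+a_nX_n$. *)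

theory Defs
  imports
    Complex_Main
    "HOL-Library.Poly_Mapping"
    "Jordan_Normal_Form.Determinant"
begin

text \<open>
  Multivariate polynomials are finitely supported functions from exponent vectors to
  coefficients; their ring structure is the one of \<^theory>\<open>HOL-Library.Poly_Mapping\<close>.
  The variables $X_1,\dots,X_n$ are those with indices $0,\dots,n-1$.
\<close>

type_synonym 'a mpoly = "(nat \<Rightarrow>\<^sub>0 nat) \<Rightarrow>\<^sub>0 'a"

definition Const :: "'a::zero \<Rightarrow> 'a mpoly" where
  "Const c = Poly_Mapping.single 0 c"

definition Var :: "nat \<Rightarrow> 'a::zero_neq_one mpoly" where
  "Var i = Poly_Mapping.single (Poly_Mapping.single i 1) 1"

definition poly_ring :: "nat \<Rightarrow> 'a::zero mpoly set" where
  "poly_ring n = {p. \<forall>m \<in> Poly_Mapping.keys p. Poly_Mapping.keys m \<subseteq> {..<n}}"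

text \<open>Evaluation at a point of a commutative ring, coefficients being mapped by \<open>h\<close>.\<close>

definition eval_with ::
    "('a::zero \<Rightarrow> 'b::comm_semiring_1) \<Rightarrow> (nat \<Rightarrow> 'b) \<Rightarrow> 'a mpoly \<Rightarrow> 'b" where
  "eval_with h x p = (\<Sum>m \<in> Poly_Mapping.keys p.
     h (Poly_Mapping.lookup p m) * (\<Prod>i \<in> Poly_Mapping.keys m. x i ^ Poly_Mapping.lookup m i))"

definition eval_at :: "'a::comm_semiring_1 vec \<Rightarrow> 'a mpoly \<Rightarrow> 'a" where
  "eval_at x p = eval_with (\<lambda>c. c) (\<lambda>i. x $ i) p"

definition subst :: "'a::comm_semiring_1 mpoly vec \<Rightarrow> 'a mpoly \<Rightarrow> 'a mpoly" where
  "subst G p = eval_with Const (\<lambda>i. G $ i) p"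

text \<open>
  If \<open>i\<close> does not occur in the monomial \<open>m\<close>, the truncated subtraction below is harmless,
  as the coefficient is then zero.
\<close>

definition partial_deriv :: "nat \<Rightarrow> 'a::comm_semiring_1 mpoly \<Rightarrow> 'a mpoly" where
  "partial_deriv i p = (\<Sum>m \<in> Poly_Mapping.keys p.
     Poly_Mapping.single (m - Poly_Mapping.single i 1)
       (of_nat (Poly_Mapping.lookup m i) * Poly_Mapping.lookup p m))"

definition poly_maps :: "nat \<Rightarrow> 'a::zero mpoly vec set" where
  "poly_maps n = {F \<in> carrier_vec n. \<forall>i<n. F $ i \<in> poly_ring n}"

definition id_map :: "nat \<Rightarrow> 'a::zero_neq_one mpoly vec" where
  "id_map n = vec n Var"

definition comp_map ::
    "'a::comm_semiring_1 mpoly vec \<Rightarrow> 'a mpoly vec \<Rightarrow> 'a mpoly vec" where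
  "comp_map F G = map_vec (subst G) F"

definition jacobian :: "nat \<Rightarrow> 'a::comm_ring_1 mpoly vec \<Rightarrow> 'a mpoly mat" where
  "jacobian n F = mat n n (\<lambda>(i, j). partial_deriv j (F $ i))"

definition keller_map :: "nat \<Rightarrow> 'a::comm_ring_1 mpoly vec \<Rightarrow> bool" where
  "keller_map n F \<longleftrightarrow> F \<in> poly_maps n \<and> det (jacobian n F) = 1"

definition JC :: "'k::field_char_0 itself \<Rightarrow> nat \<Rightarrow> bool" where
  "JC _ n \<longleftrightarrow> (\<forall>F :: 'k mpoly vec. keller_map n F \<longrightarrow>
     (\<exists>G \<in> poly_maps n. comp_map F G = id_map n \<and> comp_map G F = id_map n))"

definition jacobian_conjecture :: "'k::field_char_0 itself \<Rightarrow> bool" where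
  "jacobian_conjecture K \<longleftrightarrow> (\<forall>n>1. JC K n)"

definition linear_form :: "'a::comm_ring_1 vec \<Rightarrow> 'a mpoly" where
  "linear_form a = (\<Sum>j<dim_vec a. Const (a $ j) * Var j)"

definition quadratic_cubic_linear_form :: "nat \<Rightarrow> 'a::comm_ring_1 mpoly vec \<Rightarrow> bool" where
  "quadratic_cubic_linear_form n F \<longleftrightarrow>
     (\<exists>(a :: nat \<Rightarrow> 'a vec) (d :: nat \<Rightarrow> nat).
        (\<forall>i<n. a i \<in> carrier_vec n \<and> d i \<in> {2, 3}) \<and>
        F = vec n (\<lambda>i. Var i + linear_form (a i) ^ d i))"

text \<open>The points of the affine curve $F_1(X) = \dots = F_n(X)$ over the coefficient ring.\<close>

definition diagonal_curve :: "nat \<Rightarrow> 'a::comm_ring_1 mpoly vec \<Rightarrow> 'a vec set" where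
  "diagonal_curve n F =
     {x \<in> carrier_vec n. \<forall>i<n. \<forall>j<n. eval_at x (F $ i) = eval_at x (F $ j)}"

end

theory Submission
  imports
    Defs
    "HOL-Computational_Algebra.Fundamental_Theorem_Algebra"
begin

text \<open>
  Let $G$ be the formal inverse of a Keller map $F = X + \dots$ over $\mathbb{C}$ without polynomial
  inverse; it has nonzero homogeneous components in arbitrarily high degrees. The field generated by
  the coefficients is a tower of simple extensions of $\mathbb{Q}$, which is descended step by step: a
  transcendental generator is specialized, an algebraic one is removed by restriction of scalars. After
  rescaling one obtains, for each $K_0$ and with dimension $n$ and degree bound independent of $K_0$,
  a Keller map $F$ over $\mathbb{Z}$ with $G_K \neq 0$ for some $K > K_0$.

  Consider $(t, z) \mapsto (t, t^{-1} F(tz))$ along the line spanned by $(1, v)$: for $c \neq 0$ the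
  point $x = cz$ satisfies $F(x) = \tau v$ with $\tau = c^2$ and $x \equiv 0$ modulo $c$. Hence $x$ is
  congruent to the truncations of $\sum_e \tau^e G_e(v)$ modulo high powers of $\tau$. On the other hand
  $|x_i| = O(|\tau|^\kappa)$, where $\kappa$ depends only on $n$ and $\deg F$, because $x_i$ is algebraic
  over $F(x)$. For $K > \kappa$ and $|\tau|$ large this forces $x_i = \sum_{e<K} \tau^e G_{e,i}(v)$ and
  then $\tau \mid G_{K,i}(v)$, which is impossible. So the points on this line divisible by a large $N$
  are zero. Elementary automorphisms reduce the degree to three, and the pairing
  $x + C (B x)^d \leftrightarrow y + (B C y)^d$ leads to powers of linear forms; both preserve the
  absence of such points, and dummy columns of $C$ turn the line into the diagonal.
\<close>

section \<open>Multivariate polynomials\<close>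

text \<open>The threshold for K is explicit, n * ((n * d + 2) ^ n + 1), and depends on dimension and
  degree only. This is why the map may change together with K: a specialization keeps one chosen
  coefficient of the formal inverse alive, and no single specialization is claimed to keep
  infinitely many. The Hensel argument reaches only points that are c-adically small; nothing is
  claimed about other integral points over the line. The coordinate t supplies the divisibility of x
  by c, and the restriction to points divisible by a large N makes c large as soon as it is nonzero.
  The restriction disappears only in the final rescaling by 24 M, under which every integral point
  corresponds to a point divisible by 24 M. The same factor pays for the denominators 4 and 24 of
  polarization. Along the reductions the Keller condition is carried as surjectivity of the
  derivative at each integral point, a form that elementary maps and the pairing respect without any
  determinant.\<close>

abbreviation "lookup \<equiv> Poly_Mapping.lookup"
abbreviation "keys \<equiv> Poly_Mapping.keys"
abbreviation "single \<equiv> Poly_Mapping.single"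

definition mon_eval :: "(nat \<Rightarrow> 'b::comm_semiring_1) \<Rightarrow> (nat \<Rightarrow>\<^sub>0 nat) \<Rightarrow> 'b" where
  "mon_eval x m = (\<Prod>i\<in>keys m. x i ^ lookup m i)"

lemma mon_eval_superset:
  assumes "finite S" "keys m \<subseteq> S"
  shows "mon_eval x m = (\<Prod>i\<in>S. x i ^ lookup m i)"
  unfolding mon_eval_def using assms
  by (intro prod.mono_neutral_left) (auto simp: in_keys_iff)

lemma mon_eval_add: "mon_eval x (m + m') = mon_eval x m * mon_eval x m'"
proof -
  let ?S = "keys m \<union> keys m'"
  have "keys (m + m') \<subseteq> ?S" by (rule Poly_Mapping.keys_add)
  then show ?thesis
    by (simp add: mon_eval_superset[of ?S] lookup_add power_add prod.distrib)
qed

lemma mon_eval_zero [simp]: "mon_eval x 0 = 1"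
  by (simp add: mon_eval_def)

lemma mon_eval_single [simp]: "mon_eval x (single i e) = x i ^ e"
  by (cases "e = 0") (simp_all add: mon_eval_def)

lemma mon_eval_cong: "(\<And>i. i \<in> keys m \<Longrightarrow> x i = y i) \<Longrightarrow> mon_eval x m = mon_eval y m"
  by (simp add: mon_eval_def)

lemma sum_singles: "p = (\<Sum>m\<in>keys p. single m (lookup p m))"
  by (rule poly_mapping_eqI)
    (simp add: lookup_sum lookup_single when_def in_keys_iff sum.delta)

lemma eval_with_mon: "eval_with h x p = (\<Sum>m\<in>keys p. h (lookup p m) * mon_eval x m)"
  by (simp add: eval_with_def mon_eval_def)

lemma eval_with_superset:
  assumes "finite S" "keys p \<subseteq> S" "h 0 = 0"
  shows "eval_with h x p = (\<Sum>m\<in>S. h (lookup p m) * mon_eval x m)"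
  unfolding eval_with_mon using assms
  by (intro sum.mono_neutral_left) (auto simp: in_keys_iff)

text \<open>A predicate on subsets of one type rather than a type of its own: the descent passes
  through several subrings of the same field, among them a localization.\<close>

definition subring :: "'a::comm_ring_1 set \<Rightarrow> bool" where
  "subring R \<longleftrightarrow> 1 \<in> R \<and> (\<forall>a\<in>R. - a \<in> R) \<and> (\<forall>a\<in>R. \<forall>b\<in>R. a + b \<in> R \<and> a * b \<in> R)"

lemma subringD:
  assumes "subring R"
  shows "1 \<in> R" "0 \<in> R" "a \<in> R \<Longrightarrow> - a \<in> R" "a \<in> R \<Longrightarrow> b \<in> R \<Longrightarrow> a + b \<in> R"
    "a \<in> R \<Longrightarrow> b \<in> R \<Longrightarrow> a - b \<in> R" "a \<in> R \<Longrightarrow> b \<in> R \<Longrightarrow> a * b \<in> R"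
proof -
  have *: "1 \<in> R" "\<And>a. a \<in> R \<Longrightarrow> - a \<in> R" "\<And>a b. a \<in> R \<Longrightarrow> b \<in> R \<Longrightarrow> a + b \<in> R"
     "\<And>a b. a \<in> R \<Longrightarrow> b \<in> R \<Longrightarrow> a * b \<in> R"
    using assms by (auto simp: subring_def)
  from * show "1 \<in> R" "a \<in> R \<Longrightarrow> - a \<in> R" "a \<in> R \<Longrightarrow> b \<in> R \<Longrightarrow> a + b \<in> R" 
     "a \<in> R \<Longrightarrow> b \<in> R \<Longrightarrow> a * b \<in> R" by blast+
  show "0 \<in> R" using *(1) *(2)[OF *(1)] *(3)[of 1 "-1"] by simp
  show "a \<in> R \<Longrightarrow> b \<in> R \<Longrightarrow> a - b \<in> R" using *(2)[of b] *(3)[of a "-b"] by simp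
qed

lemma subring_UNIV [simp]: "subring UNIV"
  by (simp add: subring_def)

lemma subring_sum: "subring R \<Longrightarrow> (\<And>i. i \<in> A \<Longrightarrow> f i \<in> R) \<Longrightarrow> sum f A \<in> R"
  by (induction A rule: infinite_finite_induct) (auto intro: subringD)

lemma subring_power: "subring R \<Longrightarrow> a \<in> R \<Longrightarrow> a ^ e \<in> R"
  by (induction e) (auto intro: subringD)

lemma subring_of_nat: "subring R \<Longrightarrow> of_nat a \<in> R"
  by (induction a) (auto intro: subringD)

text \<open>\<open>h\<close> is a total function whose values outside \<open>R\<close> are
  arbitrary. This fits the specialization of a transcendental element, which is defined only on
  fractions whose denominator stays nonzero.\<close>

definition hom_on :: "'a::comm_ring_1 set \<Rightarrow> ('a \<Rightarrow> 'b::comm_ring_1) \<Rightarrow> bool" where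
  "hom_on R h \<longleftrightarrow> subring R \<and> h 0 = 0 \<and> h 1 = 1 \<and>
    (\<forall>a\<in>R. \<forall>b\<in>R. h (a + b) = h a + h b \<and> h (a * b) = h a * h b)"

lemma hom_onD:
  assumes "hom_on R h"
  shows "subring R" "h 0 = 0" "h 1 = 1" "a \<in> R \<Longrightarrow> b \<in> R \<Longrightarrow> h (a + b) = h a + h b"
    "a \<in> R \<Longrightarrow> b \<in> R \<Longrightarrow> h (a * b) = h a * h b"
  using assms by (auto simp: hom_on_def)

lemma hom_on_uminus:
  assumes "hom_on R h" "a \<in> R" shows "h (- a) = - h a"
  using hom_onD(4)[OF assms(1) assms(2), of "-a"] hom_onD(2)[OF assms(1)]
    subringD(3)[OF hom_onD(1)[OF assms(1)] assms(2)]
  by (simp add: minus_unique)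

lemma hom_on_sum:
  assumes "hom_on R h" "\<And>i. i \<in> A \<Longrightarrow> f i \<in> R"
  shows "h (sum f A) = (\<Sum>i\<in>A. h (f i))"
  using assms(2)
proof (induction A rule: infinite_finite_induct)
  case (insert x F)
  then show ?case
    using hom_onD[OF assms(1)] subring_sum[OF hom_onD(1)[OF assms(1)], of F f] by simp
qed (simp_all add: hom_onD[OF assms(1)])

lemma hom_on_id [simp]: "hom_on UNIV (\<lambda>c. c)"
  by (simp add: hom_on_def)

lemma hom_on_Const [simp]: "hom_on UNIV Const"
  by (auto simp: hom_on_def Const_def single_add mult_single)

lemma hom_on_compose:
  assumes "hom_on R h" "hom_on R' h'" "\<And>a. a \<in> R \<Longrightarrow> h a \<in> R'"
  shows "hom_on R (\<lambda>a. h' (h a))"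
  using assms unfolding hom_on_def by auto

lemma hom_on_Const_compose: "hom_on R h \<Longrightarrow> hom_on R (\<lambda>a. Const (h a))"
  by (rule hom_on_compose[of R h UNIV]) auto

section \<open>Polynomials with restricted coefficients and variables\<close>

definition over :: "'a::zero set \<Rightarrow> ('b \<Rightarrow>\<^sub>0 'a) \<Rightarrow> bool" where
  "over R p \<longleftrightarrow> (\<forall>m. lookup p m \<in> R)"

lemma overD: "over R p \<Longrightarrow> lookup p m \<in> R"
  by (simp add: over_def)

lemma over_UNIV [simp]: "over UNIV p"
  by (simp add: over_def)

lemma over_single: "0 \<in> R \<Longrightarrow> a \<in> R \<Longrightarrow> over R (single m a)"
  by (simp add: over_def lookup_single when_def)

lemma over_Const: "subring R \<Longrightarrow> a \<in> R \<Longrightarrow> over R (Const a)"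
  by (simp add: Const_def over_single subringD)

lemma over_Var: "subring R \<Longrightarrow> over R (Var i)"
  by (simp add: Var_def over_single subringD)

lemma over_zero: "subring R \<Longrightarrow> over R 0"
  by (simp add: over_def subringD)

lemma over_one: "subring R \<Longrightarrow> over R (1 :: 'a::comm_ring_1 mpoly)"
  by (simp add: over_def lookup_one when_def subringD)

lemma over_add: "subring R \<Longrightarrow> over R p \<Longrightarrow> over R q \<Longrightarrow> over R (p + q)"
  by (simp add: over_def lookup_add subringD)

lemma over_uminus: "subring R \<Longrightarrow> over R p \<Longrightarrow> over R (- p)"
  by (simp add: over_def subringD)

lemma over_diff: "subring R \<Longrightarrow> over R p \<Longrightarrow> over R q \<Longrightarrow> over R (p - q)"
  by (simp add: over_def lookup_minus subringD)

lemma over_sum: "subring R \<Longrightarrow> (\<And>i. i \<in> A \<Longrightarrow> over R (f i)) \<Longrightarrow> over R (sum f A)"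
  by (auto simp: over_def lookup_sum intro: subring_sum)

lemma mult_singles:
  "(p::'a::comm_ring_1 mpoly) * q =
    (\<Sum>m\<in>keys p. \<Sum>m'\<in>keys q. single (m + m') (lookup p m * lookup q m'))"
  by (subst (1) sum_singles[of p], subst (1) sum_singles[of q])
    (simp add: sum_product mult_single)

lemma over_mult:
  assumes "subring R" "over R (p::'a::comm_ring_1 mpoly)" "over R q"
  shows "over R (p * q)"
  unfolding mult_singles using assms
  by (intro over_sum over_single) (auto intro: subringD dest: overD)

lemma over_prod:
  "subring R \<Longrightarrow> (\<And>i. i \<in> A \<Longrightarrow> over R (f i :: 'a::comm_ring_1 mpoly)) \<Longrightarrow> over R (prod f A)"
  by (induction A rule: infinite_finite_induct) (auto intro: over_one over_mult)

lemma over_power: "subring R \<Longrightarrow> over R (p :: 'a::comm_ring_1 mpoly) \<Longrightarrow> over R (p ^ e)"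
  by (induction e) (auto intro: over_one over_mult)

lemma over_mon: "subring R \<Longrightarrow> (\<And>i. i \<in> keys m \<Longrightarrow> over R (g i :: 'a::comm_ring_1 mpoly)) \<Longrightarrow> over R (mon_eval g m)"
  by (auto simp: mon_eval_def intro: over_prod over_power)

lemma poly_ringD: "p \<in> poly_ring n \<Longrightarrow> m \<in> keys p \<Longrightarrow> i \<in> keys m \<Longrightarrow> i < n"
  by (auto simp: poly_ring_def)

lemma poly_ring_single: "keys m \<subseteq> {..<n} \<Longrightarrow> single m a \<in> poly_ring n"
  by (simp add: poly_ring_def)

lemma poly_ring_Const [simp]: "Const a \<in> poly_ring n"
  by (simp add: Const_def poly_ring_def)

lemma poly_ring_zero [simp]: "0 \<in> poly_ring n"
  by (simp add: poly_ring_def)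

lemma poly_ring_one [simp]: "1 \<in> poly_ring n"
  by (simp add: poly_ring_def)

lemma poly_ring_Var [simp]: "i < n \<Longrightarrow> (Var i :: 'a::comm_ring_1 mpoly) \<in> poly_ring n"
  by (simp add: Var_def poly_ring_def)

lemma poly_ring_add: "p \<in> poly_ring n \<Longrightarrow> q \<in> poly_ring n \<Longrightarrow> p + q \<in> poly_ring n"
  using Poly_Mapping.keys_add[of p q] by (fastforce simp: poly_ring_def)

lemma poly_ring_uminus: "(p::'a::comm_ring_1 mpoly) \<in> poly_ring n \<Longrightarrow> - p \<in> poly_ring n"
  by (simp add: poly_ring_def in_keys_iff)

lemma poly_ring_diff:
  "(p::'a::comm_ring_1 mpoly) \<in> poly_ring n \<Longrightarrow> q \<in> poly_ring n \<Longrightarrow> p - q \<in> poly_ring n"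
  using poly_ring_add[of p n "- q"] poly_ring_uminus[of q n] by simp

lemma poly_ring_sum: "(\<And>i. i \<in> A \<Longrightarrow> f i \<in> poly_ring n) \<Longrightarrow> sum f A \<in> poly_ring n"
  by (induction A rule: infinite_finite_induct) (auto intro: poly_ring_add)

lemma poly_ring_mult:
  assumes "(p::'a::comm_ring_1 mpoly) \<in> poly_ring n" "q \<in> poly_ring n"
  shows "p * q \<in> poly_ring n"
  unfolding mult_singles
proof (intro poly_ring_sum poly_ring_single)
  fix m m' assume "m \<in> keys p" "m' \<in> keys q"
  then show "keys (m + m') \<subseteq> {..<n}"
    using assms Poly_Mapping.keys_add[of m m'] unfolding poly_ring_def by blast
qed

lemma poly_ring_prod:
  "(\<And>i. i \<in> A \<Longrightarrow> f i \<in> poly_ring n) \<Longrightarrow> (prod f A :: 'a::comm_ring_1 mpoly) \<in> poly_ring n"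
  by (induction A rule: infinite_finite_induct) (auto intro: poly_ring_mult)

lemma poly_ring_power: "(p :: 'a::comm_ring_1 mpoly) \<in> poly_ring n \<Longrightarrow> p ^ e \<in> poly_ring n"
  by (induction e) (auto intro: poly_ring_mult)

lemma ex_poly_ring: "\<exists>n. p \<in> poly_ring n"
proof -
  have "finite (\<Union>m\<in>keys p. keys m)" by simp
  then obtain n where "\<forall>i\<in>(\<Union>m\<in>keys p. keys m). i < n"
    using finite_nat_set_iff_bounded by auto
  then show ?thesis by (auto simp: poly_ring_def intro!: exI[of _ n])
qed

lemma single_eq_Const_mon:
  "single m (a::'a::comm_ring_1) = Const a * mon_eval Var m"
proof -
  have "single (single i (e::nat)) (1::'a) = Var i ^ e" for i e
  proof (induction e)
    case (Suc e)
    have "single (single i (Suc e)) (1::'a) =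
      Var i * single (single i e) 1"
      unfolding Var_def mult_single by (simp flip: single_add)
    then show ?case using Suc by simp
  qed simp
  then have *: "mon_eval Var m = (\<Prod>i\<in>keys m. single (single i (lookup m i)) (1::'a))"
    by (simp add: mon_eval_def)
  have prod1: "finite A \<Longrightarrow> (\<Prod>i\<in>A. single (f i) (1::'a)) = single (\<Sum>i\<in>A. f i) 1"
    for A and f :: "nat \<Rightarrow> (nat \<Rightarrow>\<^sub>0 nat)"
    by (induction A rule: finite_induct) (simp_all add: mult_single)
  have "mon_eval Var m = single m (1::'a)"
    unfolding * by (simp add: prod1 flip: sum_singles)
  then show ?thesis by (simp add: Const_def mult_single)
qed

lemma mpoly_induct [consumes 3, case_names Const Var add mult]:
  fixes p :: "'a::comm_ring_1 mpoly"
  assumes R: "subring R" and "over R p" and "p \<in> poly_ring n"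
    and C: "\<And>c. c \<in> R \<Longrightarrow> P (Const c)"
    and V: "\<And>i. i < n \<Longrightarrow> P (Var i)"
    and A: "\<And>p q. over R p \<Longrightarrow> p \<in> poly_ring n \<Longrightarrow> over R q \<Longrightarrow> q \<in> poly_ring n \<Longrightarrow> P p \<Longrightarrow> P q \<Longrightarrow> P (p + q)"
    and M: "\<And>p q. over R p \<Longrightarrow> p \<in> poly_ring n \<Longrightarrow> over R q \<Longrightarrow> q \<in> poly_ring n \<Longrightarrow> P p \<Longrightarrow> P q \<Longrightarrow> P (p * q)"
  shows "P p"
proof -
  \<comment> \<open>Membership in the polynomial ring over \<open>R\<close> in \<open>n\<close>
    variables is carried along with \<open>P\<close>, so that the closure assumptions for sums and
    products may presuppose it.\<close>
  define Q where "Q p \<longleftrightarrow> over R p \<and> p \<in> poly_ring n \<and> P p" for p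
  have QC: "Q (Const c)" if "c \<in> R" for c
    using that by (simp add: Q_def C over_Const R)
  have QV: "Q (Var i)" if "i < n" for i
    using that by (simp add: Q_def V over_Var R)
  have QA: "Q p \<Longrightarrow> Q q \<Longrightarrow> Q (p + q)" for p q
    by (auto simp: Q_def A over_add R poly_ring_add)
  have QM: "Q p \<Longrightarrow> Q q \<Longrightarrow> Q (p * q)" for p q
    by (auto simp: Q_def M over_mult R poly_ring_mult)
  have Q0: "Q 0" and Q1: "Q 1"
    using QC[of 0] QC[of 1] subringD[OF R] by (simp_all add: Const_def)
  have QP: "Q p \<Longrightarrow> Q (p ^ e)" for p e
    by (induction e) (auto intro: Q1 QM)
  have QPr: "finite S \<Longrightarrow> (\<And>i. i \<in> S \<Longrightarrow> Q (f i)) \<Longrightarrow> Q (prod f S)" for f :: "nat \<Rightarrow> 'a mpoly" and S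
    by (induction S rule: finite_induct) (auto intro: Q1 QM)
  have QS: "finite S \<Longrightarrow> (\<And>i. i \<in> S \<Longrightarrow> Q (f i)) \<Longrightarrow> Q (sum f S)" for f :: "(nat \<Rightarrow>\<^sub>0 nat) \<Rightarrow> 'a mpoly" and S
    by (induction S rule: finite_induct) (auto intro: Q0 QA)
  have "Q (\<Sum>m\<in>keys p. single m (lookup p m))"
    unfolding single_eq_Const_mon
  proof (rule QS)
    fix m assume m: "m \<in> keys p"
    have "Q (mon_eval Var m)"
      unfolding mon_eval_def using poly_ringD[OF assms(3) m] by (intro QPr QP QV) auto
    then show "Q (Const (lookup p m) * mon_eval Var m)"
      using QC[of "lookup p m"] overD[OF assms(2), of m] QM by blast
  qed simp
  then show ?thesis by (simp add: Q_def flip: sum_singles)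
qed

section \<open>Evaluation along a ring homomorphism of the coefficients\<close>

context
  fixes R :: "'a::comm_ring_1 set" and h :: "'a \<Rightarrow> 'b::comm_ring_1"
  assumes h: "hom_on R h"
begin

lemma eval_with_zero [simp]: "eval_with h x 0 = 0"
  by (simp add: eval_with_mon)

lemma eval_with_one [simp]: "eval_with h x 1 = 1"
  by (simp add: eval_with_mon hom_onD[OF h])

lemma eval_with_single: "eval_with h x (single m a) = h a * mon_eval x m"
  using hom_onD(2)[OF h] by (cases "a = 0") (simp_all add: eval_with_mon)

lemma eval_with_Const [simp]: "eval_with h x (Const a) = h a"
  by (simp add: Const_def eval_with_single)

lemma eval_with_Var [simp]: "eval_with h x (Var i) = x i"
  by (simp add: Var_def eval_with_single hom_onD[OF h])

lemma eval_with_add: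
  assumes "over R p" "over R q"
  shows "eval_with h x (p + q) = eval_with h x p + eval_with h x q"
proof -
  have "keys (p + q) \<subseteq> keys p \<union> keys q" by (rule Poly_Mapping.keys_add)
  then show ?thesis
    using assms hom_onD(2)[OF h]
    by (simp add: eval_with_superset[of "keys p \<union> keys q"] lookup_add sum.distrib
      hom_onD(4)[OF h] overD distrib_right)
qed

lemma eval_with_sum:
  assumes "\<And>i. i \<in> A \<Longrightarrow> over R (f i)"
  shows "eval_with h x (sum f A) = (\<Sum>i\<in>A. eval_with h x (f i))"
  using assms
  by (induction A rule: infinite_finite_induct)
    (simp_all add: eval_with_add over_sum[OF hom_onD(1)[OF h]])

lemma eval_with_mult:
  assumes "over R p" "over R q"
  shows "eval_with h x (p * q) = eval_with h x p * eval_with h x q"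
proof -
  note R = hom_onD(1)[OF h]
  have "eval_with h x (p * q) =
    (\<Sum>m\<in>keys p. \<Sum>m'\<in>keys q. h (lookup p m * lookup q m') * mon_eval x (m + m'))"
    unfolding mult_singles using assms R
    by (simp add: eval_with_sum over_sum over_single subringD overD eval_with_single)
  also have "\<dots> = eval_with h x p * eval_with h x q"
    unfolding eval_with_mon sum_product using assms
    by (simp add: hom_onD(5)[OF h] overD mon_eval_add mult_ac)
  finally show ?thesis .
qed

lemma eval_with_uminus: "over R p \<Longrightarrow> eval_with h x (- p) = - eval_with h x p"
  by (simp add: eval_with_mon in_keys_iff hom_on_uminus[OF h] overD sum_negf)

lemma eval_with_diff:
  "over R p \<Longrightarrow> over R q \<Longrightarrow> eval_with h x (p - q) = eval_with h x p - eval_with h x q"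
  using eval_with_add[of p "- q"] over_uminus[OF hom_onD(1)[OF h], of q]
  by (simp add: eval_with_uminus)

lemma eval_with_power: "over R p \<Longrightarrow> eval_with h x (p ^ e) = eval_with h x p ^ e"
  by (induction e) (simp_all add: eval_with_mult over_power[OF hom_onD(1)[OF h]])

end

lemma eval_with_cong:
  assumes "p \<in> poly_ring n" "\<And>i. i < n \<Longrightarrow> x i = y i" "\<And>m. h (lookup p m) = h' (lookup p m)"
  shows "eval_with h x p = eval_with h' y p"
  unfolding eval_with_mon using assms
  by (intro sum.cong arg_cong2[where f = "(*)"] mon_eval_cong) (auto dest: poly_ringD)

text \<open>Both sides of the equation are ring homomorphisms in \<open>p\<close> that agree on
  constants and variables. Different choices of \<open>h\<close> and \<open>h'\<close> give
  associativity of substitution, evaluation after substitution, and compatibility of substitution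
  with a change of coefficients. That the inner result lies over \<open>R'\<close> is part of the
  induction, since \<open>h'\<close> is known to be multiplicative only there.\<close>

lemma eval_with_comp:
  fixes h :: "'a::comm_ring_1 \<Rightarrow> 'b::comm_ring_1" and h' :: "'b \<Rightarrow> 'c::comm_ring_1"
  assumes h: "hom_on R h" and h': "hom_on R' h'" and sub: "\<And>a. a \<in> R \<Longrightarrow> h a \<in> R'"
    and p: "over R p" "p \<in> poly_ring n" and g: "\<And>i. i < n \<Longrightarrow> over R' (g i)"
  shows "over R' (eval_with (\<lambda>a. Const (h a)) g p) \<and>
    eval_with h' y (eval_with (\<lambda>a. Const (h a)) g p)
      = eval_with (\<lambda>a. h' (h a)) (\<lambda>i. eval_with h' y (g i)) p"
proof -
  note R = hom_onD(1)[OF h] note R' = hom_onD(1)[OF h']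
  note c1 = hom_on_Const_compose[OF h] and c2 = hom_on_compose[OF h h' sub]
  show ?thesis
    using R p
  proof (induction rule: mpoly_induct)
    case (Const c)
    then show ?case by (simp add: eval_with_Const[OF c1] eval_with_Const[OF c2] 
       eval_with_Const[OF h'] over_Const R' sub)
  next
    case (Var i)
    then show ?case using g by (simp add: eval_with_Var[OF c1] eval_with_Var[OF c2])
  next
    case (add p q)
    then show ?case
      by (simp add: eval_with_add[OF c1] eval_with_add[OF c2] eval_with_add[OF h'] over_add R')
  next
    case (mult p q)
    then show ?case
      by (simp add: eval_with_mult[OF c1] eval_with_mult[OF c2] eval_with_mult[OF h'] over_mult R')
  qed
qed

section \<open>Formal partial derivatives\<close>

lemma partial_deriv_superset:
  fixes p :: "'a::comm_ring_1 mpoly"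
  assumes "finite S" "keys p \<subseteq> S"
  shows "partial_deriv i p = (\<Sum>m\<in>S. single (m - single i 1)
       (of_nat (lookup m i) * lookup p m))"
  unfolding partial_deriv_def using assms
  by (intro sum.mono_neutral_left) (auto simp: in_keys_iff)

lemma partial_deriv_single:
  "partial_deriv i (single m (a::'a::comm_ring_1)) =
    single (m - single i 1) (of_nat (lookup m i) * a)"
  using partial_deriv_superset[of "{m}" "single m a" i] by simp

lemma partial_deriv_zero [simp]: "partial_deriv i (0::'a::comm_ring_1 mpoly) = 0"
  by (simp add: partial_deriv_def)

lemma partial_deriv_add:
  "partial_deriv i (p + q :: 'a::comm_ring_1 mpoly) = partial_deriv i p + partial_deriv i q"
proof -
  have "keys (p + q) \<subseteq> keys p \<union> keys q" by (rule Poly_Mapping.keys_add)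
  then show ?thesis
    by (simp add: partial_deriv_superset[of "keys p \<union> keys q"] lookup_add distrib_left
      single_add sum.distrib)
qed

lemma partial_deriv_sum:
  "partial_deriv i (sum f A :: 'a::comm_ring_1 mpoly) = (\<Sum>j\<in>A. partial_deriv i (f j))"
  by (induction A rule: infinite_finite_induct) (simp_all add: partial_deriv_add)

lemma partial_deriv_mult_single:
  fixes a b :: "'a::comm_ring_1"
  shows "partial_deriv i (single m a * single m' b) =
    partial_deriv i (single m a) * single m' b +
    single m a * partial_deriv i (single m' b)"
proof -
  let ?e = "single i (1::nat)"
  have 1: "m + m' - ?e = m - ?e + m'" if "lookup m i \<noteq> 0"
    by (rule poly_mapping_eqI) (use that in \<open>auto simp: lookup_add lookup_minus lookup_single when_def\<close>)
  have 2: "m + m' - ?e = m + (m' - ?e)" if "lookup m' i \<noteq> 0"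
    by (rule poly_mapping_eqI) (use that in \<open>auto simp: lookup_add lookup_minus lookup_single when_def\<close>)
  \<comment> \<open>When \<open>lookup m i\<close> is 0, truncated subtraction may make the two
    exponents differ, but then both coefficients are 0 as well.\<close>
  have "single (m + m' - ?e) (of_nat (lookup m i) * (a * b)) =
      single (m - ?e + m') (of_nat (lookup m i) * (a * b))"
    using 1 by (cases "lookup m i = 0") auto
  moreover have "single (m + m' - ?e) (of_nat (lookup m' i) * (a * b)) =
      single (m + (m' - ?e)) (of_nat (lookup m' i) * (a * b))"
    using 2 by (cases "lookup m' i = 0") auto
  ultimately show ?thesis
    by (simp add: partial_deriv_single mult_single lookup_add distrib_right distrib_left
      single_add mult.assoc mult.left_commute)
qed

lemma partial_deriv_mult:
  fixes p q :: "'a::comm_ring_1 mpoly"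
  shows "partial_deriv i (p * q) = partial_deriv i p * q + p * partial_deriv i q"
proof -
  let ?p = "\<lambda>m. single m (lookup p m)" and ?q = "\<lambda>m. single m (lookup q m)"
  have "partial_deriv i ((\<Sum>m\<in>keys p. ?p m) * (\<Sum>m\<in>keys q. ?q m)) =
    partial_deriv i (\<Sum>m\<in>keys p. ?p m) * (\<Sum>m\<in>keys q. ?q m) +
    (\<Sum>m\<in>keys p. ?p m) * partial_deriv i (\<Sum>m\<in>keys q. ?q m)"
    unfolding sum_product partial_deriv_sum
    by (simp add: partial_deriv_mult_single sum.distrib sum_product)
  then show ?thesis by (simp flip: sum_singles)
qed

lemma partial_deriv_Const [simp]: "partial_deriv i (Const (a::'a::comm_ring_1)) = 0"
  by (simp add: Const_def partial_deriv_single)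

lemma partial_deriv_one [simp]: "partial_deriv i (1::'a::comm_ring_1 mpoly) = 0"
  using partial_deriv_Const[of i "1::'a"] by (simp add: Const_def)

lemma partial_deriv_Var [simp]:
  "partial_deriv i (Var j :: 'a::comm_ring_1 mpoly) = (if i = j then 1 else 0)"
  by (simp add: Var_def partial_deriv_single lookup_single when_def)

lemma over_partial_deriv:
  assumes "subring R" "over R (p::'a::comm_ring_1 mpoly)" shows "over R (partial_deriv i p)"
  unfolding partial_deriv_def using assms
  by (intro over_sum over_single subringD subring_of_nat overD)

lemma poly_ring_partial_deriv:
  assumes "(p::'a::comm_ring_1 mpoly) \<in> poly_ring n" shows "partial_deriv i p \<in> poly_ring n"
  unfolding partial_deriv_def
proof (intro poly_ring_sum poly_ring_single)
  fix m assume "m \<in> keys p"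
  then have "keys m \<subseteq> {..<n}" using assms by (auto simp: poly_ring_def)
  moreover have "keys (m - single i 1) \<subseteq> keys m"
    by (auto simp: in_keys_iff lookup_minus)
  ultimately show "keys (m - single i 1) \<subseteq> {..<n}" by blast
qed

text \<open>For fixed \<open>g\<close> both sides are derivations along the homomorphism that
  evaluates \<open>p\<close>, and they agree on constants and variables. With \<open>g = Var\<close>
  this says that coefficient maps commute with differentiation.\<close>

lemma chain_rule:
  fixes h :: "'a::comm_ring_1 \<Rightarrow> 'b::comm_ring_1"
  assumes h: "hom_on R h" and p: "over R p" "p \<in> poly_ring n"
  shows "partial_deriv j (eval_with (\<lambda>a. Const (h a)) g p) =
    (\<Sum>l<n. eval_with (\<lambda>a. Const (h a)) g (partial_deriv l p) * partial_deriv j (g l))"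
proof -
  note R = hom_onD(1)[OF h]
  note c1 = hom_on_Const_compose[OF h]
  note s = eval_with_add[OF c1] eval_with_mult[OF c1] over_partial_deriv[OF R] over_mult[OF R] over_add[OF R]
  show ?thesis
    using R p
  proof (induction rule: mpoly_induct)
    case (Const c)
    then show ?case by (simp add: eval_with_Const[OF c1] eval_with_zero[OF c1])
  next
    case (Var i)
    then show ?case 
      by (simp add: eval_with_Var[OF c1] if_distrib[of "eval_with _ _"] if_distrib[of "\<lambda>a. a * _"] 
         eval_with_zero[OF c1] eval_with_one[OF c1] sum.delta cong: if_cong)
  next
    case (add p q)
    then show ?case
      by (simp add: s partial_deriv_add sum.distrib distrib_right)
  next
    case (mult p q)
    then show ?case
      by (simp add: s partial_deriv_mult sum.distrib distrib_right distrib_left sum_distrib_left sum_distrib_right mult_ac)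
  qed
qed

section \<open>Degrees and filtrations\<close>

definition mdeg :: "(nat \<Rightarrow>\<^sub>0 nat) \<Rightarrow> nat" where
  "mdeg m = (\<Sum>i\<in>keys m. lookup m i)"

lemma mdeg_superset: "finite S \<Longrightarrow> keys m \<subseteq> S \<Longrightarrow> mdeg m = (\<Sum>i\<in>S. lookup m i)"
  unfolding mdeg_def by (intro sum.mono_neutral_left) (auto simp: in_keys_iff)

lemma mdeg_add: "mdeg (m + m') = mdeg m + mdeg m'"
proof -
  let ?S = "keys m \<union> keys m'"
  have "keys (m + m') \<subseteq> ?S" by (rule Poly_Mapping.keys_add)
  then show ?thesis
    by (simp add: mdeg_superset[of ?S] lookup_add sum.distrib)
qed

lemma mdeg_zero [simp]: "mdeg 0 = 0"
  by (simp add: mdeg_def)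

lemma mdeg_single [simp]: "mdeg (single i e) = e"
  by (cases "e = 0") (simp_all add: mdeg_def)

lemma lookup_le_mdeg: "lookup m i \<le> mdeg m"
proof (cases "i \<in> keys m")
  case True
  then show ?thesis unfolding mdeg_def by (intro member_le_sum) auto
qed (simp add: in_keys_iff)

lemma mdeg_eq_0_iff: "mdeg m = 0 \<longleftrightarrow> m = 0"
proof
  assume "mdeg m = 0"
  then have "lookup m i = 0" for i using lookup_le_mdeg[of m i] by simp
  then show "m = 0" by (intro poly_mapping_eqI) simp
qed simp

lemma ex_in_keys: "p \<noteq> 0 \<Longrightarrow> \<exists>k. k \<in> keys p"
  using poly_mapping_eqI[of p 0] unfolding in_keys_iff lookup_zero by blast

lemma mdeg_eq_1_iff: "mdeg m = 1 \<longleftrightarrow> (\<exists>i. m = single i 1)"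
proof
  assume m: "mdeg m = 1"
  then have "m \<noteq> 0" by auto
  then obtain i where i: "i \<in> keys m" using ex_in_keys by blast
  define m' where "m' = m - single i 1"
  have "m = single i 1 + m'"
    unfolding m'_def using i
    by (intro poly_mapping_eqI) (auto simp: lookup_add lookup_minus lookup_single when_def in_keys_iff)
  then have "mdeg m' = 0" using m mdeg_add[of "single i 1" m'] by simp
  then show "\<exists>i. m = single i 1"
    using \<open>m = _\<close> mdeg_eq_0_iff by auto
qed auto

definition degs_in :: "nat set \<Rightarrow> 'a::zero mpoly \<Rightarrow> bool" where
  "degs_in S p \<longleftrightarrow> (\<forall>m\<in>keys p. mdeg m \<in> S)"

lemma degs_in_mono: "degs_in S p \<Longrightarrow> S \<subseteq> T \<Longrightarrow> degs_in T p"
  by (auto simp: degs_in_def)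

lemma degs_in_alt: "degs_in S p \<longleftrightarrow> (\<forall>m. mdeg m \<notin> S \<longrightarrow> lookup p m = 0)"
  by (auto simp: degs_in_def in_keys_iff)

lemma degs_in_zero [simp]: "degs_in S 0"
  by (simp add: degs_in_def)

lemma degs_in_add: "degs_in S p \<Longrightarrow> degs_in S q \<Longrightarrow> degs_in S (p + q)"
  by (simp add: degs_in_alt lookup_add)

lemma degs_in_uminus: "degs_in S (p::'a::comm_ring_1 mpoly) \<Longrightarrow> degs_in S (- p)"
  by (simp add: degs_in_alt)

lemma degs_in_diff: "degs_in S (p::'a::comm_ring_1 mpoly) \<Longrightarrow> degs_in S q \<Longrightarrow> degs_in S (p - q)"
  by (simp add: degs_in_alt lookup_minus)

lemma degs_in_sum: "(\<And>i. i \<in> A \<Longrightarrow> degs_in S (f i)) \<Longrightarrow> degs_in S (sum f A)"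
  by (induction A rule: infinite_finite_induct) (auto intro: degs_in_add)

lemma degs_in_single: "mdeg m \<in> S \<Longrightarrow> degs_in S (single m a)"
  by (simp add: degs_in_def)

lemma degs_in_Const [simp]: "0 \<in> S \<Longrightarrow> degs_in S (Const a)"
  by (simp add: Const_def degs_in_single)

lemma degs_in_one [simp]: "0 \<in> S \<Longrightarrow> degs_in S 1"
  by (simp add: degs_in_def)

lemma degs_in_Var [simp]: "1 \<in> S \<Longrightarrow> degs_in S (Var i)"
  by (simp add: Var_def degs_in_single)

lemma degs_in_mult:
  assumes "degs_in S (p::'a::comm_ring_1 mpoly)" "degs_in T q"
    and "\<And>s t. s \<in> S \<Longrightarrow> t \<in> T \<Longrightarrow> s + t \<in> U"
  shows "degs_in U (p * q)"
  unfolding mult_singles using assms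
  by (intro degs_in_sum degs_in_single) (auto simp: mdeg_add degs_in_def)

lemma degs_in_power:
  assumes "degs_in {..b} (p::'a::comm_ring_1 mpoly)"
  shows "degs_in {..e * b} (p ^ e)"
proof (induction e)
  case (Suc e)
  then show ?case
    using degs_in_mult[OF assms Suc, of "{..Suc e * b}"] by simp
qed simp

lemma degs_in_mon_le:
  assumes "\<And>i. i \<in> keys m \<Longrightarrow> degs_in {..b} (g i :: 'a::comm_ring_1 mpoly)"
  shows "degs_in {..b * mdeg m} (mon_eval g m)"
proof -
  have "degs_in {..b * (\<Sum>i\<in>A. lookup m i)} (\<Prod>i\<in>A. g i ^ lookup m i)" if "finite A" "A \<subseteq> keys m" for A
    using that
  proof (induction A rule: finite_induct)
    case (insert i A)
    then have "degs_in {..lookup m i * b} (g i ^ lookup m i)"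
      using assms by (intro degs_in_power) auto
    with insert show ?case
      by (auto simp: algebra_simps intro!: degs_in_mult[of "{..lookup m i * b}" _ "{..b * (\<Sum>i\<in>A. lookup m i)}"])
  qed simp
  from this[of "keys m"] show ?thesis by (simp add: mon_eval_def mdeg_def)
qed

lemma degs_in_mon_linear:
  assumes "\<And>i. i \<in> keys m \<Longrightarrow> degs_in {1} (g i :: 'a::comm_ring_1 mpoly)"
  shows "degs_in {mdeg m} (mon_eval g m)"
proof -
  have pow: "degs_in {e} (p ^ e)" if "degs_in {1} p" for e and p :: "'a mpoly"
    by (induction e) (auto intro!: degs_in_mult[OF that])
  have "degs_in {(\<Sum>i\<in>A. lookup m i)} (\<Prod>i\<in>A. g i ^ lookup m i)" if "finite A" "A \<subseteq> keys m" for A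
    using that
  proof (induction A rule: finite_induct)
    case (insert i A)
    then have "degs_in {lookup m i} (g i ^ lookup m i)"
      using assms by (intro pow) auto
    with insert show ?case
      by (auto intro!: degs_in_mult[of "{lookup m i}" _ "{\<Sum>i\<in>A. lookup m i}"])
  qed simp
  from this[of "keys m"] show ?thesis by (simp add: mon_eval_def mdeg_def)
qed

lemma degs_in_linear_subst:
  assumes "degs_in S p" "p \<in> poly_ring n" "\<And>i. i < n \<Longrightarrow> degs_in {1} (g i :: 'b::comm_ring_1 mpoly)"
  shows "degs_in S (eval_with (\<lambda>a. Const (h a)) g p)"
  unfolding eval_with_mon
proof (intro degs_in_sum)
  fix m assume m: "m \<in> keys p"
  have "degs_in {mdeg m} (mon_eval g m)"
    using assms(2,3) m by (intro degs_in_mon_linear) (auto dest: poly_ringD)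
  then have "degs_in {mdeg m} (Const (h (lookup p m)) * mon_eval g m)"
    by (intro degs_in_mult[of "{0}" _ "{mdeg m}"]) auto
  then show "degs_in S (Const (h (lookup p m)) * mon_eval g m)"
    using assms(1) m by (auto simp: degs_in_def)
qed

text \<open>An abstract decreasing filtration with two instances below: the order of vanishing of
  polynomials at the origin, and divisibility of integers by powers of a number. The formal inverse
  and the Hensel argument thereby rest on one and the same estimate.\<close>

definition filtration :: "(nat \<Rightarrow> 'r::comm_ring_1 set) \<Rightarrow> bool" where
  "filtration I \<longleftrightarrow> I 0 = UNIV \<and> (\<forall>a. 0 \<in> I a \<and> I (Suc a) \<subseteq> I a) \<and>
    (\<forall>a. \<forall>x\<in>I a. \<forall>y\<in>I a. x + y \<in> I a) \<and>
    (\<forall>a b. \<forall>x\<in>I a. \<forall>y\<in>I b. x * y \<in> I (a + b))"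

lemma filtrationD:
  assumes "filtration I"
  shows "x \<in> I 0" "0 \<in> I a" "x \<in> I a \<Longrightarrow> y \<in> I a \<Longrightarrow> x + y \<in> I a"
    "x \<in> I a \<Longrightarrow> y \<in> I b \<Longrightarrow> x * y \<in> I (a + b)"
    "x \<in> I a \<Longrightarrow> r * x \<in> I a" "x \<in> I a \<Longrightarrow> - x \<in> I a" "x \<in> I a \<Longrightarrow> b \<le> a \<Longrightarrow> x \<in> I b"
    "x \<in> I a \<Longrightarrow> y \<in> I a \<Longrightarrow> x - y \<in> I a"
proof -
  have *: "\<And>x. x \<in> I 0" "\<And>a. 0 \<in> I a" "\<And>x y a. x \<in> I a \<Longrightarrow> y \<in> I a \<Longrightarrow> x + y \<in> I a"
    "\<And>x y a b. x \<in> I a \<Longrightarrow> y \<in> I b \<Longrightarrow> x * y \<in> I (a + b)" "\<And>a. I (Suc a) \<subseteq> I a"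
    using assms by (auto simp: filtration_def)
  show "x \<in> I 0" "0 \<in> I a" "x \<in> I a \<Longrightarrow> y \<in> I a \<Longrightarrow> x + y \<in> I a"
    "x \<in> I a \<Longrightarrow> y \<in> I b \<Longrightarrow> x * y \<in> I (a + b)" by (rule *; assumption)+
  have r: "x \<in> I a \<Longrightarrow> r * x \<in> I a" for x r a using *(4)[OF *(1)[of r], of x a] by simp
  then show "x \<in> I a \<Longrightarrow> r * x \<in> I a" by blast
  have m: "- x \<in> I a" if "x \<in> I a" for x using r[OF that, of "-1"] by simp
  then show "x \<in> I a \<Longrightarrow> - x \<in> I a" by blast
  show "x \<in> I a \<Longrightarrow> y \<in> I a \<Longrightarrow> x - y \<in> I a" using m *(3)[of x a "-y"] by simp
  show "x \<in> I b" if "x \<in> I a" "b \<le> a"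
    using lift_Suc_antimono_le[of I b a] *(5) that by blast
qed

lemma filtration_sum:
  "filtration I \<Longrightarrow> (\<And>i. i \<in> A \<Longrightarrow> f i \<in> I a) \<Longrightarrow> sum f A \<in> I a"
  by (induction A rule: infinite_finite_induct) (auto intro: filtrationD)

text \<open>In a telescoped difference of two products of e factors, one factor is a difference in
  \<open>I (Suc a)\<close> and the e - 1 others lie in \<open>I 1\<close>, which gives order a + e.
  The induction tracks the two products and their difference together as \<open>P\<close>.\<close>

lemma filtration_mon_diff:
  assumes I: "filtration I"
    and "\<And>i. i \<in> keys m \<Longrightarrow> x i \<in> I 1" "\<And>i. i \<in> keys m \<Longrightarrow> y i \<in> I 1"
    and "\<And>i. i \<in> keys m \<Longrightarrow> x i - y i \<in> I (Suc a)"
  shows "mon_eval x m - mon_eval y m \<in> I (a + mdeg m)" and "mon_eval x m \<in> I (mdeg m)"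
proof -
  define P where "P u v d \<longleftrightarrow> u \<in> I d \<and> v \<in> I d \<and> u - v \<in> I (a + d)" for u v d
  have P1: "P 1 1 0" by (simp add: P_def filtrationD(1,2)[OF I])
  have PM: "P (u * u') (v * v') (d + d')" if "P u v d" "P u' v' d'" for u v d u' v' d'
  proof -
    have "u * u' - v * v' = u * (u' - v') + (u - v) * v'" by (simp add: algebra_simps)
    moreover have "u * (u' - v') \<in> I (a + (d + d'))"
      using filtrationD(4)[OF I, of u d "u' - v'" "a + d'"] that by (simp add: P_def ac_simps)
    moreover have "(u - v) * v' \<in> I (a + (d + d'))"
      using filtrationD(4)[OF I, of "u - v" "a + d" v' d'] that by (simp add: P_def ac_simps)
    ultimately show ?thesis using that filtrationD(3,4)[OF I]
      unfolding P_def by metis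
  qed
  have PP: "P (u ^ e) (v ^ e) (e * d)" if "P u v d" for u v d e
    by (induction e) (auto intro: P1 PM[OF that])
  have "P (\<Prod>i\<in>A. x i ^ lookup m i) (\<Prod>i\<in>A. y i ^ lookup m i) (\<Sum>i\<in>A. lookup m i)"
    if "finite A" "A \<subseteq> keys m" for A
    using that
  proof (induction A rule: finite_induct)
    case (insert i A)
    then have "P (x i) (y i) 1" using assms by (auto simp: P_def)
    then have "P (x i ^ lookup m i) (y i ^ lookup m i) (lookup m i)" using PP by force
    with insert show ?case by (simp add: PM)
  qed (simp add: P1)
  from this[of "keys m"] have "P (mon_eval x m) (mon_eval y m) (mdeg m)" by (simp add: mon_eval_def mdeg_def)
  then show "mon_eval x m - mon_eval y m \<in> I (a + mdeg m)" and "mon_eval x m \<in> I (mdeg m)" by (simp_all add: P_def)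
qed

text \<open>For \<open>b = 2\<close> this is a contraction: terms of order at least two turn an
  agreement modulo \<open>I (Suc a)\<close> into one modulo \<open>I (a + 2)\<close>.\<close>

lemma filtration_eval_diff:
  assumes I: "filtration I" and p: "p \<in> poly_ring n" "degs_in {b..} p"
    and "\<And>i. i < n \<Longrightarrow> x i \<in> I 1" "\<And>i. i < n \<Longrightarrow> y i \<in> I 1"
    and "\<And>i. i < n \<Longrightarrow> x i - y i \<in> I (Suc a)"
  shows "eval_with h x p - eval_with h y p \<in> I (a + b)"
proof -
  have "eval_with h x p - eval_with h y p = (\<Sum>m\<in>keys p. h (lookup p m) * (mon_eval x m - mon_eval y m))"
    by (simp add: eval_with_mon sum_subtractf algebra_simps)
  also have "\<dots> \<in> I (a + b)"
  proof (intro filtration_sum[OF I] filtrationD(5)[OF I])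
    fix m assume m: "m \<in> keys p"
    have "mon_eval x m - mon_eval y m \<in> I (a + mdeg m)"
      using assms m by (intro filtration_mon_diff(1)) (auto dest: poly_ringD)
    moreover have "b \<le> mdeg m" using p(2) m by (auto simp: degs_in_def)
    ultimately show "mon_eval x m - mon_eval y m \<in> I (a + b)" 
      using filtrationD(7)[OF I, of _ "a + mdeg m" "a + b"] by simp
  qed
  finally show ?thesis .
qed

lemma filtration_eval:
  assumes I: "filtration I" and p: "p \<in> poly_ring n" "degs_in {b..} p"
    and "\<And>i. i < n \<Longrightarrow> x i \<in> I 1"
  shows "eval_with h x p \<in> I b"
  unfolding eval_with_mon
proof (intro filtration_sum[OF I] filtrationD(5)[OF I])
  fix m assume m: "m \<in> keys p"
  have "mon_eval x m \<in> I (mdeg m)"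
    using assms m by (intro filtration_mon_diff(2)[where y = x and a = 0])
      (auto dest: poly_ringD simp: filtrationD(1,2)[OF I])
  moreover have "b \<le> mdeg m" using p(2) m by (auto simp: degs_in_def)
  ultimately show "mon_eval x m \<in> I b" 
    using filtrationD(7)[OF I, of _ "mdeg m" b] by simp
qed

lemma filtration_order: "filtration (\<lambda>a. {p::'a::comm_ring_1 mpoly. degs_in {a..} p})"
  by (auto simp: filtration_def intro: degs_in_add intro!: degs_in_mult[of "{_..}" _ "{_..}"])
     (auto simp: degs_in_def)

lemma filtration_dvd: "filtration (\<lambda>a. {z::int. c ^ a dvd z})"
  by (auto simp: filtration_def power_add intro: mult_dvd_mono dvd_mult_right)

definition deg_filter :: "nat set \<Rightarrow> 'a::comm_ring_1 mpoly \<Rightarrow> 'a mpoly" where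
  "deg_filter S p = (\<Sum>m\<in>{m\<in>keys p. mdeg m \<in> S}. single m (lookup p m))"

lemma lookup_deg_filter: "lookup (deg_filter S p) m = (if mdeg m \<in> S then lookup p m else 0)"
  by (auto simp: deg_filter_def lookup_sum lookup_single when_def in_keys_iff sum.delta)

lemma poly_ring_deg_filter: "p \<in> poly_ring n \<Longrightarrow> deg_filter S p \<in> poly_ring n"
  unfolding deg_filter_def by (intro poly_ring_sum poly_ring_single) (auto simp: poly_ring_def)

section \<open>Nonvanishing of a polynomial at some integral point\<close>

lemma digits_unique:
  assumes "(\<Sum>i<n. f i * B ^ i) = (\<Sum>i<n. g i * B ^ i)"
    and "\<And>i. i < n \<Longrightarrow> f i < B" "\<And>i. i < n \<Longrightarrow> g i < (B::nat)" and "i < n"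
  shows "f i = g i"
  using assms
proof (induction n arbitrary: f g i)
  case (Suc n)
  have B: "B > 0" using Suc.prems(2)[of 0] by simp
  have shift: "(\<Sum>i<Suc n. h i * B ^ i) = h 0 + B * (\<Sum>i<n. h (Suc i) * B ^ i)" for h :: "nat \<Rightarrow> nat"
    unfolding sum.lessThan_Suc_shift by (simp add: sum_distrib_left mult_ac)
  have eq: "f 0 + B * (\<Sum>i<n. f (Suc i) * B ^ i) = g 0 + B * (\<Sum>i<n. g (Suc i) * B ^ i)"
    using Suc.prems(1) unfolding shift .
  have 0: "f 0 = g 0"
    using arg_cong[OF eq, of "\<lambda>x. x mod B"] Suc.prems(2,3)[of 0] by simp
  then have "(\<Sum>i<n. f (Suc i) * B ^ i) = (\<Sum>i<n. g (Suc i) * B ^ i)" using eq B by simp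
  then have "f (Suc j) = g (Suc j)" if "j < n" for j
    using Suc.IH[of "\<lambda>i. f (Suc i)" "\<lambda>i. g (Suc i)"] Suc.prems(2,3) that by simp
  with 0 Suc.prems(4) show ?case by (cases i) auto
qed simp

text \<open>Kronecker substitution: X_i goes to t^(B^i) with B above every degree that occurs, so
  the exponents of a monomial become the base-B digits of an exponent of t and no two monomials
  collide. What remains is a nonzero polynomial in t, with finitely many roots.\<close>

lemma ex_int_point_nonzero:
  fixes p :: "'a::{idom,ring_char_0} mpoly"
  assumes p: "p \<in> poly_ring n" "p \<noteq> 0"
  shows "\<exists>v::nat \<Rightarrow> int. eval_with (\<lambda>c. c) (\<lambda>i. of_int (v i)) p \<noteq> 0"
proof -
  obtain B where B: "\<forall>d\<in>mdeg ` keys p. d < B"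
    using finite_nat_set_iff_bounded[of "mdeg ` keys p"] by auto
  define code where "code m = (\<Sum>i<n. lookup m i * B ^ i)" for m
  have inj: "m = m'" if "m \<in> keys p" "m' \<in> keys p" "code m = code m'" for m m'
  proof (rule poly_mapping_eqI)
    fix i
    have less: "lookup k j < B" if "k \<in> keys p" for k j
      using B that lookup_le_mdeg[of k j] by fastforce
    show "lookup m i = lookup m' i"
    proof (cases "i < n")
      case True
      then show ?thesis using digits_unique[OF that(3)[unfolded code_def] less less] that by blast
    next
      case False
      then have "i \<notin> keys m" "i \<notin> keys m'" using p(1) that by (auto dest: poly_ringD)
      then show ?thesis by (simp add: in_keys_iff)
    qed
  qed
  define q where "q = (\<Sum>m\<in>keys p. Polynomial.monom (lookup p m) (code m))"
  obtain m0 where m0: "m0 \<in> keys p" using ex_in_keys[OF p(2)] by blast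
  have "Polynomial.coeff q (code m0) = (\<Sum>m\<in>keys p. if m = m0 then lookup p m else 0)"
    unfolding q_def coeff_sum coeff_monom using inj m0 by (intro sum.cong) auto
  also have "\<dots> = lookup p m0" using m0 by simp
  finally have "q \<noteq> 0" using m0 by (auto simp: in_keys_iff)
  then have "finite {t. poly q t = 0}" by (rule poly_roots_finite)
  moreover have "infinite (range (of_nat :: nat \<Rightarrow> 'a))"
    by (intro range_inj_infinite) (simp add: inj_on_def)
  ultimately have "\<not> range of_nat \<subseteq> {t. poly q t = 0}"
    using finite_subset by blast
  then obtain u :: nat where u: "poly q (of_nat u) \<noteq> 0" by auto
  define t where "t = int u"
  have t: "poly q (of_int t) \<noteq> 0" using u by (simp add: t_def)
  have "poly q (of_int t) = eval_with (\<lambda>c. c) (\<lambda>i. of_int (t ^ (B ^ i))) p"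
    unfolding q_def poly_sum poly_monom eval_with_mon
  proof (intro sum.cong refl)
    fix m assume m: "m \<in> keys p"
    have "mon_eval (\<lambda>i. (of_int (t ^ (B ^ i)) :: 'a)) m = (\<Prod>i<n. of_int (t ^ (B ^ i)) ^ lookup m i)"
      using p(1) m by (intro mon_eval_superset) (auto dest: poly_ringD)
    also have "\<dots> = of_int t ^ code m"
      by (simp add: code_def power_sum mult.commute flip: power_mult)
    finally show "lookup p m * of_int t ^ code m = lookup p m * mon_eval (\<lambda>i. of_int (t ^ B ^ i)) m"
      by simp
  qed
  with t have "eval_with (\<lambda>c. c) (\<lambda>i. of_int (t ^ (B ^ i))) p \<noteq> 0" by simp
  then show ?thesis by (rule exI[of _ "\<lambda>i. t ^ (B ^ i)"])
qed

section \<open>Truncated inverses of a polynomial map\<close>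

abbreviation sub :: "(nat \<Rightarrow> 'a::comm_ring_1 mpoly) \<Rightarrow> 'a mpoly \<Rightarrow> 'a mpoly" where
  "sub g p \<equiv> eval_with Const g p"

abbreviation ev :: "(nat \<Rightarrow> 'a::comm_ring_1) \<Rightarrow> 'a mpoly \<Rightarrow> 'a" where
  "ev x p \<equiv> eval_with (\<lambda>c. c) x p"

lemmas sub_simps = eval_with_zero[OF hom_on_Const] eval_with_one[OF hom_on_Const]
  eval_with_Const[OF hom_on_Const] eval_with_Var[OF hom_on_Const]
  eval_with_add[OF hom_on_Const over_UNIV over_UNIV] eval_with_diff[OF hom_on_Const over_UNIV over_UNIV]
  eval_with_mult[OF hom_on_Const over_UNIV over_UNIV] eval_with_sum[OF hom_on_Const over_UNIV]

lemmas ev_simps = eval_with_zero[OF hom_on_id] eval_with_one[OF hom_on_id]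
  eval_with_Const[OF hom_on_id] eval_with_Var[OF hom_on_id]
  eval_with_add[OF hom_on_id over_UNIV over_UNIV] eval_with_diff[OF hom_on_id over_UNIV over_UNIV]
  eval_with_mult[OF hom_on_id over_UNIV over_UNIV] eval_with_sum[OF hom_on_id over_UNIV]

lemma sub_sub: "sub g (sub f p) = sub (\<lambda>i. sub g (f i)) p"
proof -
  obtain n where "p \<in> poly_ring n" using ex_poly_ring by blast
  then show ?thesis
    using eval_with_comp[OF hom_on_id hom_on_Const, of p n f g] by simp
qed

lemma ev_sub: "ev x (sub f p) = ev (\<lambda>i. ev x (f i)) p"
proof -
  obtain n where "p \<in> poly_ring n" using ex_poly_ring by blast
  then show ?thesis
    using eval_with_comp[OF hom_on_id hom_on_id, of p n f x] by simp
qed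

lemma sub_Var: "sub Var p = p"
  by (subst (2) sum_singles) (simp add: eval_with_mon single_eq_Const_mon)

lemma sub_Var_cong: "p \<in> poly_ring n \<Longrightarrow> (\<And>i. i < n \<Longrightarrow> g i = Var i) \<Longrightarrow> sub g p = p"
  using eval_with_cong[of p n g Var Const Const] by (simp add: sub_Var)

lemma chain_rule_sub:
  "p \<in> poly_ring n \<Longrightarrow>
    partial_deriv j (sub g p) = (\<Sum>l<n. sub g (partial_deriv l p) * partial_deriv j (g l))"
  using chain_rule[OF hom_on_id over_UNIV, of p n j g] by simp

lemma poly_ring_mon: "(\<And>i. i \<in> keys m \<Longrightarrow> g i \<in> poly_ring n) \<Longrightarrow> (mon_eval g m :: 'a::comm_ring_1 mpoly) \<in> poly_ring n"
  unfolding mon_eval_def by (intro poly_ring_prod poly_ring_power)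

lemma poly_ring_eval:
  assumes "p \<in> poly_ring n" "\<And>i. i < n \<Longrightarrow> g i \<in> poly_ring n'"
  shows "(eval_with (\<lambda>a. Const (h a)) g p :: 'b::comm_ring_1 mpoly) \<in> poly_ring n'"
  unfolding eval_with_mon using assms
  by (intro poly_ring_sum poly_ring_mult poly_ring_Const poly_ring_mon) (auto dest: poly_ringD)

lemma over_eval:
  assumes "subring R" "\<And>m. h (lookup p m) \<in> R" "p \<in> poly_ring n" "\<And>i. i < n \<Longrightarrow> over R (g i)"
  shows "over R (eval_with (\<lambda>a. Const (h a)) g p :: 'b::comm_ring_1 mpoly)"
  unfolding eval_with_mon using assms
  by (intro over_sum over_mult over_Const over_mon) (auto dest: poly_ringD)

lemma over_sub:
  "subring R \<Longrightarrow> over R p \<Longrightarrow> p \<in> poly_ring n \<Longrightarrow> (\<And>i. i < n \<Longrightarrow> over R (g i)) \<Longrightarrow> over R (sub g p)"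
  using over_eval[of R "\<lambda>a. a" p n g] by (simp add: overD)

lemma ev_at_zero: "ev (\<lambda>i. 0) p = lookup p 0"
proof -
  have "mon_eval (\<lambda>i. 0 :: 'a) m = (if m = 0 then 1 else 0)" for m
  proof (cases "m = 0")
    case False
    then obtain i where "i \<in> keys m" using ex_in_keys by blast
    then show ?thesis using False
      by (auto simp: mon_eval_def in_keys_iff power_0_left intro!: prod_zero)
  qed simp
  then show ?thesis
    by (simp add: eval_with_mon if_distrib[of "\<lambda>a. _ * a"] in_keys_iff cong: if_cong)
qed

lemma lookup_partial_deriv:
  fixes p :: "'a::comm_ring_1 mpoly"
  shows "lookup (partial_deriv i p) m =
    of_nat (Suc (lookup m i)) * lookup p (m + single i 1)"
proof -
  let ?e = "single i (1::nat)"
  have "(of_nat (lookup k i) * lookup p k when k - ?e = m) =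
    (if k = m + ?e then of_nat (lookup k i) * lookup p k else 0)" for k
  proof (cases "lookup k i = 0")
    case True
    moreover have "lookup (m + ?e) i \<noteq> 0" by (simp add: lookup_add)
    ultimately show ?thesis by auto
  next
    case False
    then have "k = (k - ?e) + ?e"
      by (intro poly_mapping_eqI) (auto simp: lookup_add lookup_minus lookup_single when_def)
    moreover have "m + ?e - ?e = m" by simp
    ultimately have "k - ?e = m \<longleftrightarrow> k = m + ?e" by metis
    then show ?thesis by simp
  qed
  then show ?thesis
    by (simp add: partial_deriv_def lookup_sum lookup_single lookup_add in_keys_iff
      del: of_nat_Suc)
qed

lemma degs_in_ge_2I:
  assumes "lookup p 0 = 0" "\<And>i. lookup p (single i 1) = 0"
  shows "degs_in {2..} p"
  unfolding degs_in_alt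
proof (intro allI impI)
  fix m assume "mdeg m \<notin> {2..}"
  then have "mdeg m = 0 \<or> mdeg m = 1" by auto
  then show "lookup p m = 0" using assms unfolding mdeg_eq_0_iff mdeg_eq_1_iff by auto
qed

lemma order_all_zero: 
  assumes "\<And>j. j \<ge> j0 \<Longrightarrow> degs_in {j..} p" shows "p = 0"
proof (rule poly_mapping_eqI)
  fix m show "lookup p m = lookup 0 m"
    using assms[of "max j0 (Suc (mdeg m))"] by (auto simp: degs_in_alt)
qed

text \<open>The part of lowest degree of \<open>p\<close> survives the substitution, because
  \<open>T\<close> is the identity up to terms of order two and so changes \<open>p\<close> only in
  higher degrees.\<close>

lemma sub_inj:
  assumes T: "\<And>i. i < n \<Longrightarrow> degs_in {2..} (T i - Var i)" and p: "p \<in> poly_ring n" "sub T p = 0"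
  shows "p = 0"
proof (rule ccontr)
  assume "p \<noteq> 0"
  then obtain k where "k \<in> keys p" using ex_in_keys by blast
  then obtain m where m: "m \<in> keys p" "\<And>m'. m' \<in> keys p \<Longrightarrow> mdeg m \<le> mdeg m'"
    using arg_min_nat_lemma[of "\<lambda>m. m \<in> keys p" k mdeg] by blast
  have T1: "degs_in {1..} (T i)" if "i < n" for i
    using degs_in_add[of "{1..}" "T i - Var i" "Var i"] degs_in_mono[OF T[OF that], of "{1..}"]
    by auto
  have pm: "degs_in {mdeg m..} p" using m by (auto simp: degs_in_def)
  have "sub T p - sub Var p \<in> {q. degs_in {1 + mdeg m..} q}"
    by (rule filtration_eval_diff[OF filtration_order p(1)])
       (use T T1 pm in \<open>auto simp: numeral_2_eq_2\<close>)
  then have "degs_in {1 + mdeg m..} p"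
    using p(2) degs_in_uminus by (fastforce simp: sub_Var)
  with m(1) show False by (auto simp: degs_in_def)
qed

text \<open>
  A finite certificate, with coefficients in \<open>k\<close>, that the inverse of \<open>F\<close> has a nonzero homogeneous
  component of degree \<open>K\<close>: \<open>G\<close> is the inverse up to terms of degree above \<open>K\<close>. The Keller condition is
  expressed by an inverse \<open>M\<close> of the Jacobian matrix, which is easier to transport than the determinant.
\<close>

definition noninv_data ::
  "'a::comm_ring_1 set \<Rightarrow> nat \<Rightarrow> nat \<Rightarrow> nat \<Rightarrow> (nat \<Rightarrow> 'a mpoly) \<Rightarrow> (nat \<Rightarrow> nat \<Rightarrow> 'a mpoly) \<Rightarrow>
    (nat \<Rightarrow> 'a mpoly) \<Rightarrow> bool" where
  "noninv_data k n d K F M G \<longleftrightarrow>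
    (\<forall>i<n. over k (F i) \<and> over k (G i)) \<and> (\<forall>i<n. \<forall>j<n. over k (M i j)) \<and>
    (\<forall>i<n. F i \<in> poly_ring n \<and> degs_in {..d} (F i) \<and> degs_in {2..} (F i - Var i)) \<and>
    (\<forall>i<n. \<forall>s<n. M i s \<in> poly_ring n) \<and>
    (\<forall>i<n. \<forall>s<n. (\<Sum>j<n. partial_deriv j (F i) * M j s) = (if i = s then 1 else 0)) \<and>
    (\<forall>i<n. G i \<in> poly_ring n \<and> degs_in {1..} (G i) \<and> degs_in {Suc K..} (sub G (F i) - Var i)) \<and>
    (\<exists>i<n. \<exists>m. mdeg m = K \<and> lookup (G i) m \<noteq> 0)"

text \<open>Writing F = X + H, the inverse solves G = X - H(G); these are the iterates of that
  equation from 0. For H of order two, each round makes one more degree correct.\<close>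

primrec inv_approx :: "nat \<Rightarrow> (nat \<Rightarrow> 'a::comm_ring_1 mpoly) \<Rightarrow> nat \<Rightarrow> nat \<Rightarrow> 'a mpoly" where
  "inv_approx n F 0 = (\<lambda>i. 0)"
| "inv_approx n F (Suc j) = (\<lambda>i. if i < n then Var i - sub (inv_approx n F j) (F i - Var i) else 0)"

text \<open>If all components of the formal inverse in degrees above \<open>K0\<close> vanished, its
  truncation \<open>T\<close> at degree \<open>K0\<close> would be a polynomial inverse of
  \<open>F\<close>. The iterate \<open>g K\<close> serves as the certificate for degree
  \<open>K\<close>.\<close>

lemma ex_noninv_data:
  fixes F :: "nat \<Rightarrow> 'a::comm_ring_1 mpoly"
  assumes k: "subring k" and F: "\<And>i. i < n \<Longrightarrow> over k (F i)" "\<And>i. i < n \<Longrightarrow> F i \<in> poly_ring n"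
    "\<And>i. i < n \<Longrightarrow> degs_in {..d} (F i)" "\<And>i. i < n \<Longrightarrow> degs_in {2..} (F i - Var i)"
    and M: "\<And>i s. i < n \<Longrightarrow> s < n \<Longrightarrow> over k (M i s)" "\<And>i s. i < n \<Longrightarrow> s < n \<Longrightarrow> M i s \<in> poly_ring n"
    "\<And>i s. i < n \<Longrightarrow> s < n \<Longrightarrow> (\<Sum>j<n. partial_deriv j (F i) * M j s) = (if i = s then 1 else 0)"
    and noninv: "\<not> (\<exists>T. \<forall>i<n. T i \<in> poly_ring n \<and> sub T (F i) = Var i \<and> sub F (T i) = Var i)"
  shows "\<exists>K>K0. \<exists>G. noninv_data k n d K F M G"
proof -
  let ?I = "\<lambda>a. {p::'a mpoly. degs_in {a..} p}"
  note I = filtration_order[where 'a = 'a]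
  note Isub = filtrationD(8)[OF I] note Iadd = filtrationD(3)[OF I] note Imono = filtrationD(7)[OF I]
  note Iminus = filtrationD(6)[OF I]
  define g where "g = inv_approx n F"
  have gS: "g (Suc j) i = Var i - sub (g j) (F i - Var i)" if "i < n" for i j
    using that by (simp add: g_def)
  have g0: "g 0 i = 0" for i by (simp add: g_def)
  have over: "over k (g j i)" for i j
    unfolding g_def
    by (induction j arbitrary: i)
      (auto intro!: over_zero over_diff over_Var over_sub[of _ _ n] k F poly_ring_diff)
  have Fr: "F i - Var i \<in> poly_ring n" if "i < n" for i using F(2) that by (auto intro: poly_ring_diff)
  have ring: "g j i \<in> poly_ring n" if "i < n" for i j
    using that
  proof (induction j arbitrary: i)
    case (Suc j)
    then show ?case
      unfolding gS[OF Suc.prems]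
      using poly_ring_eval[OF Fr[OF Suc.prems], of "g j" n "\<lambda>a. a"]
      by (intro poly_ring_diff) auto
  qed (simp add: g_def)
  have ord1: "g j i \<in> ?I 1" if "i < n" for i j
    using that
  proof (induction j arbitrary: i)
    case (Suc j)
    have "sub (g j) (F i - Var i) \<in> ?I 2"
      using Suc F(2,4) by (intro filtration_eval[OF I, of _ n]) (auto intro: poly_ring_diff)
    then have "sub (g j) (F i - Var i) \<in> ?I 1" by (rule Imono) simp
    moreover have "Var i \<in> ?I 1" by simp
    ultimately show ?case unfolding gS[OF Suc.prems] using Isub by blast
  qed (simp add: g_def)
  have step: "g (Suc j) i - g j i \<in> ?I (Suc j)" if "i < n" for i j
    using that
  proof (induction j arbitrary: i)
    case 0
    then show ?case using ord1[of i 1] by (simp add: g0)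
  next
    case (Suc j)
    have "sub (g (Suc j)) (F i - Var i) - sub (g j) (F i - Var i) \<in> ?I (j + 2)"
      using Suc F(4)[OF Suc.prems] ord1 by (intro filtration_eval_diff[OF I, of _ n] Fr) auto
    moreover have "g (Suc (Suc j)) i - g (Suc j) i =
      - (sub (g (Suc j)) (F i - Var i) - sub (g j) (F i - Var i))"
      unfolding gS[OF Suc.prems] by simp
    ultimately show ?case using Iminus[of _ "j + 2"] by (metis add_2_eq_Suc')
  qed
  have stable: "g (j + l) i - g j i \<in> ?I (Suc j)" if "i < n" for i j l
  proof (induction l)
    case (Suc l)
    have "g (Suc (j + l)) i - g (j + l) i \<in> ?I (Suc j)"
      by (rule Imono[OF step[OF that]]) simp
    from Iadd[OF this Suc] show ?case by (simp add: algebra_simps)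
  qed simp
  \<comment> \<open>A coefficient of degree at most \<open>j'\<close> has its final value from the
    iterate \<open>j'\<close> on, so the iterates define a formal power series.\<close>
  have stable_lookup: "lookup (g j i) m = lookup (g j' i) m" if "i < n" "mdeg m \<le> j'" "j' \<le> j" for i j j' m
    using stable[OF that(1), of j' "j - j'"] that(2,3) by (auto simp: degs_in_alt lookup_minus)
  have inv: "sub (g j) (F i) - Var i \<in> ?I (Suc j)" if "i < n" for i j
  proof -
    \<comment> \<open>The defect of an iterate is, up to sign, the next correction.\<close>
    have "sub (g j) (F i) - Var i = - (g (Suc j) i - g j i)"
      unfolding gS[OF that] by (simp add: sub_simps)
    then show ?thesis using Iminus[OF step[OF that, of j]] by metis
  qed
  have "\<exists>K>K0. \<exists>i<n. \<exists>m. mdeg m = K \<and> lookup (g K i) m \<noteq> 0"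
  proof (rule ccontr)
    assume neg: "\<not> ?thesis"
    have vanish: "lookup (g j i) m = 0" if "i < n" "K0 < mdeg m" "mdeg m \<le> j" for i j m
      using neg stable_lookup[of i m "mdeg m" j] that by auto
    define T where "T = (\<lambda>i. deg_filter {..K0} (g K0 i))"
    have T: "T i - g j i \<in> ?I (Suc j)" if "i < n" "K0 \<le> j" for i j
      using vanish[OF that(1)] stable_lookup[OF that(1), of _ K0 j] that(2)
      by (auto simp: degs_in_alt lookup_minus T_def lookup_deg_filter)
    have Tring: "T i \<in> poly_ring n" if "i < n" for i
      by (simp add: T_def poly_ring_deg_filter ring that)
    have T1: "T i \<in> ?I 1" if "i < n" for i
      using Iadd[OF Imono[OF T[OF that, of K0], of 1] ord1[OF that, of K0]] by simp
    have F1: "degs_in {1..} (F i)" if "i < n" for i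
      using degs_in_add[OF degs_in_mono[OF F(4)[OF that], of "{1..}"], of "Var i"] by auto
    have TF: "sub T (F i) = Var i" if i: "i < n" for i
    proof -
      have "degs_in {j..} (sub T (F i) - Var i)" if "j \<ge> K0" for j
      proof -
        have "sub T (F i) - sub (g j) (F i) \<in> ?I (j + 1)"
          using T T1 ord1 that F1 i F(2) by (intro filtration_eval_diff[OF I, of _ n]) auto
        from Iadd[OF this, of "sub (g j) (F i) - Var i"] inv[OF i, of j]
        have "sub T (F i) - Var i \<in> ?I (Suc j)" by simp
        from Imono[OF this, of j] show ?thesis by simp
      qed
      from order_all_zero[OF this] show ?thesis by simp
    qed
    have T2: "degs_in {2..} (T i - Var i)" if "i < n" for i
    proof -
      have "sub (g K0) (F i - Var i) \<in> ?I 2"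
        using ord1 F(4)[OF that] by (intro filtration_eval[OF I, of _ n] Fr[OF that]) auto
      then have 1: "g (Suc K0) i - Var i \<in> ?I 2"
        using Iminus[of "sub (g K0) (F i - Var i)" 2] by (simp add: gS[OF that])
      have "T i - g (Suc K0) i \<in> ?I 2" by (rule Imono[OF T[OF that]]) auto
      from Iadd[OF this 1] show ?thesis by simp
    qed
    \<comment> \<open>A right inverse is also a left inverse: F(T) = X gives T(F(T)) = T, and
      substitution of \<open>T\<close> is injective.\<close>
    have "sub F (T i) = Var i" if "i < n" for i
    proof -
      have "sub T (sub F (T i)) = T i"
        unfolding sub_sub by (rule sub_Var_cong[OF Tring[OF that]]) (rule TF)
      then have "sub T (sub F (T i) - Var i) = 0" by (simp add: sub_simps)
      moreover have "sub F (T i) - Var i \<in> poly_ring n"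
        using poly_ring_eval[OF Tring[OF that], of F n "\<lambda>a. a"] F(2) that
        by (intro poly_ring_diff) auto
      ultimately have "sub F (T i) - Var i = 0" using sub_inj[of n T] T2 by blast
      then show ?thesis by simp
    qed
    with TF Tring noninv show False by blast
  qed
  then obtain K where K: "K > K0" "\<exists>i<n. \<exists>m. mdeg m = K \<and> lookup (g K i) m \<noteq> 0" by blast
  have "noninv_data k n d K F M (g K)"
    unfolding noninv_data_def using K F M over ring ord1 inv by auto
  with K show ?thesis by blast
qed

lemma partial_deriv_diff:
  "partial_deriv i (p - q :: 'a::comm_ring_1 mpoly) = partial_deriv i p - partial_deriv i q"
  using partial_deriv_add[of i "p - q" q] by (simp add: algebra_simps)

lemma single_one_eq_iff [simp]:
  "single i (Suc 0) = single s (Suc 0) \<longleftrightarrow> i = s"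
  by (auto dest: arg_cong[of _ _ keys])

text \<open>An affine change of the target: subtract the value at the origin and apply the inverse
  of the Jacobian matrix there, so that the map becomes X plus terms of order two. Neither operation
  affects the existence of a polynomial inverse.\<close>

lemma not_JC_normalized:
  assumes "\<not> jacobian_conjecture TYPE('k::field_char_0)"
  shows "\<exists>n. \<exists>(F::nat \<Rightarrow> 'k mpoly) M.
    (\<forall>i<n. F i \<in> poly_ring n \<and> degs_in {2..} (F i - Var i)) \<and>
    (\<forall>i<n. \<forall>s<n. M i s \<in> poly_ring n \<and> 
       (\<Sum>j<n. partial_deriv j (F i) * M j s) = (if i = s then 1 else 0)) \<and>
    \<not> (\<exists>T. \<forall>i<n. T i \<in> poly_ring n \<and> sub T (F i) = Var i \<and> sub F (T i) = Var i)"
proof -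
  from assms obtain n and Fv :: "'k mpoly vec" where kel: "keller_map n Fv"
    and noinv: "\<not> (\<exists>G\<in>poly_maps n. comp_map Fv G = id_map n \<and> comp_map G Fv = id_map n)"
    unfolding jacobian_conjecture_def JC_def by blast
  define f where "f i = Fv $ i" for i
  have Fv: "Fv \<in> carrier_vec n" and f: "f i \<in> poly_ring n" if "i < n" for i
    using kel that by (auto simp: keller_map_def poly_maps_def f_def)
  have dimFv: "dim_vec Fv = n" using kel by (auto simp: keller_map_def poly_maps_def)
  define J where "J = jacobian n Fv"
  have J: "J \<in> carrier_mat n n" and detJ: "det J = 1"
    using kel by (auto simp: J_def jacobian_def keller_map_def)
  \<comment> \<open>The determinant being 1, the adjugate is a two-sided inverse of the Jacobian
    matrix, and its entries are again polynomials.\<close>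
  define N where "N i j = adj_mat J $$ (i, j)" for i j
  have Jij: "J $$ (i, j) = partial_deriv j (f i)" if "i < n" "j < n" for i j
    using that by (simp add: J_def jacobian_def f_def)
  note adj = adj_mat[OF J]
  have right: "(\<Sum>j<n. partial_deriv j (f i) * N j s) = (if i = s then 1 else 0)" if "i < n" "s < n" for i s
  proof -
    have "(J * adj_mat J) $$ (i, s) = (\<Sum>j<n. partial_deriv j (f i) * N j s)"
      using that J adj(1) by (simp add: scalar_prod_def Jij N_def atLeast0LessThan)
    moreover have "(J * adj_mat J) $$ (i, s) = (if i = s then 1 else 0)"
      using that adj(2) detJ by simp
    ultimately show ?thesis by simp
  qed
  have left: "(\<Sum>j<n. N i j * partial_deriv s (f j)) = (if i = s then 1 else 0)" if "i < n" "s < n" for i s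
  proof -
    have "(adj_mat J * J) $$ (i, s) = (\<Sum>j<n. N i j * partial_deriv s (f j))"
      using that J adj(1) by (simp add: scalar_prod_def Jij N_def atLeast0LessThan)
    moreover have "(adj_mat J * J) $$ (i, s) = (if i = s then 1 else 0)"
      using that adj(3) detJ by simp
    ultimately show ?thesis by simp
  qed
  have Nring: "N i s \<in> poly_ring n" if "i < n" "s < n" for i s
  proof -
    have det_ring: "det A \<in> poly_ring n" if "\<And>i j. i < dim_row A \<Longrightarrow> j < dim_col A \<Longrightarrow> A $$ (i, j) \<in> poly_ring n"
      for A :: "'k mpoly mat"
    proof -
      have "signof p \<in> (poly_ring n :: 'k mpoly set)" for p
        by (cases p rule: sign_cases) (auto intro: poly_ring_uminus)
      moreover have "p i < dim_row A" if "p permutes {0..<dim_row A}" "i < dim_row A" for p i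
        using permutes_in_image[OF that(1), of i] that(2) by simp
      ultimately show ?thesis
        unfolding det_def using that
        by (auto intro!: poly_ring_sum poly_ring_mult poly_ring_prod)
    qed
    have del: "mat_delete J s i $$ (i', j') \<in> poly_ring n" if "i' < n - 1" "j' < n - 1" for i' j'
      using that J \<open>i < n\<close> \<open>s < n\<close> 
      by (auto simp: mat_delete_def Jij intro!: poly_ring_partial_deriv f)
    have "det (mat_delete J s i) \<in> poly_ring n"
      by (rule det_ring, rule del) (use J in \<open>auto simp: mat_delete_dim\<close>)
    moreover have "(- 1) ^ e \<in> (poly_ring n :: 'k mpoly set)" for e :: nat
      by (intro poly_ring_power poly_ring_uminus poly_ring_one)
    ultimately show ?thesis using that J
      by (auto simp: N_def adj_mat_def cofactor_def intro: poly_ring_mult)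
  qed
  let ?c = "\<lambda>p. ev (\<lambda>i. 0) p :: 'k"
  \<comment> \<open>\<open>A\<close> is the Jacobian matrix at the origin. Its inverse
    \<open>B\<close> comes from evaluating the adjugate identities there.\<close>
  define A where "A i j = ?c (partial_deriv j (f i))" for i j
  define B where "B i j = ?c (N i j)" for i j
  define b where "b i = ?c (f i)" for i
  have AB: "(\<Sum>j<n. A i j * B j s) = (if i = s then 1 else 0)" if "i < n" "s < n" for i s
    using arg_cong[OF right[OF that], of ?c] by (simp add: ev_simps A_def B_def)
  have BA: "(\<Sum>j<n. B i j * A j s) = (if i = s then 1 else 0)" if "i < n" "s < n" for i s
    using arg_cong[OF left[OF that], of ?c] by (simp add: ev_simps A_def B_def)
  define F where "F i = (\<Sum>j<n. Const (B i j) * (f j - Const (b j)))" for i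
  define M where "M i s = (\<Sum>l<n. N i l * Const (A l s))" for i s
  have Fr: "F i \<in> poly_ring n" for i
    unfolding F_def by (intro poly_ring_sum poly_ring_mult poly_ring_diff f) auto
  have dF: "partial_deriv j (F i) = (\<Sum>l<n. Const (B i l) * partial_deriv j (f l))" for i j
    by (simp add: F_def partial_deriv_sum partial_deriv_mult partial_deriv_diff)
  have F2: "degs_in {2..} (F i - Var i)" if "i < n" for i
  proof (rule degs_in_ge_2I)
    have "?c (F i - Var i) = 0" by (simp add: F_def ev_simps b_def)
    then show "lookup (F i - Var i) 0 = 0" by (simp add: ev_at_zero)
    fix s
    show "lookup (F i - Var i) (single s 1) = 0"
    proof (cases "s < n")
      case True
      have "lookup (F i) (single s 1) = lookup (partial_deriv s (F i)) 0"
        unfolding lookup_partial_deriv by simp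
      also have "\<dots> = (\<Sum>l<n. B i l * A l s)"
        unfolding ev_at_zero[symmetric] dF by (simp add: ev_simps A_def)
      also have "\<dots> = (if i = s then 1 else 0)" using BA that True by simp
      finally show ?thesis by (auto simp: lookup_minus Var_def lookup_single when_def)
    next
      case False
      have "F i - Var i \<in> poly_ring n" using Fr that by (auto intro: poly_ring_diff)
      then have "single s 1 \<notin> keys (F i - Var i)"
        using False poly_ringD[of "F i - Var i" n "single s 1" s] by auto
      then show ?thesis by (simp add: in_keys_iff)
    qed
  qed
  have CAB: "(\<Sum>j<n. Const (A i j) * Const (B j s)) = (if i = s then 1 else 0)" if "i < n" "s < n" for i s
    using arg_cong[OF AB[OF that], of Const]
    by (simp add: hom_on_sum[OF hom_on_Const] hom_onD[OF hom_on_Const] if_distrib[of Const] cong: if_cong)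
  have CBA: "(\<Sum>j<n. Const (B i j) * Const (A j s)) = (if i = s then 1 else 0)" if "i < n" "s < n" for i s
    using arg_cong[OF BA[OF that], of Const]
    by (simp add: hom_on_sum[OF hom_on_Const] hom_onD[OF hom_on_Const] if_distrib[of Const] cong: if_cong)
  have FM: "(\<Sum>j<n. partial_deriv j (F i) * M j s) = (if i = s then 1 else 0)" if "i < n" "s < n" for i s
  proof -
    have "(\<Sum>j<n. partial_deriv j (F i) * M j s) = 
      (\<Sum>j<n. \<Sum>l<n. \<Sum>l'<n. Const (B i l) * Const (A l' s) * (partial_deriv j (f l) * N j l'))"
      unfolding dF M_def sum_product by (simp add: mult_ac)
    also have "\<dots> = (\<Sum>l<n. \<Sum>l'<n. \<Sum>j<n. Const (B i l) * Const (A l' s) * (partial_deriv j (f l) * N j l'))"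
      by (rule trans[OF sum.swap sum.cong[OF refl sum.swap]])
    also have "\<dots> = (\<Sum>l<n. \<Sum>l'<n. Const (B i l) * Const (A l' s) * (if l = l' then 1 else 0))"
      by (simp add: right flip: sum_distrib_left)
    also have "\<dots> = (\<Sum>l<n. Const (B i l) * Const (A l s))"
      by (simp add: if_distrib[of "\<lambda>a. _ * a"] cong: if_cong)
    finally show ?thesis using CBA that by simp
  qed
  have Mr: "M i s \<in> poly_ring n" if "i < n" for i s
    unfolding M_def using that by (intro poly_ring_sum poly_ring_mult Nring) auto
  have noT0: "False" if T: "\<forall>i<n. T i \<in> poly_ring n \<and> sub T (F i) = Var i \<and> sub F (T i) = Var i" for T
  proof -
    \<comment> \<open>\<open>L\<close> is the affine map for which F = L(f), so an inverse
      \<open>T\<close> of \<open>F\<close> yields the inverse T(L) of \<open>f\<close>.\<close>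
    define L where "L j = (\<Sum>l<n. Const (B j l) * (Var l - Const (b l)))" for j :: nat
    define G where "G = vec n (\<lambda>i. sub L (T i))"
    have Lr: "L j \<in> poly_ring n" for j
      unfolding L_def by (intro poly_ring_sum poly_ring_mult poly_ring_diff) auto
    have "G \<in> poly_maps n"
      using poly_ring_eval[of _ n L n "\<lambda>a. a"] T Lr by (auto simp: poly_maps_def G_def)
    have fF: "f l = Const (b l) + (\<Sum>i<n. Const (A l i) * F i)" if "l < n" for l
    proof -
      have "(\<Sum>i<n. Const (A l i) * F i) = 
        (\<Sum>i<n. \<Sum>j<n. (Const (A l i) * Const (B i j)) * (f j - Const (b j)))"
        by (simp add: F_def sum_distrib_left mult_ac)
      also have "\<dots> = (\<Sum>j<n. (if l = j then 1 else 0) * (f j - Const (b j)))"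
        by (subst sum.swap) (simp add: CAB[OF that] flip: sum_distrib_right)
      finally show ?thesis using that by (simp add: if_distrib[of "\<lambda>a. a * _"] cong: if_cong)
    qed
    have VL: "Var l = Const (b l) + (\<Sum>i<n. Const (A l i) * L i)" if "l < n" for l
    proof -
      have "(\<Sum>i<n. Const (A l i) * L i) = 
        (\<Sum>i<n. \<Sum>j<n. (Const (A l i) * Const (B i j)) * (Var j - Const (b j)))"
        by (simp add: L_def sum_distrib_left mult_ac)
      also have "\<dots> = (\<Sum>j<n. (if l = j then 1 else 0) * (Var j - Const (b j)))"
        by (subst sum.swap) (simp add: CAB[OF that] flip: sum_distrib_right)
      finally show ?thesis using that by (simp add: if_distrib[of "\<lambda>a. a * _"] cong: if_cong)
    qed
    have 1: "sub (\<lambda>i. sub L (T i)) (f l) = Var l" if "l < n" for l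
    proof -
      have "sub (\<lambda>i. sub L (T i)) (f l) = sub L (sub T (f l))" by (simp add: sub_sub)
      also have "sub T (f l) = Const (b l) + (\<Sum>i<n. Const (A l i) * Var i)"
        using T by (subst fF[OF that]) (simp add: sub_simps)
      also have "sub L \<dots> = Var l" using VL[OF that] by (simp add: sub_simps)
      finally show ?thesis .
    qed
    have 2: "sub f (sub L (T i)) = Var i" if "i < n" for i
    proof -
      have "sub f (sub L (T i)) = sub (\<lambda>j. sub f (L j)) (T i)" by (simp add: sub_sub)
      also have "(\<lambda>j. sub f (L j)) = F"
        by (rule ext) (simp add: L_def F_def sub_simps)
      finally show ?thesis using T that by simp
    qed
    have c1: "subst G p = sub (\<lambda>i. sub L (T i)) p" if "p \<in> poly_ring n" for p
      unfolding subst_def by (rule eval_with_cong[OF that]) (simp_all add: G_def)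
    have "comp_map Fv G = id_map n"
      using 1 c1[OF f] dimFv unfolding comp_map_def id_map_def
      by (intro eq_vecI) (auto simp: f_def)
    moreover have "comp_map G Fv = id_map n"
      using 2 dimFv unfolding comp_map_def id_map_def
      by (intro eq_vecI) (auto simp: f_def[abs_def] G_def subst_def)
    ultimately show False using noinv \<open>G \<in> poly_maps n\<close> by blast
  qed
  have noT: "\<not> (\<exists>T. \<forall>i<n. T i \<in> poly_ring n \<and> sub T (F i) = Var i \<and> sub F (T i) = Var i)"
    by (rule notI, erule exE, erule noT0)
  show ?thesis
    by (rule exI[of _ n], rule exI[of _ F], rule exI[of _ M])
       (intro conjI allI impI noT Fr F2 Mr FM)
qed

section \<open>Descent of the coefficient field\<close>

definition subfield :: "'a::field set \<Rightarrow> bool" where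
  "subfield k \<longleftrightarrow> subring k \<and> (\<forall>a\<in>k. inverse a \<in> k)"

lemma subfieldD: 
  assumes "subfield k" 
  shows "subring k" "a \<in> k \<Longrightarrow> inverse a \<in> k" "a \<in> k \<Longrightarrow> b \<in> k \<Longrightarrow> a / b \<in> k"
  using assms by (auto simp: subfield_def divide_inverse intro: subringD)

definition pover :: "'a::comm_ring_1 set \<Rightarrow> 'a poly \<Rightarrow> bool" where
  "pover k p \<longleftrightarrow> (\<forall>i. coeff p i \<in> k)"

context
  fixes k :: "'a::comm_ring_1 set"
  assumes k: "subring k"
begin

lemma pover_0: "pover k 0" by (simp add: pover_def subringD[OF k])

lemma pover_1: "pover k 1" by (auto simp: pover_def coeff_1 subringD[OF k])

lemma pover_const: "a \<in> k \<Longrightarrow> pover k [:a:]"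
  by (auto simp: pover_def coeff_pCons subringD[OF k] split: nat.split)

lemma pover_X: "pover k [:0, 1:]"
  by (auto simp: pover_def coeff_pCons subringD[OF k] split: nat.split)

lemma pover_add: "pover k p \<Longrightarrow> pover k q \<Longrightarrow> pover k (p + q)"
  by (simp add: pover_def subringD[OF k])

lemma pover_uminus: "pover k p \<Longrightarrow> pover k (- p)"
  by (simp add: pover_def subringD[OF k])

lemma pover_diff: "pover k p \<Longrightarrow> pover k q \<Longrightarrow> pover k (p - q)"
  by (simp add: pover_def subringD[OF k])

lemma pover_mult: "pover k p \<Longrightarrow> pover k q \<Longrightarrow> pover k (p * q)"
  unfolding pover_def coeff_mult by (auto intro!: subring_sum[OF k] subringD(6)[OF k])

lemma pover_monom: "a \<in> k \<Longrightarrow> pover k (Polynomial.monom a e)"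
  by (simp add: pover_def subringD[OF k])

lemma poly_in_subring: "pover k p \<Longrightarrow> a \<in> k \<Longrightarrow> poly p a \<in> k"
  unfolding poly_altdef pover_def by (auto intro!: subring_sum[OF k] subringD(6)[OF k] subring_power[OF k])

end

text \<open>Fractions p(c) / q(c) describe the simple extension whether \<open>c\<close> is
  transcendental or algebraic, so the two cases separate only in the descent.\<close>

definition adjoin :: "'a::field set \<Rightarrow> 'a \<Rightarrow> 'a set" where
  "adjoin k c = {poly p c / poly q c | p q. pover k p \<and> pover k q \<and> poly q c \<noteq> 0}"

lemma adjoinI: "pover k p \<Longrightarrow> pover k q \<Longrightarrow> poly q c \<noteq> 0 \<Longrightarrow> poly p c / poly q c \<in> adjoin k c"
  by (auto simp: adjoin_def)

lemma adjoin_polyI: "subring k \<Longrightarrow> pover k p \<Longrightarrow> poly p c \<in> adjoin k c"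
  using adjoinI[of k p 1 c] by (simp add: pover_1)

lemma subset_adjoin: "subring k \<Longrightarrow> k \<subseteq> adjoin k c"
  using adjoin_polyI[OF _ pover_const, of k _ c] by auto

lemma in_adjoin: "subring k \<Longrightarrow> c \<in> adjoin k c"
  using adjoin_polyI[OF _ pover_X, of k c] by simp

lemma subfield_adjoin:
  assumes "subfield k" shows "subfield (adjoin k c)"
  unfolding subfield_def subring_def
proof (intro conjI ballI)
  note R = subfieldD(1)[OF assms]
  show "1 \<in> adjoin k c" using subset_adjoin[OF R] subringD(1)[OF R] by auto
  fix a assume "a \<in> adjoin k c"
  then obtain p q where a: "a = poly p c / poly q c" "pover k p" "pover k q" "poly q c \<noteq> 0"
    by (auto simp: adjoin_def)
  show "- a \<in> adjoin k c"
    using adjoinI[of k "- p" q c] a pover_uminus[OF R] by simp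
  show "inverse a \<in> adjoin k c"
  proof (cases "poly p c = 0")
    case True
    then show ?thesis using a subset_adjoin[OF R, of c] subringD(2)[OF R] by auto
  next
    case False
    then show ?thesis using adjoinI[of k q p c] a by simp
  qed
  fix b assume "b \<in> adjoin k c"
  then obtain p' q' where b: "b = poly p' c / poly q' c" "pover k p'" "pover k q'" "poly q' c \<noteq> 0"
    by (auto simp: adjoin_def)
  show "a + b \<in> adjoin k c"
    using adjoinI[of k "p * q' + p' * q" "q * q'" c] a b
    by (simp add: pover_add[OF R] pover_mult[OF R] add_frac_eq)
  show "a * b \<in> adjoin k c"
    using adjoinI[of k "p * p'" "q * q'" c] a b
    by (simp add: pover_mult[OF R])
qed

primrec adjoin_list :: "'a::field_char_0 list \<Rightarrow> 'a set" where
  "adjoin_list [] = \<rat>"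
| "adjoin_list (c # cs) = adjoin (adjoin_list cs) c"

lemma subfield_Rats: "subfield (\<rat> :: 'a::field_char_0 set)"
  by (simp add: subfield_def subring_def)

lemma subfield_adjoin_list: "subfield (adjoin_list cs)"
  by (induction cs) (auto intro: subfield_adjoin subfield_Rats)

lemma finite_subset_adjoin_list: "finite S \<Longrightarrow> \<exists>cs. S \<subseteq> adjoin_list cs"
proof (induction S rule: finite_induct)
  case (insert c S)
  then obtain cs where "S \<subseteq> adjoin_list cs" by blast
  with subset_adjoin[of "adjoin_list cs" c] in_adjoin[of "adjoin_list cs" c] subfieldD(1)[OF subfield_adjoin_list, of cs]
  have "insert c S \<subseteq> adjoin_list (c # cs)" by auto
  then show ?case by blast
qed simp

text \<open>
  The map \<open>F\<close> may depend on \<open>K0\<close>; only its dimension \<open>n\<close> and its degree bound \<open>d\<close> are fixed. This is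
  what survives the specialization of a transcendental coefficient.
\<close>

definition noninv :: "'a::comm_ring_1 set \<Rightarrow> nat \<Rightarrow> nat \<Rightarrow> bool" where
  "noninv k n d \<longleftrightarrow> (\<forall>K0. \<exists>K>K0. \<exists>F M G. noninv_data k n d K F M G)"

lemma finite_lookup_range: "finite {lookup p m | m. True}"
proof -
  have "{lookup p m | m. True} \<subseteq> insert 0 (lookup p ` keys p)" by (auto simp: in_keys_iff)
  then show ?thesis by (rule finite_subset) simp
qed

text \<open>It suffices that the field contains the coefficients of \<open>F\<close> and
  \<open>M\<close>: the approximate inverses arise from \<open>F\<close> by ring operations, so
  their coefficients lie in the same field for every \<open>K\<close>.\<close>

lemma not_JC_noninv:
  assumes "\<not> jacobian_conjecture TYPE('k::field_char_0)"
  shows "\<exists>n d cs. noninv (adjoin_list cs :: 'k set) n d"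
proof -
  obtain n and F :: "nat \<Rightarrow> 'k mpoly" and M where
    F: "\<And>i. i < n \<Longrightarrow> F i \<in> poly_ring n" "\<And>i. i < n \<Longrightarrow> degs_in {2..} (F i - Var i)"
    and M: "\<And>i s. i < n \<Longrightarrow> s < n \<Longrightarrow> M i s \<in> poly_ring n"
       "\<And>i s. i < n \<Longrightarrow> s < n \<Longrightarrow> (\<Sum>j<n. partial_deriv j (F i) * M j s) = (if i = s then 1 else 0)"
    and T: "\<not> (\<exists>T. \<forall>i<n. T i \<in> poly_ring n \<and> sub T (F i) = Var i \<and> sub F (T i) = Var i)"
    using not_JC_normalized[OF assms] by blast
  let ?S = "(\<Union>i<n. {lookup (F i) m | m. True}) \<union> (\<Union>i<n. \<Union>s<n. {lookup (M i s) m | m. True})"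
  have "finite ?S" by (intro finite_UnI finite_UN_I finite_lookup_range) auto
  then obtain cs where cs: "?S \<subseteq> adjoin_list cs" using finite_subset_adjoin_list by blast
  have "finite (\<Union>i<n. mdeg ` keys (F i))" by auto
  then obtain d where d: "\<forall>x\<in>(\<Union>i<n. mdeg ` keys (F i)). x \<le> d"
    using finite_nat_set_iff_bounded_le by blast
  have oF: "over (adjoin_list cs) (F i)" if "i < n" for i
    using cs that unfolding over_def by blast
  have oM: "over (adjoin_list cs) (M i s)" if "i < n" "s < n" for i s
    using cs that unfolding over_def by blast
  have dF: "degs_in {..d} (F i)" if "i < n" for i
    using d that by (auto simp: degs_in_def)
  have "noninv (adjoin_list cs) n d"
    unfolding noninv_def
    using ex_noninv_data[OF subfieldD(1)[OF subfield_adjoin_list] oF F(1) dF F(2) oM M T] by blast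
  then show ?thesis by blast
qed

section \<open>Transport of certificates between coefficient rings\<close>

definition coeff_map :: "('a::comm_ring_1 \<Rightarrow> 'b::comm_ring_1) \<Rightarrow> 'a mpoly \<Rightarrow> 'b mpoly" where
  "coeff_map h p = eval_with (\<lambda>a. Const (h a)) Var p"

lemma lookup_coeff_map:
  assumes "h 0 = 0" shows "lookup (coeff_map h p) m = h (lookup p m)"
  using assms by (simp add: coeff_map_def eval_with_mon lookup_sum lookup_single when_def in_keys_iff
      flip: single_eq_Const_mon)

lemma keys_coeff_map_subset: "h 0 = 0 \<Longrightarrow> keys (coeff_map h p) \<subseteq> keys p"
  by (auto simp: in_keys_iff lookup_coeff_map)

lemma poly_ring_coeff_map: "h 0 = 0 \<Longrightarrow> p \<in> poly_ring n \<Longrightarrow> coeff_map h p \<in> poly_ring n"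
  using keys_coeff_map_subset[of h p] by (auto simp: poly_ring_def)

lemma degs_in_coeff_map: "h 0 = 0 \<Longrightarrow> degs_in S p \<Longrightarrow> degs_in S (coeff_map h p)"
  using keys_coeff_map_subset[of h p] by (auto simp: degs_in_def)

context
  fixes R :: "'a::comm_ring_1 set" and h :: "'a \<Rightarrow> 'b::comm_ring_1"
  assumes h: "hom_on R h"
begin

lemmas hC = hom_on_Const_compose[OF h]

lemmas coeff_map_simps =
  eval_with_zero[OF hC, of Var, folded coeff_map_def] eval_with_one[OF hC, of Var, folded coeff_map_def]
  eval_with_Const[OF hC, of Var, folded coeff_map_def] eval_with_Var[OF hC, of Var, folded coeff_map_def]
  eval_with_add[OF hC, where x = Var, folded coeff_map_def] eval_with_mult[OF hC, where x = Var, folded coeff_map_def]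
  eval_with_diff[OF hC, where x = Var, folded coeff_map_def] eval_with_sum[OF hC, where x = Var, folded coeff_map_def]

lemma coeff_map_partial_deriv:
  assumes "over R p" "p \<in> poly_ring n" "j < n"
  shows "coeff_map h (partial_deriv j p) = partial_deriv j (coeff_map h p)"
  using chain_rule[OF h assms(1,2), of j Var] assms(3)
  by (simp add: coeff_map_def if_distrib[of "\<lambda>a. _ * a"] cong: if_cong)

lemma coeff_map_sub:
  assumes "over R p" "p \<in> poly_ring n" "\<And>i. i < n \<Longrightarrow> over R (G i)"
  shows "coeff_map h (sub G p) = sub (\<lambda>i. coeff_map h (G i)) (coeff_map h p)" "over R (sub G p)"
proof -
  note R = hom_onD(1)[OF h]
  have id: "hom_on R (\<lambda>a. a)" using R by (simp add: hom_on_def)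
  show "coeff_map h (sub G p) = sub (\<lambda>i. coeff_map h (G i)) (coeff_map h p)" 
    using eval_with_comp[OF id hC, of p n G Var] eval_with_comp[OF h hom_on_Const, of p n Var "\<lambda>i. coeff_map h (G i)"] assms
    by (simp add: coeff_map_def sub_simps)
  show "over R (sub G p)" by (rule over_sub[OF R assms])
qed

end

lemma noninv_dataD:
  assumes "noninv_data R n d K F M G" "i < n"
  shows "over R (F i)" "over R (G i)" "F i \<in> poly_ring n" "degs_in {..d} (F i)" "degs_in {2..} (F i - Var i)"
    "G i \<in> poly_ring n" "degs_in {1..} (G i)" "degs_in {Suc K..} (sub G (F i) - Var i)"
  using assms by (auto simp: noninv_data_def)

lemma noninv_data_jacobian:
  assumes "noninv_data R n d K F M G" "i < n" "s < n"
  shows "over R (M i s)" "M i s \<in> poly_ring n"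
    "(\<Sum>j<n. partial_deriv j (F i) * M j s) = (if i = s then 1 else 0)"
  using assms by (auto simp: noninv_data_def)

text \<open>The clauses of the certificate are identities, degree bounds and membership conditions,
  all of which pass through a homomorphism. Only the nonzero coefficient of \<open>G\<close> may be
  sent to 0; \<open>nz\<close> asks for one that is not.\<close>

lemma noninv_data_hom:
  assumes h: "hom_on R h" and k: "subring k" "\<And>a. a \<in> R \<Longrightarrow> h a \<in> k"
    and D: "noninv_data R n d K F M G"
    and nz: "\<exists>i<n. \<exists>m. mdeg m = K \<and> h (lookup (G i) m) \<noteq> 0"
  shows "noninv_data k n d K (\<lambda>i. coeff_map h (F i)) (\<lambda>i j. coeff_map h (M i j)) (\<lambda>i. coeff_map h (G i))"
proof -
  note R = hom_onD(1)[OF h] note h0 = hom_onD(2)[OF h]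
  note cm = coeff_map_simps[OF h]
  note D' = noninv_dataD[OF D] and M = noninv_data_jacobian[OF D]
  have ov: "over k (coeff_map h p)" if "over R p" for p
    using that k by (auto simp: over_def lookup_coeff_map h0)
  have id: "(\<Sum>j<n. partial_deriv j (coeff_map h (F i)) * coeff_map h (M j s)) = (if i = s then 1 else 0)"
    if "i < n" "s < n" for i s
  proof -
    have "(if i = s then 1 else 0) = coeff_map h (\<Sum>j<n. partial_deriv j (F i) * M j s)"
      using M(3)[OF that] by (simp add: cm)
    also have "\<dots> = (\<Sum>j<n. coeff_map h (partial_deriv j (F i)) * coeff_map h (M j s))"
    proof -
      have o: "over R (partial_deriv j (F i))" "over R (M j s)" if "j < n" for j
        using over_partial_deriv[OF R D'(1)[OF \<open>i < n\<close>]] M(1)[OF that \<open>s < n\<close>] by auto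
      then have "coeff_map h (\<Sum>j<n. partial_deriv j (F i) * M j s) =
          (\<Sum>j<n. coeff_map h (partial_deriv j (F i) * M j s))"
        by (intro cm(8) over_mult[OF R]) auto
      also have "\<dots> = (\<Sum>j<n. coeff_map h (partial_deriv j (F i)) * coeff_map h (M j s))"
        using o by (intro sum.cong refl cm(6)) auto
      finally show ?thesis .
    qed
    also have "\<dots> = (\<Sum>j<n. partial_deriv j (coeff_map h (F i)) * coeff_map h (M j s))"
      using coeff_map_partial_deriv[OF h D'(1,3)[OF that(1)]] by simp
    finally show ?thesis by simp
  qed
  have "degs_in S (coeff_map h p - Var i)" if "over R p" "degs_in S (p - Var i)" for S p i
  proof -
    have "coeff_map h (p - Var i) = coeff_map h p - Var i"
      using that(1) by (simp add: cm over_Var[OF R])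
    with degs_in_coeff_map[where h = h, OF h0 that(2)] show ?thesis by simp
  qed
  note dV = this
  have sG: "degs_in {Suc K..} (sub (\<lambda>i. coeff_map h (G i)) (coeff_map h (F i)) - Var i)" if "i < n" for i
    using dV[OF coeff_map_sub(2)[OF h D'(1,3)[OF that] D'(2)] D'(8)[OF that]] 
      coeff_map_sub(1)[OF h D'(1,3)[OF that] D'(2)] by simp
  show ?thesis
    unfolding noninv_data_def
    using D' M(1,2) ov id sG dV nz by (auto simp: lookup_coeff_map h0 poly_ring_coeff_map degs_in_coeff_map)
qed

lemma noninv_data_over:
  "noninv_data k n d K F M G \<Longrightarrow> (\<And>i. i < n \<Longrightarrow> over k' (F i)) \<Longrightarrow> (\<And>i. i < n \<Longrightarrow> over k' (G i)) \<Longrightarrow>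
   (\<And>i s. i < n \<Longrightarrow> s < n \<Longrightarrow> over k' (M i s)) \<Longrightarrow> noninv_data k' n d K F M G"
  by (simp add: noninv_data_def)

lemma noninv_data_mono:
  "noninv_data k n d K F M G \<Longrightarrow> k \<subseteq> k' \<Longrightarrow> noninv_data k' n d K F M G"
  by (rule noninv_data_over) (auto simp: noninv_data_def over_def)

text \<open>The finite set serves to avoid finitely many poles and to find a common denominator. As
  it need not be a subring, certificates are defined for an arbitrary set of coefficients.\<close>

lemma noninv_data_finite_coeffs:
  assumes D: "noninv_data k n d K F M G"
  shows "\<exists>S. finite S \<and> S \<subseteq> k \<and> noninv_data S n d K F M G"
proof -
  define S where "S = (\<Union>i<n. {lookup (F i) m | m. True}) \<union> (\<Union>i<n. \<Union>s<n. {lookup (M i s) m | m. True})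
    \<union> (\<Union>i<n. {lookup (G i) m | m. True})"
  have "finite S" unfolding S_def by (intro finite_UnI finite_UN_I finite_lookup_range) auto
  moreover have "S \<subseteq> k" using D by (auto simp: S_def noninv_data_def over_def)
  moreover have "noninv_data S n d K F M G"
    by (rule noninv_data_over[OF D]) (auto simp: over_def S_def)
  ultimately show ?thesis by blast
qed

text \<open>Specialize \<open>c\<close> to a natural number at which no coefficient of the
  certificate has a pole and the distinguished coefficient of \<open>G\<close> does not vanish. The
  number depends on the certificate, hence on \<open>K\<close>, and so does the resulting
  map.\<close>

lemma noninv_transcendental:
  fixes k :: "'a::field_char_0 set"
  assumes k: "subfield k" and tr: "\<And>p. pover k p \<Longrightarrow> poly p c = 0 \<Longrightarrow> p = 0"
    and "noninv (adjoin k c) n d"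
  shows "noninv k n d"
  unfolding noninv_def
proof
  note kr = subfieldD(1)[OF k]
  fix K0
  obtain K F M G where K: "K > K0" and D: "noninv_data (adjoin k c) n d K F M G"
    using assms(3) unfolding noninv_def by blast
  obtain i0 m0 where i0: "i0 < n" "mdeg m0 = K" "lookup (G i0) m0 \<noteq> 0"
    using D by (auto simp: noninv_data_def)
  let ?g = "lookup (G i0) m0"
  obtain S where fin: "finite S" and S: "S \<subseteq> adjoin k c" and DS: "noninv_data S n d K F M G"
    using noninv_data_finite_coeffs[OF D] by blast
  have "\<forall>s\<in>S. \<exists>pq. s = poly (fst pq) c / poly (snd pq) c \<and> pover k (fst pq) \<and> pover k (snd pq) \<and>
      poly (snd pq) c \<noteq> 0"
    using S by (fastforce simp: adjoin_def)
  from bchoice[OF this] obtain pq where pq: "\<forall>s\<in>S. s = poly (fst (pq s)) c / poly (snd (pq s)) c \<and>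
      pover k (fst (pq s)) \<and> pover k (snd (pq s)) \<and> poly (snd (pq s)) c \<noteq> 0"
    by blast
  define P where "P s = fst (pq s)" for s
  define Q where "Q s = snd (pq s)" for s
  have PQ: "s = poly (P s) c / poly (Q s) c" "pover k (P s)" "pover k (Q s)" "poly (Q s) c \<noteq> 0"
    if "s \<in> S" for s using pq that by (auto simp: P_def Q_def)
  have gS: "?g \<in> S" using noninv_dataD(2)[OF DS i0(1)] by (rule overD)
  \<comment> \<open>The roots of \<open>W\<close> are the forbidden values: zeros of the
    denominators chosen for the finitely many coefficients, and of the numerator of the
    distinguished one.\<close>
  define W where "W = P ?g * (\<Prod>s\<in>S. Q s)"
  have "P ?g \<noteq> 0" using PQ(1)[OF gS] i0(3) by auto
  moreover have "Q s \<noteq> 0" if "s \<in> S" for s using PQ(4)[OF that] by auto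
  ultimately have "W \<noteq> 0" using fin by (auto simp: W_def)
  then have "finite {t. poly W t = 0}" by (rule poly_roots_finite)
  moreover have "infinite (range (of_nat :: nat \<Rightarrow> 'a))"
    by (intro range_inj_infinite) (simp add: inj_on_def)
  ultimately have "\<not> range of_nat \<subseteq> {t. poly W t = 0}"
    using finite_subset by blast
  then obtain u :: nat where u: "poly W (of_nat u) \<noteq> 0" by auto
  define a :: 'a where "a = of_nat u"
  have ak: "a \<in> k" by (simp add: a_def subring_of_nat kr)
  have Pa: "poly (P ?g) a \<noteq> 0" and Qa: "\<And>s. s \<in> S \<Longrightarrow> poly (Q s) a \<noteq> 0"
    using u fin by (auto simp: W_def a_def poly_prod)
  define R where "R = {poly p c / poly q c | p q. pover k p \<and> pover k q \<and> poly q a \<noteq> 0}"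
  define rep where "rep x pq \<longleftrightarrow> x = poly (fst pq) c / poly (snd pq) c \<and> pover k (fst pq) \<and> pover k (snd pq) \<and> poly (snd pq) a \<noteq> 0" for x pq
  \<comment> \<open>\<open>h\<close> evaluates at \<open>a\<close> some fraction representing
    \<open>x\<close>. Independence of the choice is where transcendence enters: two representations
    of \<open>x\<close> cross-multiply to a polynomial relation for \<open>c\<close>, which must be
    trivial and therefore holds at \<open>a\<close> too.\<close>
  define h where "h x = (let pq = (SOME pq. rep x pq) in poly (fst pq) a / poly (snd pq) a)" for x
  have nz: "poly q c \<noteq> 0" if "pover k q" "poly q a \<noteq> 0" for q
    using tr[OF that(1)] that(2) by auto
  have h: "h (poly p c / poly q c) = poly p a / poly q a" if "pover k p" "pover k q" "poly q a \<noteq> 0" for p q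
  proof -
    let ?x = "poly p c / poly q c"
    have "rep ?x (p, q)" using that by (simp add: rep_def)
    then have some: "rep ?x (SOME pq. rep ?x pq)" by (rule someI)
    obtain p' q' where e: "(SOME pq. rep ?x pq) = (p', q')" by (rule prod.exhaust)
    have pq': "(SOME pq. rep ?x pq) = (p', q')" "?x = poly p' c / poly q' c"
      "pover k p'" "pover k q'" "poly q' a \<noteq> 0"
      using some e unfolding e rep_def by simp_all
    have "poly (p * q' - p' * q) c = 0"
      using pq'(2) nz[OF that(2,3)] nz[OF pq'(4,5)] by (simp add: field_simps)
    then have "p * q' - p' * q = 0"
      by (intro tr) (auto intro!: pover_diff pover_mult kr that pq')
    then have "poly (p * q' - p' * q) a = 0" by simp
    then have "poly p a * poly q' a = poly p' a * poly q a" by simp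
    then show ?thesis using that(3) pq'(5) by (simp add: h_def pq'(1) field_simps)
  qed
  have RI: "poly p c / poly q c \<in> R" if "pover k p" "pover k q" "poly q a \<noteq> 0" for p q
    using that by (auto simp: R_def)
  have hom: "hom_on R h"
    unfolding hom_on_def subring_def
  proof (intro conjI ballI)
    show "1 \<in> R" using RI[of 1 1] by (simp add: pover_1 kr)
    show "h 0 = 0" using h[of 0 1] by (simp add: pover_0 pover_1 kr)
    show "h 1 = 1" using h[of 1 1] by (simp add: pover_0 pover_1 kr)
    fix x assume "x \<in> R"
    then obtain p q where x: "x = poly p c / poly q c" "pover k p" "pover k q" "poly q a \<noteq> 0"
      by (auto simp: R_def)
    show "- x \<in> R"
      using RI[of "- p" q] x by (simp add: pover_uminus[OF kr])
    fix y assume "y \<in> R"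
    then obtain p' q' where y: "y = poly p' c / poly q' c" "pover k p'" "pover k q'" "poly q' a \<noteq> 0"
      by (auto simp: R_def)
    note nzs = nz[OF x(3,4)] nz[OF y(3,4)]
    have add: "x + y = poly (p * q' + p' * q) c / poly (q * q') c"
      using nzs by (simp add: x(1) y(1) add_frac_eq)
    have mul: "x * y = poly (p * p') c / poly (q * q') c"
      by (simp add: x(1) y(1))
    show "x + y \<in> R" unfolding add
      by (rule RI) (use x y in \<open>auto intro!: pover_add[OF kr] pover_mult[OF kr]\<close>)
    show "x * y \<in> R" unfolding mul
      by (rule RI) (use x y in \<open>auto intro!: pover_add[OF kr] pover_mult[OF kr]\<close>)
    have "h (x + y) = poly (p * q' + p' * q) a / poly (q * q') a" unfolding add
      by (rule h) (use x y in \<open>auto intro!: pover_add[OF kr] pover_mult[OF kr]\<close>)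
    then show "h (x + y) = h x + h y"
      using x y by (simp add: h add_frac_eq)
    have "h (x * y) = poly (p * p') a / poly (q * q') a" unfolding mul
      by (rule h) (use x y in \<open>auto intro!: pover_add[OF kr] pover_mult[OF kr]\<close>)
    then show "h (x * y) = h x * h y"
      using x y by (simp add: h)
  qed
  have hk: "h x \<in> k" if "x \<in> R" for x
    using that h by (auto simp: R_def intro!: subfieldD(3)[OF k] poly_in_subring[OF kr] ak)
  have SR: "S \<subseteq> R"
  proof
    fix s assume s: "s \<in> S"
    show "s \<in> R" using RI[of "P s" "Q s"] PQ[OF s] Qa[OF s] by simp
  qed
  have "noninv_data R n d K F M G" by (rule noninv_data_mono[OF DS SR])
  moreover have "h ?g \<noteq> 0"
    using h[of "P ?g" "Q ?g"] PQ(2,3)[OF gS] Qa[OF gS] Pa PQ(1)[OF gS, symmetric] by simp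
  ultimately have "noninv_data k n d K (\<lambda>i. coeff_map h (F i)) (\<lambda>i j. coeff_map h (M i j)) (\<lambda>i. coeff_map h (G i))"
    using noninv_data_hom[OF hom kr hk] i0 by blast
  with K show "\<exists>K>K0. \<exists>F M G. noninv_data k n d K F M G" by blast
qed

text \<open>Long division, carried out so that quotient and remainder keep their coefficients in
  \<open>k\<close>. The measure ranks 0 below the nonzero constants, from which
  \<open>degree\<close> alone does not separate it.\<close>

lemma pover_division:
  fixes k :: "'a::field_char_0 set"
  assumes k: "subfield k" and b: "pover k b" "b \<noteq> 0"
  shows "pover k a \<Longrightarrow> \<exists>s r. pover k s \<and> pover k r \<and> a = b * s + r \<and> (r = 0 \<or> degree r < degree b)"
proof (induction "if a = 0 then 0 else Suc (degree a)" arbitrary: a rule: less_induct)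
  case less
  note kr = subfieldD(1)[OF k]
  show ?case
  proof (cases "a = 0 \<or> degree a < degree b")
    case True
    then show ?thesis using less.prems pover_0[OF kr]
      by (intro exI[of _ 0] exI[of _ a]) auto
  next
    case False
    define t where "t = Polynomial.monom (lead_coeff a / lead_coeff b) (degree a - degree b)"
    have t: "pover k t"
      unfolding t_def
      by (intro pover_monom[OF kr] subfieldD(3)[OF k]) (use less.prems b in \<open>auto simp: pover_def\<close>)
    define a' where "a' = a - b * t"
    have a': "pover k a'" using less.prems b t by (simp add: a'_def pover_diff[OF kr] pover_mult[OF kr])
    have "degree (b * t) \<le> degree a"
      using degree_mult_le[of b t] degree_monom_le[of "lead_coeff a / lead_coeff b" "degree a - degree b"] False
      unfolding t_def by linarith
    then have "degree a' \<le> degree a" unfolding a'_def by (intro degree_diff_le) auto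
    moreover have "coeff a' (degree a) = 0"
      using False b(2) unfolding a'_def t_def
      by (simp add: mult.commute[of b] coeff_monom_mult)
    ultimately have "a' = 0 \<or> degree a' < degree a" by (rule eq_zero_or_degree_less)
    then have "(if a' = 0 then 0 else Suc (degree a')) < (if a = 0 then 0 else Suc (degree a))"
      using False by auto
    from less.hyps[OF this a'] obtain s r where
      "pover k s" "pover k r" "a' = b * s + r" "r = 0 \<or> degree r < degree b" by blast
    then show ?thesis
      using t by (intro exI[of _ "s + t"] exI[of _ r]) (auto simp: a'_def algebra_simps intro: pover_add[OF kr])
  qed
qed

text \<open>\<open>r\<close> is the degree of the minimal polynomial of \<open>c\<close>, and
  \<open>\<pi> j\<close> is the coordinate at \<open>c ^ j\<close>. The Euclidean algorithm turns
  fractions into polynomials in \<open>c\<close>, and division by the minimal polynomial brings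
  these to degree below \<open>r\<close>.\<close>

lemma adjoin_algebraic_basis:
  fixes k :: "'a::field_char_0 set"
  assumes k: "subfield k" and "pover k p0" "p0 \<noteq> 0" "poly p0 c = 0"
  shows "\<exists>r \<pi>. 0 < r \<and>
    (\<forall>x\<in>adjoin k c. (\<forall>j<r. \<pi> j x \<in> k) \<and> x = (\<Sum>j<r. \<pi> j x * c ^ j)) \<and>
    (\<forall>b b'. (\<forall>j<r. b j \<in> k \<and> b' j \<in> k) \<and> (\<Sum>j<r. b j * c ^ j) = (\<Sum>j<r. b' j * c ^ j) \<longrightarrow>
      (\<forall>j<r. b j = b' j))"
proof -
  note kr = subfieldD(1)[OF k]
  obtain \<mu> where mu: "pover k \<mu>" "\<mu> \<noteq> 0" "poly \<mu> c = 0"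
    and min: "\<And>p. pover k p \<Longrightarrow> p \<noteq> 0 \<Longrightarrow> poly p c = 0 \<Longrightarrow> degree \<mu> \<le> degree p"
    using arg_min_nat_lemma[of "\<lambda>p. pover k p \<and> p \<noteq> 0 \<and> poly p c = 0" p0 degree] assms(2-4) by blast
  define r where "r = degree \<mu>"
  have r: "0 < r"
  proof (rule ccontr)
    assume "\<not> 0 < r"
    then obtain a where "\<mu> = [:a:]" unfolding r_def using degree_eq_zeroE by blast
    with mu show False by auto
  qed
  have inv: "\<exists>u. pover k u \<and> poly u c * poly q c = 1" if "pover k q" "q \<noteq> 0" "degree q < r" for q
    using that
  proof (induction "degree q" arbitrary: q rule: less_induct)
    case less
    show ?case
    proof (cases "degree q = 0")
      case True
      then obtain a where q: "q = [:a:]" using degree_eq_zeroE by blast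
      then have "a \<in> k" "a \<noteq> 0" using less.prems by (auto simp: pover_def dest: spec[of _ 0])
      then show ?thesis using pover_const[OF kr] subfieldD(2)[OF k]
        by (intro exI[of _ "[:inverse a:]"]) (simp add: q)
    next
      case False
      obtain s t where st: "pover k s" "pover k t" "\<mu> = q * s + t" "t = 0 \<or> degree t < degree q"
        using pover_division[OF k less.prems(1,2) mu(1)] by blast
      have eq: "poly q c * poly s c + poly t c = 0" using mu(3) st(3) by simp
      have "t \<noteq> 0"
      proof
        assume t: "t = 0"
        have "poly q c \<noteq> 0" using min[OF less.prems(1,2)] less.prems(3) r_def by auto
        then have "poly s c = 0" using eq t by simp
        moreover have "s \<noteq> 0" using st(3) mu(2) t by auto
        ultimately have "r \<le> degree s" using min st(1) r_def by blast
        moreover have "r = degree q + degree s"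
          using st(3) t less.prems(2) \<open>s \<noteq> 0\<close> by (simp add: r_def degree_mult_eq)
        ultimately show False using False by simp
      qed
      then obtain u where u: "pover k u" "poly u c * poly t c = 1"
        using less.hyps[of t] st(2,4) less.prems(3) by auto
      \<comment> \<open>From \<mu> = q s + t one gets q(c) s(c) = - t(c), so an inverse u(c) of t(c)
        yields the inverse - u(c) s(c) of q(c).\<close>
      have "poly t c = - (poly q c * poly s c)"
        using eq by (simp add: eq_neg_iff_add_eq_0 add.commute)
      then have "poly (- (u * s)) c * poly q c = poly u c * poly t c" by simp
      then have "poly (- (u * s)) c * poly q c = 1" using u(2) by simp
      then show ?thesis using pover_uminus[OF kr pover_mult[OF kr u(1) st(1)]] by blast
    qed
  qed
  have red: "\<exists>q. pover k q \<and> poly q c = poly p c \<and> (\<forall>i\<ge>r. coeff q i = 0)" if p: "pover k p" for p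
  proof -
    obtain s t where st: "pover k s" "pover k t" "p = \<mu> * s + t" "t = 0 \<or> degree t < degree \<mu>"
      using pover_division[OF k mu(1,2) p] by blast
    then show ?thesis using mu(3)
      by (intro exI[of _ t]) (auto simp: r_def coeff_eq_0)
  qed
  have repr: "\<exists>q. pover k q \<and> poly q c = x \<and> (\<forall>i\<ge>r. coeff q i = 0)" if x: "x \<in> adjoin k c" for x
  proof -
    obtain p q where pq: "x = poly p c / poly q c" "pover k p" "pover k q" "poly q c \<noteq> 0"
      using x by (auto simp: adjoin_def)
    obtain q' where q': "pover k q'" "poly q' c = poly q c" "\<forall>i\<ge>r. coeff q' i = 0"
      using red[OF pq(3)] by blast
    have q'0: "q' \<noteq> 0" using q' pq(4) by auto
    then have "degree q' < r" using q'(3) leading_coeff_neq_0[of q'] by (meson not_le)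
    then obtain u where u: "pover k u" "poly u c * poly q c = 1"
      using inv[OF q'(1) q'0] q'(2) by auto
    then have "inverse (poly q c) = poly u c"
      using inverse_unique[of "poly q c" "poly u c"] by (simp add: mult.commute)
    then have "x = poly (p * u) c" using pq(1) by (simp add: divide_inverse)
    then show ?thesis using red[OF pover_mult[OF kr pq(2) u(1)]] by simp
  qed
  from bchoice[of "adjoin k c" "\<lambda>x q. pover k q \<and> poly q c = x \<and> (\<forall>i\<ge>r. coeff q i = 0)"] repr
  obtain rep where rep: "\<And>x. x \<in> adjoin k c \<Longrightarrow> pover k (rep x) \<and> poly (rep x) c = x \<and> (\<forall>i\<ge>r. coeff (rep x) i = 0)"
    by blast
  have poly_expand: "poly q c = (\<Sum>j<r. coeff q j * c ^ j)" if "\<forall>i\<ge>r. coeff q i = 0" for q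
  proof -
    have "poly q c = (\<Sum>j\<in>{..degree q}. coeff q j * c ^ j)" by (rule poly_altdef)
    also have "\<dots> = (\<Sum>j\<in>{..degree q} \<union> {..<r}. coeff q j * c ^ j)"
      by (rule sum.mono_neutral_left) (auto simp: coeff_eq_0)
    also have "\<dots> = (\<Sum>j<r. coeff q j * c ^ j)"
      by (rule sum.mono_neutral_right) (use that in auto)
    finally show ?thesis .
  qed
  have uniq: "b j = b' j" if "\<forall>j<r. b j \<in> k \<and> b' j \<in> k" "(\<Sum>j<r. b j * c ^ j) = (\<Sum>j<r. b' j * c ^ j)" "j < r" for b b' j
  proof -
    define q where "q = (\<Sum>i<r. Polynomial.monom (b i - b' i) i)"
    have cq: "coeff q i = (if i < r then b i - b' i else 0)" for i
      by (simp add: q_def coeff_sum)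
    have "pover k q" using that(1) by (auto simp: pover_def cq subringD[OF kr])
    moreover have "poly q c = 0" using that(2) by (simp add: q_def poly_sum poly_monom algebra_simps sum_subtractf)
    moreover have "degree q < r" using r by (intro degree_lessI) (auto simp: cq)
    ultimately have "q = 0" using min[of q] r_def by force
    then show ?thesis using cq[of j] that(3) by simp
  qed
  show ?thesis
  proof (rule exI[of _ r], rule exI[of _ "\<lambda>j x. coeff (rep x) j"], intro conjI ballI)
    fix x assume "x \<in> adjoin k c"
    then show "\<forall>j<r. coeff (rep x) j \<in> k" "x = (\<Sum>j<r. coeff (rep x) j * c ^ j)"
      using rep[of x] poly_expand[of "rep x"] by (auto simp: pover_def)
  qed (use r uniq in auto)
qed

lemma lookup_Const_mult: "lookup (Const a * p) m = a * lookup (p :: 'a::comm_ring_1 mpoly) m"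
proof -
  have "Const a * p = Poly_Mapping.map ((*) a) p"
    by (simp add: Const_def mult_map_scale_conv_mult)
  then show ?thesis by (simp add: Poly_Mapping.map.rep_eq when_def)
qed

lemma sum_lessThan_add: "(\<Sum>l<a + b. f l) = (\<Sum>l<a. f l) + (\<Sum>j<b. f (a + j :: nat))"
  by (induction b) (simp_all add: add.assoc)

lemma sum_lessThan_mult: "(\<Sum>l<n * r. f l) = (\<Sum>i<n. \<Sum>j<r. f (i * r + j :: nat))"
proof (induction n)
  case (Suc n)
  then show ?case using sum_lessThan_add[of f "n * r" r] by (simp add: add.commute)
qed simp

text \<open>
  Restriction of scalars: each variable \<open>X_i\<close> is replaced by \<open>Z_i = (\<Sum>j<r. c ^ j * X_(i * r + j))\<close>,
  and polynomials over \<open>k(c)\<close> are decomposed along the basis \<open>c ^ j\<close>.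
\<close>

lemma noninv_data_algebraic:
  fixes k :: "'a::field_char_0 set"
  assumes k: "subfield k" and r: "0 < r"
    and coord: "\<And>x j. x \<in> adjoin k c \<Longrightarrow> j < r \<Longrightarrow> \<pi> j x \<in> k"
      "\<And>x. x \<in> adjoin k c \<Longrightarrow> x = (\<Sum>j<r. \<pi> j x * c ^ j)"
    and uniq: "\<And>b b' j. (\<And>j. j < r \<Longrightarrow> b j \<in> k) \<Longrightarrow> (\<And>j. j < r \<Longrightarrow> b' j \<in> k) \<Longrightarrow>
      (\<Sum>j<r. b j * c ^ j) = (\<Sum>j<r. b' j * c ^ j) \<Longrightarrow> j < r \<Longrightarrow> b j = b' j"
    and D: "noninv_data (adjoin k c) n d K F M G"
  shows "\<exists>F' M' G'. noninv_data k (n * r) d K F' M' G'"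
proof -
  note kr = subfieldD(1)[OF k] note A = subfieldD(1)[OF subfield_adjoin[OF k], of c]
  have kA: "a \<in> adjoin k c" if "a \<in> k" for a using subset_adjoin[OF kr] that by blast
  have cA: "c ^ e \<in> adjoin k c" for e by (rule subring_power[OF A in_adjoin[OF kr]])
  have pi0: "\<pi> j 0 = 0" if "j < r" for j
    using uniq[of "\<lambda>j. \<pi> j 0" "\<lambda>_. 0" j] coord[OF subringD(2)[OF A]] that subringD(2)[OF kr] by simp
  define C where "C e = Const (c ^ e)" for e :: nat
  \<comment> \<open>The coordinate maps need not be ring homomorphisms. Here
    \<open>coeff_map\<close> merely applies them to each coefficient, which rests on
    \<open>\<pi> j 0 = 0\<close>.\<close>
  define dec where "dec j p = coeff_map (\<pi> j) p" for j and p :: "'a mpoly"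
  have lookup_dec: "lookup (dec j p) m = \<pi> j (lookup p m)" if "j < r" for j p m
    unfolding dec_def by (rule lookup_coeff_map[where h = "\<pi> j", OF pi0[OF that]])
  have over_dec: "over k (dec j p)" if "over (adjoin k c) p" "j < r" for j p
    using that coord(1) by (auto simp: over_def lookup_dec)
  have ring_dec: "dec j p \<in> poly_ring N" if "p \<in> poly_ring N" "j < r" for j p N
    unfolding dec_def by (rule poly_ring_coeff_map[where h = "\<pi> j", OF pi0[OF that(2)] that(1)])
  have degs_dec: "degs_in S (dec j p)" if "degs_in S p" "j < r" for j p S
    unfolding dec_def by (rule degs_in_coeff_map[where h = "\<pi> j", OF pi0[OF that(2)] that(1)])
  have dec_sum: "p = (\<Sum>j<r. C j * dec j p)" if "over (adjoin k c) p" for p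
  proof (rule poly_mapping_eqI)
    fix m
    have "lookup p m = (\<Sum>j<r. \<pi> j (lookup p m) * c ^ j)" by (rule coord(2)[OF overD[OF that]])
    also have "\<dots> = (\<Sum>j<r. c ^ j * \<pi> j (lookup p m))" by (simp only: mult.commute)
    also have "\<dots> = lookup (\<Sum>j<r. C j * dec j p) m"
      by (simp add: lookup_sum C_def lookup_Const_mult lookup_dec)
    finally show "lookup p m = lookup (\<Sum>j<r. C j * dec j p) m" .
  qed
  \<comment> \<open>The device for the identities over \<open>k\<close> below: sum the coordinates
    against the powers of \<open>c\<close>, compute over k(c), and compare coordinates
    again.\<close>
  have unique: "b j = b' j" if "\<And>j. j < r \<Longrightarrow> over k (b j)" "\<And>j. j < r \<Longrightarrow> over k (b' j)"
    "(\<Sum>j<r. C j * b j) = (\<Sum>j<r. C j * b' j)" "j < r" for b b' j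
  proof (rule poly_mapping_eqI)
    fix m
    have "lookup (\<Sum>j<r. C j * b j) m = lookup (\<Sum>j<r. C j * b' j) m" using that(3) by simp
    then have "(\<Sum>j<r. c ^ j * lookup (b j) m) = (\<Sum>j<r. c ^ j * lookup (b' j) m)"
      by (simp add: lookup_sum C_def lookup_Const_mult)
    then have "(\<Sum>j<r. lookup (b j) m * c ^ j) = (\<Sum>j<r. lookup (b' j) m * c ^ j)"
      by (simp only: mult.commute)
    then show "lookup (b j) m = lookup (b' j) m"
      using uniq[of "\<lambda>j. lookup (b j) m" "\<lambda>j. lookup (b' j) m" j] that(1,2,4) by (simp add: over_def)
  qed
  note D' = noninv_dataD[OF D] and M = noninv_data_jacobian[OF D]
  define Z where "Z i = (\<Sum>j<r. C j * Var (i * r + j))" for i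
  have idx: "i * r + j < n * r" if "i < n" "j < r" for i j
  proof -
    have "i * r + j < Suc i * r" using that(2) by simp
    also have "\<dots> \<le> n * r" using that(1) by (intro mult_right_mono) auto
    finally show ?thesis .
  qed
  have Zr: "Z i \<in> poly_ring (n * r)" if "i < n" for i
    unfolding Z_def C_def using idx that by (intro poly_ring_sum poly_ring_mult) auto
  have ZA: "over (adjoin k c) (Z i)" for i
    unfolding Z_def C_def by (intro over_sum over_mult over_Const over_Var A cA)
  have Z1: "degs_in {1} (Z i)" for i
    unfolding Z_def C_def by (intro degs_in_sum degs_in_mult[of "{0}" _ "{1}"]) auto
  have subA: "over (adjoin k c) (sub Z p)" if "over (adjoin k c) p" for p
  proof -
    obtain N where "p \<in> poly_ring N" using ex_poly_ring by blast
    then show ?thesis using over_sub[OF A that] ZA by blast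
  qed
  have subr: "sub Z p \<in> poly_ring (n * r)" if "p \<in> poly_ring n" for p
    using poly_ring_eval[OF that Zr, where h = "\<lambda>a. a"] by simp
  have subd: "degs_in S (sub Z p)" if "degs_in S p" for p S
  proof -
    obtain N where "p \<in> poly_ring N" using ex_poly_ring by blast
    then show ?thesis using degs_in_linear_subst[OF that, of N Z "\<lambda>a. a"] Z1 by simp
  qed
  define F' where "F' l = dec (l mod r) (sub Z (F (l div r)))" for l
  define G' where "G' l = dec (l mod r) (sub Z (G (l div r)))" for l
  \<comment> \<open>The block of \<open>M'\<close> at a pair of original indices is the matrix of
    multiplication by the entry of \<open>M\<close> in the basis of powers of \<open>c\<close>:
    column \<open>q mod r\<close> holds the coordinates of that power of \<open>c\<close> times the
    entry.\<close>
  define M' where "M' l q = dec (l mod r) (C (q mod r) * sub Z (M (l div r) (q div r)))" for l q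
  have lr: "l div r < n" "l mod r < r" "l = (l div r) * r + l mod r" if "l < n * r" for l
    using that r by (auto simp: less_mult_imp_div_less)
  have F'i: "F' (i * r + j) = dec j (sub Z (F i))" and G'i: "G' (i * r + j) = dec j (sub Z (G i))"
    and M'i: "M' (i * r + j) (s * r + e) = dec j (C e * sub Z (M i s))" if "j < r" "e < r" for i j s e
    using that by (simp_all add: F'_def G'_def M'_def)
  have oC: "over (adjoin k c) (C e)" for e unfolding C_def by (rule over_Const[OF A cA])
  have oF: "over k (F' l)" and oG: "over k (G' l)" if "l < n * r" for l
    using lr[OF that] by (auto simp: F'_def G'_def intro!: over_dec subA D')
  have oM: "over k (M' l q)" if "l < n * r" "q < n * r" for l q
    using lr[OF that(1)] lr[OF that(2)] by (auto simp: M'_def intro!: over_dec subA M over_mult A oC)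
  have oV: "over k (Var l)" for l by (rule over_Var[OF kr])
  have sumF: "(\<Sum>j<r. C j * F' (i * r + j)) = sub Z (F i)" if "i < n" for i
    using dec_sum[OF subA[OF D'(1)[OF that]]] F'i by simp
  have sumG: "(\<Sum>j<r. C j * G' (i * r + j)) = sub Z (G i)" if "i < n" for i
    using dec_sum[OF subA[OF D'(2)[OF that]]] G'i by simp
  have shift: "X j = dec j (sub Z R) + Var (i * r + j)"
    if "(\<Sum>j<r. C j * X j) = sub Z R + Z i" "\<And>j. j < r \<Longrightarrow> over k (X j)" "over (adjoin k c) R" "j < r" for X R i j
  proof (rule unique[of X "\<lambda>j. dec j (sub Z R) + Var (i * r + j)"])
    have "sub Z R + Z i = (\<Sum>j<r. C j * dec j (sub Z R)) + Z i"
      using dec_sum[OF subA[OF that(3)]] by simp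
    also have "\<dots> = (\<Sum>j<r. C j * (dec j (sub Z R) + Var (i * r + j)))"
      by (simp add: Z_def distrib_left sum.distrib)
    finally show "(\<Sum>j<r. C j * X j) = (\<Sum>j<r. C j * (dec j (sub Z R) + Var (i * r + j)))"
      using that(1) by simp
  qed (use that in \<open>auto intro!: over_add[OF kr] over_dec subA oV\<close>)
  have F2: "degs_in {2..} (F' l - Var l)" if l: "l < n * r" for l
  proof -
    let ?i = "l div r" and ?j = "l mod r"
    have "(\<Sum>j<r. C j * F' (?i * r + j)) = sub Z (F ?i - Var ?i) + Z ?i"
      using sumF[OF lr(1)[OF l]] by (simp add: sub_simps)
    from shift[OF this _ _ lr(2)[OF l]] have "F' l = dec ?j (sub Z (F ?i - Var ?i)) + Var l"
      using oF idx lr[OF l] over_diff[OF A D'(1)[OF lr(1)[OF l]] over_Var[OF A]] by simp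
    then show ?thesis using degs_dec[OF subd[OF D'(5)]] lr[OF l] by simp
  qed
  have sG: "degs_in {Suc K..} (sub G' (F' l) - Var l)" if l: "l < n * r" for l
  proof -
    let ?i = "l div r" and ?j = "l mod r"
    let ?R = "sub G (F ?i) - Var ?i"
    have i: "?i < n" using lr l by blast
    have subGZ: "sub G' (Z i) = sub Z (G i)" if "i < n" for i
      using sumG[OF that] by (simp add: Z_def C_def sub_simps)
    have "(\<Sum>j<r. C j * sub G' (F' (?i * r + j))) = sub G' (\<Sum>j<r. C j * F' (?i * r + j))"
      by (simp add: C_def sub_simps)
    also have "\<dots> = sub (\<lambda>i. sub G' (Z i)) (F ?i)" by (simp add: sumF[OF i] sub_sub)
    also have "\<dots> = sub (\<lambda>i. sub Z (G i)) (F ?i)"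
      by (rule eval_with_cong[OF D'(3)[OF i]]) (simp_all add: subGZ)
    also have "\<dots> = sub Z ?R + Z ?i" by (simp add: sub_simps sub_sub)
    finally have eq: "(\<Sum>j<r. C j * sub G' (F' (?i * r + j))) = sub Z ?R + Z ?i" .
    have oR: "over (adjoin k c) ?R"
      using over_sub[OF A D'(1)[OF i] D'(3)[OF i] D'(2)] by (intro over_diff[OF A] over_Var[OF A]) auto
    have "over k (sub G' (F' l))" if "l < n * r" for l
      using over_sub[OF kr oF[OF that], of "n * r" G'] oG lr[OF that]
      by (simp add: F'_def ring_dec subr D')
    from shift[OF eq this oR lr(2)[OF l]] have "sub G' (F' l) = dec ?j (sub Z ?R) + Var l"
      using idx lr[OF l] by simp
    then show ?thesis using degs_dec[OF subd[OF D'(8)[OF i]] lr(2)[OF l]] by simp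
  qed
  have jac: "(\<Sum>l<n * r. partial_deriv l (F' a) * M' l q) = (if a = q then 1 else 0)"
    if a: "a < n * r" and q: "q < n * r" for a q
  proof -
    let ?i = "a div r" and ?s = "q div r" and ?e = "q mod r"
    note i = lr(1)[OF a] and s = lr(1)[OF q] and e = lr(2)[OF q]
    define X where "X j = (\<Sum>l<n * r. partial_deriv l (F' (?i * r + j)) * M' l q)" for j
    have oX: "over k (X j)" if "j < r" for j
      unfolding X_def using idx[OF i that] q
      by (intro over_sum[OF kr] over_mult[OF kr] over_partial_deriv[OF kr] oF oM) auto
    have dZ: "partial_deriv (u' * r + f) (Z u) = (if u = u' then C f else 0)" if "f < r" for u u' f
    proof -
      have "partial_deriv (u' * r + f) (Z u) = (\<Sum>j<r. C j * (if u' * r + f = u * r + j then 1 else 0))"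
        by (simp add: Z_def C_def partial_deriv_sum partial_deriv_mult)
      also have "\<dots> = (\<Sum>j<r. if j = f then (if u = u' then C f else 0) else 0)"
      proof (intro sum.cong refl)
        fix j assume "j \<in> {..<r}"
        then have "u' * r + f = u * r + j \<longleftrightarrow> u = u' \<and> j = f"
          using that by (metis add_left_cancel lessThan_iff div_mult_self3 div_less add.right_neutral less_nat_zero_code)
        then show "C j * (if u' * r + f = u * r + j then 1 else 0) = (if j = f then (if u = u' then C f else 0) else 0)"
          by auto
      qed
      finally show ?thesis using that by simp
    qed
    have dZF: "partial_deriv (u * r + f) (sub Z (F ?i)) = sub Z (partial_deriv u (F ?i)) * C f"
      if "u < n" "f < r" for u f
      unfolding chain_rule_sub[OF D'(3)[OF i]] dZ[OF that(2)]
      using that(1) by (simp add: if_distrib[of "\<lambda>a. _ * a"] cong: if_cong)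
    have "(\<Sum>j<r. C j * X j) = (\<Sum>l<n * r. partial_deriv l (\<Sum>j<r. C j * F' (?i * r + j)) * M' l q)"
      unfolding X_def sum_distrib_left
      by (subst sum.swap) (simp add: C_def partial_deriv_sum partial_deriv_mult sum_distrib_right mult.assoc)
    also have "\<dots> = (\<Sum>u<n. \<Sum>f<r. sub Z (partial_deriv u (F ?i)) * C f * M' (u * r + f) q)"
      unfolding sumF[OF i] sum_lessThan_mult by (simp add: dZF)
    also have "\<dots> = (\<Sum>u<n. sub Z (partial_deriv u (F ?i)) * (C ?e * sub Z (M u ?s)))"
    proof (intro sum.cong refl)
      fix u assume "u \<in> {..<n}"
      then have u: "u < n" by simp
      have "(\<Sum>f<r. C f * M' (u * r + f) q) = C ?e * sub Z (M u ?s)"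
        using dec_sum[OF over_mult[OF A oC subA[OF M(1)[OF u s]]], of ?e] by (simp add: M'_def)
      then show "(\<Sum>f<r. sub Z (partial_deriv u (F ?i)) * C f * M' (u * r + f) q) =
        sub Z (partial_deriv u (F ?i)) * (C ?e * sub Z (M u ?s))"
        by (simp add: mult.assoc flip: sum_distrib_left)
    qed
    also have "\<dots> = C ?e * sub Z (\<Sum>u<n. partial_deriv u (F ?i) * M u ?s)"
      by (simp add: sub_simps sum_distrib_left mult_ac)
    also have "\<dots> = (if ?i = ?s then C ?e else 0)"
      using M(3)[OF i s] by (simp add: sub_simps)
    also have "\<dots> = (\<Sum>j<r. C j * (if ?i = ?s \<and> j = ?e then 1 else 0))"
      using e by (simp add: if_distrib[of "\<lambda>a. _ * a"] cong: if_cong)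
    finally have eq: "(\<Sum>j<r. C j * X j) = (\<Sum>j<r. C j * (if ?i = ?s \<and> j = ?e then 1 else 0))" .
    have "X (a mod r) = (if ?i = ?s \<and> a mod r = ?e then 1 else 0)"
      by (rule unique[OF oX _ eq lr(2)[OF a]]) (auto intro: over_one[OF kr] over_zero[OF kr])
    moreover have "?i = ?s \<and> a mod r = ?e \<longleftrightarrow> a = q"
      by (metis div_mult_mod_eq)
    ultimately show ?thesis by (simp add: X_def)
  qed
  have nz: "\<exists>l<n * r. \<exists>m. mdeg m = K \<and> lookup (G' l) m \<noteq> 0"
  proof (rule ccontr)
    assume "\<not> ?thesis"
    then have G0: "degs_in (- {K}) (G' l)" if "l < n * r" for l using that by (auto simp: degs_in_alt)
    obtain i m where i: "i < n" "mdeg m = K" "lookup (G i) m \<noteq> 0"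
      using D by (auto simp: noninv_data_def)
    \<comment> \<open>\<open>W\<close> is linear and sends \<open>Z u\<close> back to
      \<open>Var u\<close>, so the component of degree \<open>K\<close> of \<open>G i\<close> cannot
      be missing from all coordinates of its restriction.\<close>
    define W where "W l = (if l mod r = 0 then Var (l div r) else 0 :: 'a mpoly)" for l
    have "sub W (Z u) = Var u" for u
    proof -
      have "sub W (Z u) = (\<Sum>j<r. C j * W (u * r + j))" by (simp add: Z_def C_def sub_simps)
      also have "\<dots> = (\<Sum>j<r. if j = 0 then Var u else 0)"
        by (intro sum.cong refl) (auto simp: W_def C_def Const_def)
      finally show ?thesis using r by simp
    qed
    then have "sub W (sub Z (G i)) = G i" by (simp add: sub_sub sub_Var)
    moreover have "degs_in (- {K}) (\<Sum>j<r. C j * G' (i * r + j))"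
      unfolding C_def using G0 idx[OF i(1)]
      by (intro degs_in_sum degs_in_mult[of "{0}" _ "- {K}"]) auto
    then have "degs_in (- {K}) (sub W (sub Z (G i)))"
      unfolding sumG[OF i(1)] using degs_in_linear_subst[OF _ subr[OF D'(6)[OF i(1)]], of "- {K}" W "\<lambda>a. a"]
      by (simp add: W_def)
    ultimately show False using i by (auto simp: degs_in_alt)
  qed
  have "noninv_data k (n * r) d K F' M' G'"
    unfolding noninv_data_def
  proof (intro conjI allI impI oF oG oM F2 sG jac nz)
    fix l assume l: "l < n * r"
    note l' = lr[OF l]
    show "F' l \<in> poly_ring (n * r)" "G' l \<in> poly_ring (n * r)"
      unfolding F'_def G'_def by (intro ring_dec subr D' l')+
    show "degs_in {..d} (F' l)" unfolding F'_def by (intro degs_dec subd D' l')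
    show "degs_in {1..} (G' l)" unfolding G'_def by (intro degs_dec subd D' l')
    fix s assume s: "s < n * r"
    show "M' l s \<in> poly_ring (n * r)"
      unfolding M'_def C_def
      by (intro ring_dec poly_ring_mult poly_ring_Const subr M l' lr[OF s])
  qed
  then show ?thesis by blast
qed

lemma noninv_adjoin:
  fixes k :: "'a::field_char_0 set"
  assumes k: "subfield k" and N: "noninv (adjoin k c) n d"
  shows "\<exists>n'. noninv k n' d"
proof (cases "\<exists>p. pover k p \<and> p \<noteq> 0 \<and> poly p c = 0")
  case False
  then show ?thesis using noninv_transcendental[OF k _ N] by blast
next
  case True
  then obtain p0 where "pover k p0" "p0 \<noteq> 0" "poly p0 c = 0" by blast
  from adjoin_algebraic_basis[OF k this] obtain r \<pi> where r: "0 < r" and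
    1: "\<forall>x\<in>adjoin k c. (\<forall>j<r. \<pi> j x \<in> k) \<and> x = (\<Sum>j<r. \<pi> j x * c ^ j)" and
    2: "\<forall>b b'. (\<forall>j<r. b j \<in> k \<and> b' j \<in> k) \<and> (\<Sum>j<r. b j * c ^ j) = (\<Sum>j<r. b' j * c ^ j) \<longrightarrow>
      (\<forall>j<r. b j = b' j)" by blast
  have "noninv k (n * r) d"
    unfolding noninv_def
  proof
    fix K0
    obtain K F M G where K: "K > K0" and D: "noninv_data (adjoin k c) n d K F M G"
      using N unfolding noninv_def by blast
    have "\<exists>F' M' G'. noninv_data k (n * r) d K F' M' G'"
      by (rule noninv_data_algebraic[OF k r, where \<pi> = \<pi>, OF _ _ _ D]) (use 1 2 in blast)+
    with K show "\<exists>K>K0. \<exists>F M G. noninv_data k (n * r) d K F M G" by blast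
  qed
  then show ?thesis by blast
qed

lemma noninv_Rats: "noninv (adjoin_list cs :: 'a set) n d \<Longrightarrow> \<exists>n'. noninv (\<rat> :: 'a::field_char_0 set) n' d"
proof (induction cs arbitrary: n)
  case (Cons c cs)
  then show ?case using noninv_adjoin[OF subfield_adjoin_list, of cs c n d] by auto
qed auto

section \<open>Integral points on the homogenized curve\<close>

definition box_monomials :: "nat \<Rightarrow> nat \<Rightarrow> (nat \<Rightarrow>\<^sub>0 nat) set" where
  "box_monomials n B = {m. keys m \<subseteq> {..<n} \<and> (\<forall>i. lookup m i < B)}"

lemma card_box_monomials:
  assumes B: "0 < B" shows "finite (box_monomials n B) \<and> card (box_monomials n B) = B ^ n"
proof (induction n)
  case 0
  have "box_monomials 0 B = {0}"
    using B by (auto simp: box_monomials_def)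
  then show ?case by simp
next
  case (Suc n)
  define f where "f = (\<lambda>(m, e). m + single n (e::nat))"
  have notin: "lookup m n = 0" if "m \<in> box_monomials n B" for m
    using that by (auto simp: box_monomials_def in_keys_iff)
  have inj: "inj_on f (box_monomials n B \<times> {..<B})"
  proof (rule inj_onI, clarsimp simp: f_def)
    fix m e m' e'
    assume m: "m \<in> box_monomials n B" "m' \<in> box_monomials n B"
      and eq: "m + single n e = m' + single n e'"
    from arg_cong[OF eq, of "\<lambda>x. lookup x n"] have "e = e'"
      using notin m by (simp add: lookup_add)
    with eq show "m = m' \<and> e = e'" by simp
  qed
  have im: "f ` (box_monomials n B \<times> {..<B}) = box_monomials (Suc n) B"
  proof (intro equalityI subsetI)
    fix x assume "x \<in> f ` (box_monomials n B \<times> {..<B})"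
    then obtain m e where m: "m \<in> box_monomials n B" "e < B" and x: "x = m + single n e"
      by (auto simp: f_def)
    have "keys x \<subseteq> {..<Suc n}"
      using Poly_Mapping.keys_add[of m "single n e"] m(1)
      by (auto simp: x box_monomials_def split: if_splits)
    moreover have "lookup x i < B" for i
      using m notin[OF m(1)] by (auto simp: x lookup_add lookup_single when_def box_monomials_def)
    ultimately show "x \<in> box_monomials (Suc n) B" by (simp add: box_monomials_def)
  next
    fix x assume x: "x \<in> box_monomials (Suc n) B"
    define m where "m = x - single n (lookup x n)"
    have xm: "x = m + single n (lookup x n)"
      by (rule poly_mapping_eqI) (simp add: m_def lookup_add lookup_minus lookup_single when_def)
    have "lookup m i < B" for i
      using x less_imp_diff_less by (auto simp: m_def lookup_minus box_monomials_def)
    moreover have "keys m \<subseteq> {..<n}"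
    proof
      fix i assume "i \<in> keys m"
      then have "lookup x i \<noteq> 0" "i \<noteq> n" by (auto simp: m_def in_keys_iff lookup_minus lookup_single when_def split: if_splits)
      then have "i \<in> keys x" "i \<noteq> n" by (simp_all add: in_keys_iff)
      then have "i < Suc n" "i \<noteq> n" using x by (auto simp: box_monomials_def)
      then show "i \<in> {..<n}" by simp
    qed
    ultimately have "m \<in> box_monomials n B" by (simp add: box_monomials_def)
    moreover have "lookup x n < B" using x by (simp add: box_monomials_def)
    ultimately show "x \<in> f ` (box_monomials n B \<times> {..<B})"
      using xm by (auto simp: f_def intro!: image_eqI[of _ _ "(m, lookup x n)"])
  qed
  show ?case
    unfolding im[symmetric] using card_image[OF inj] Suc
    by (simp add: card_cartesian_product mult.commute)
qed

text \<open>A repeated member of the family is itself a relation; otherwise the bound on independent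
  sets inside the span of the monomials in \<open>E\<close> applies.\<close>

lemma mpoly_linear_dependence:
  fixes u :: "'i \<Rightarrow> 'a::field mpoly"
  assumes I: "finite I" and E: "finite E" "card E < card I" and u: "\<And>i. i \<in> I \<Longrightarrow> keys (u i) \<subseteq> E"
  shows "\<exists>a. (\<exists>i\<in>I. a i \<noteq> 0) \<and> (\<Sum>i\<in>I. Const (a i) * u i) = 0"
proof (cases "inj_on u I")
  case False
  then obtain i i' where i: "i \<in> I" "i' \<in> I" "i \<noteq> i'" "u i = u i'" by (auto simp: inj_on_def)
  define a where "a x = (if x = i then 1 else if x = i' then - 1 else 0 :: 'a)" for x
  have "(\<Sum>x\<in>I. Const (a x) * u x) = (\<Sum>x\<in>{i, i'}. Const (a x) * u x)"
    by (rule sum.mono_neutral_right) (use I i in \<open>auto simp: a_def Const_def\<close>)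
  also have "\<dots> = 0" using i by (simp add: a_def Const_def single_uminus)
  finally show ?thesis using i by (intro exI[of _ a]) (auto simp: a_def)
next
  case True
  interpret vs: vector_space "\<lambda>(c::'a) (p::'a mpoly). Const c * p"
    by unfold_locales (simp_all add: algebra_simps hom_onD[OF hom_on_Const])
  define T where "T = (\<lambda>m. single m (1::'a)) ` E"
  have T: "finite T" "card T \<le> card E" using E by (auto simp: T_def card_image_le)
  have span: "u ` I \<subseteq> vs.span T"
  proof clarify
    fix i assume "i \<in> I"
    have "(\<Sum>m\<in>keys (u i). Const (lookup (u i) m) * single m 1) \<in> vs.span T"
      using u[OF \<open>i \<in> I\<close>] by (intro vs.span_sum vs.span_scale vs.span_base) (auto simp: T_def)
    also have "(\<Sum>m\<in>keys (u i). Const (lookup (u i) m) * single m 1) = u i"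
      by (subst (3) sum_singles) (simp add: Const_def mult_single)
    finally show "u i \<in> vs.span T" .
  qed
  have "card (u ` I) > card T" using T E(2) card_image[OF True] by simp
  then have "vs.dependent (u ` I)"
    using vs.independent_span_bound[OF T(1) _ span] by auto
  then obtain b v where b: "v \<in> u ` I" "b v \<noteq> 0" "(\<Sum>v\<in>u ` I. Const (b v) * v) = 0"
    using vs.dependent_finite[of "u ` I"] I by auto
  then show ?thesis
    using True by (intro exI[of _ "\<lambda>i. b (u i)"]) (auto simp: sum.reindex)
qed

lemma mdeg_le_box: "m \<in> box_monomials n B \<Longrightarrow> mdeg m \<le> n * B"
proof -
  assume m: "m \<in> box_monomials n B"
  then have "mdeg m = (\<Sum>i<n. lookup m i)" by (intro mdeg_superset) (auto simp: box_monomials_def)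
  also have "\<dots> \<le> (\<Sum>i<n. B)" using m by (intro sum_mono) (auto simp: box_monomials_def less_imp_le)
  finally show ?thesis by simp
qed

text \<open>The products of a monomial in \<open>F\<close> with exponents below D and a power of
  X_i0 below D number D^(n+1). Their degree is at most n d D + D, so their monomials lie in a box of
  side B = (n d + 2) D, which has (n d + 2)^n D^n elements. The choice D = (n d + 2)^n + 1 makes the
  first number larger, and the degrees of the P_j are bounded by n D, uniformly in
  \<open>F\<close>.\<close>

lemma algebraic_relation:
  fixes F :: "nat \<Rightarrow> 'a::field mpoly"
  assumes F: "\<And>i. i < n \<Longrightarrow> F i \<in> poly_ring n" "\<And>i. i < n \<Longrightarrow> degs_in {..d} (F i)"
    and "i0 < n" and D: "D = (n * d + 2) ^ n + 1"
  shows "\<exists>P. (\<forall>j<D. P j \<in> poly_ring n \<and> degs_in {..n * D} (P j)) \<and> (\<exists>j<D. P j \<noteq> 0) \<and>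
    (\<Sum>j<D. sub F (P j) * Var i0 ^ j) = 0"
proof -
  define B where "B = (n * d + 2) * D"
  have D0: "0 < D" and B0: "0 < B" by (auto simp: D B_def)
  let ?I = "box_monomials n D \<times> {..<D}" and ?E = "box_monomials n B"
  note cD = card_box_monomials[OF D0, of n] and cB = card_box_monomials[OF B0, of n]
  define u where "u = (\<lambda>(m, j). mon_eval F m * Var i0 ^ j)"
  have "(n * d + 2) ^ n * D ^ n < D ^ n * D" using D0 by (simp add: D)
  moreover have "B ^ n = (n * d + 2) ^ n * D ^ n" by (simp only: B_def power_mult_distrib)
  ultimately have card: "card ?E < card ?I" using cD cB by (simp add: card_cartesian_product)
  have keys: "keys (u x) \<subseteq> ?E" if x: "x \<in> ?I" for x
  proof -
    obtain m j where mj: "x = (m, j)" "m \<in> box_monomials n D" "j < D" using x by auto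
    have km: "i < n" if "i \<in> keys m" for i using mj(2) that by (auto simp: box_monomials_def)
    have r: "u x \<in> poly_ring n"
      using mj(1) km F(1) \<open>i0 < n\<close> by (auto simp: u_def intro!: poly_ring_mult poly_ring_mon poly_ring_power)
    have d: "degs_in {..d * mdeg m} (mon_eval F m)"
      by (rule degs_in_mon_le) (use km F(2) in auto)
    have e: "degs_in {..j} (Var i0 ^ j :: 'a mpoly)"
      using degs_in_power[of 1 "Var i0 :: 'a mpoly" j] by simp
    have "degs_in {..d * mdeg m + j} (u x)"
      unfolding u_def mj(1) prod.case by (rule degs_in_mult[OF d e]) auto
    moreover have "d * mdeg m + j < B"
    proof -
      have "d * mdeg m \<le> d * (n * D)" by (rule mult_le_mono2[OF mdeg_le_box[OF mj(2)]])
      moreover have "B = d * (n * D) + 2 * D" by (simp add: B_def algebra_simps)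
      ultimately show ?thesis using mj(3) by linarith
    qed
    ultimately have "mdeg k < B" if "k \<in> keys (u x)" for k
      using that by (force simp: degs_in_def)
    then have "lookup k i < B" if "k \<in> keys (u x)" for k i
      using that lookup_le_mdeg[of k i] by (meson le_less_trans)
    then show ?thesis using r by (auto simp: box_monomials_def poly_ring_def)
  qed
  have finI: "finite ?I" using cD by simp
  have "\<exists>a. (\<exists>x\<in>?I. a x \<noteq> 0) \<and> (\<Sum>x\<in>?I. Const (a x) * u x) = 0"
    by (rule mpoly_linear_dependence[OF finI conjunct1[OF cB] card keys])
  then obtain a where a: "\<exists>x\<in>?I. a x \<noteq> 0" "(\<Sum>x\<in>?I. Const (a x) * u x) = 0"
    by (elim exE conjE) (rule that)
  define P where "P j = (\<Sum>m\<in>box_monomials n D. single m (a (m, j)))" for j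
  have lookupP: "lookup (P j) m = (if m \<in> box_monomials n D then a (m, j) else 0)" for j m
    using cD by (simp add: P_def lookup_sum lookup_single when_def sum.delta)
  have "P j \<in> poly_ring n" for j
    unfolding P_def by (intro poly_ring_sum poly_ring_single) (simp add: box_monomials_def)
  moreover have "degs_in {..n * D} (P j)" for j
    unfolding P_def using mdeg_le_box by (intro degs_in_sum degs_in_single) auto
  moreover have "\<exists>j<D. P j \<noteq> 0"
  proof -
    obtain m j where "m \<in> box_monomials n D" "j < D" "a (m, j) \<noteq> 0" using a(1) by auto
    then have "lookup (P j) m \<noteq> 0" by (simp add: lookupP)
    then show ?thesis using \<open>j < D\<close> by force
  qed
  moreover have "(\<Sum>j<D. sub F (P j) * Var i0 ^ j) = 0"
  proof -
    have "(\<Sum>j<D. sub F (P j) * Var i0 ^ j) = (\<Sum>j<D. \<Sum>m\<in>box_monomials n D. Const (a (m, j)) * u (m, j))"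
      by (simp add: P_def sub_simps eval_with_single[OF hom_on_Const] u_def sum_distrib_right mult.assoc)
    also have "\<dots> = (\<Sum>x\<in>?I. Const (a x) * u x)"
      by (subst sum.swap) (simp add: sum.cartesian_product)
    finally show ?thesis using a(2) by simp
  qed
  ultimately show ?thesis by blast
qed

section \<open>Growth of the roots of a polynomial relation\<close>

lemma poly_bounds:
  fixes q :: "complex poly"
  shows "q \<noteq> 0 \<Longrightarrow> \<exists>\<delta>>0. \<exists>t0. \<forall>t. cmod t \<ge> t0 \<longrightarrow> \<delta> \<le> cmod (poly q t)"
    and "degree q \<le> \<kappa> \<Longrightarrow> 1 \<le> cmod t \<Longrightarrow> cmod (poly q t) \<le> (\<Sum>i\<le>degree q. cmod (coeff q i)) * cmod t ^ \<kappa>"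
proof -
  assume q: "q \<noteq> 0"
  obtain a p where ap: "q = pCons a p" by (cases q)
  show "\<exists>\<delta>>0. \<exists>t0. \<forall>t. cmod t \<ge> t0 \<longrightarrow> \<delta> \<le> cmod (poly q t)"
  proof (cases "p = 0")
    case True
    then show ?thesis using q by (intro exI[of _ "cmod a"]) (auto simp: ap)
  next
    case False
    from poly_infinity[OF this, of 1 a] obtain r where "\<forall>z. r \<le> cmod z \<longrightarrow> 1 \<le> cmod (poly q z)"
      by (auto simp: ap)
    then show ?thesis by (intro exI[of _ 1]) auto
  qed
next
  assume d: "degree q \<le> \<kappa>" and t: "1 \<le> cmod t"
  have "cmod (poly q t) \<le> (\<Sum>i\<le>degree q. cmod (coeff q i * t ^ i))"
    unfolding poly_altdef by (rule norm_sum)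
  also have "\<dots> \<le> (\<Sum>i\<le>degree q. cmod (coeff q i) * cmod t ^ \<kappa>)"
    using d t by (intro sum_mono) (auto simp: norm_mult norm_power intro!: mult_left_mono power_increasing)
  finally show "cmod (poly q t) \<le> (\<Sum>i\<le>degree q. cmod (coeff q i)) * cmod t ^ \<kappa>"
    by (simp add: sum_distrib_right)
qed

text \<open>Cauchy's bound for roots in y: for large t the leading nonzero coefficient stays away
  from 0, while the lower ones are O(|t|^\<kappa>). If only the coefficient of y^0 is nonzero, there
  are no roots at all for large t.\<close>

lemma root_bound:
  fixes q :: "nat \<Rightarrow> complex poly"
  assumes deg: "\<And>j. j < D \<Longrightarrow> degree (q j) \<le> \<kappa>" and nz: "\<exists>j<D. q j \<noteq> 0"
  shows "\<exists>C t0. 0 \<le> C \<and> (\<forall>t y. t0 \<le> cmod t \<longrightarrow> (\<Sum>j<D. poly (q j) t * y ^ j) = 0 \<longrightarrow> cmod y \<le> C * cmod t ^ \<kappa>)"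
proof -
  define s where "s = (GREATEST j. j < D \<and> q j \<noteq> 0)"
  have s: "s < D" "q s \<noteq> 0" and smax: "\<And>j. j < D \<Longrightarrow> q j \<noteq> 0 \<Longrightarrow> j \<le> s"
    using GreatestI_ex_nat[of "\<lambda>j. j < D \<and> q j \<noteq> 0" D] nz Greatest_le_nat[of "\<lambda>j. j < D \<and> q j \<noteq> 0" _ D]
    unfolding s_def by auto
  obtain \<delta> t0 where \<delta>: "\<delta> > 0" "\<And>t. cmod t \<ge> t0 \<Longrightarrow> \<delta> \<le> cmod (poly (q s) t)"
    using poly_bounds(1)[OF s(2)] by blast
  define A where "A = (\<Sum>j<s. \<Sum>i\<le>degree (q j). cmod (coeff (q j) i))"
  have A0: "0 \<le> A" unfolding A_def by (intro sum_nonneg) auto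
  have "cmod y \<le> (A / \<delta> + 1) * cmod t ^ \<kappa>"
    if t: "max t0 1 \<le> cmod t" and eq: "(\<Sum>j<D. poly (q j) t * y ^ j) = 0" for t y
  proof (cases "cmod y \<le> 1")
    case True
    also have "1 \<le> (A / \<delta> + 1) * cmod t ^ \<kappa>"
      using mult_mono[of 1 "A / \<delta> + 1" 1 "cmod t ^ \<kappa>"] A0 \<delta>(1) t by (simp add: one_le_power)
    finally show ?thesis .
  next
    case False
    have "(\<Sum>j<D. poly (q j) t * y ^ j) = (\<Sum>j<Suc s. poly (q j) t * y ^ j)"
      by (rule sum.mono_neutral_right) (use s smax in \<open>auto simp: not_less\<close>, force)
    then have eq': "poly (q s) t * y ^ s = - (\<Sum>j<s. poly (q j) t * y ^ j)"
      using eq by (simp add: eq_neg_iff_add_eq_0 add.commute)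
    have ds: "\<delta> \<le> cmod (poly (q s) t)" using \<delta>(2) t by simp
    have s0: "s \<noteq> 0"
    proof
      assume "s = 0"
      then have "poly (q s) t = 0" using eq' by simp
      then show False using ds \<delta>(1) by simp
    qed
    have "\<delta> * cmod y ^ s \<le> cmod (poly (q s) t) * cmod y ^ s"
      using ds by (intro mult_right_mono) auto
    also have "\<dots> = cmod (\<Sum>j<s. poly (q j) t * y ^ j)"
      using arg_cong[OF eq', of cmod] by (simp add: norm_mult norm_power)
    also have "\<dots> \<le> (\<Sum>j<s. cmod (poly (q j) t) * cmod y ^ j)"
      by (rule order_trans[OF norm_sum]) (simp add: norm_mult norm_power)
    also have "\<dots> \<le> (\<Sum>j<s. ((\<Sum>i\<le>degree (q j). cmod (coeff (q j) i)) * cmod t ^ \<kappa>) * cmod y ^ (s - 1))"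
      using s(1) t False
      by (intro sum_mono mult_mono poly_bounds(2) deg power_increasing mult_nonneg_nonneg sum_nonneg) auto
    also have "\<dots> = A * cmod t ^ \<kappa> * cmod y ^ (s - 1)"
      by (simp add: A_def sum_distrib_right)
    finally have "(\<delta> * cmod y) * cmod y ^ (s - 1) \<le> (A * cmod t ^ \<kappa>) * cmod y ^ (s - 1)"
      using s0 by (simp add: power_eq_if mult.assoc)
    moreover have "0 < cmod y ^ (s - 1)" using False by (intro zero_less_power) linarith
    ultimately have "\<delta> * cmod y \<le> A * cmod t ^ \<kappa>" by simp
    then have "cmod y \<le> A / \<delta> * cmod t ^ \<kappa>" using \<delta>(1) by (simp add: field_simps)
    also have "\<dots> \<le> (A / \<delta> + 1) * cmod t ^ \<kappa>" by (simp add: distrib_right)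
    finally show ?thesis .
  qed
  moreover have "0 \<le> A / \<delta> + 1" using A0 \<delta>(1) by simp
  ultimately show ?thesis by blast
qed

section \<open>Clearing denominators by scaling\<close>

lemma mon_eval_mult: "mon_eval (\<lambda>i. a i * b i) m = mon_eval a m * mon_eval b m"
  by (simp add: mon_eval_def power_mult_distrib prod.distrib)

lemma mon_eval_const: "mon_eval (\<lambda>_. a) m = a ^ mdeg m"
  by (simp add: mon_eval_def mdeg_def power_sum)

lemma Const_one [simp]: "Const 1 = 1"
  by (simp add: Const_def)

lemma Const_mult: "Const (a * b) = Const a * Const (b::'a::comm_ring_1)"
  using hom_onD(5)[OF hom_on_Const] by blast

lemma Const_power: "Const (a ^ e) = Const (a::'a::comm_ring_1) ^ e"
by (induction e) (simp_all add: Const_mult)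

lemma lookup_scale:
  "lookup (sub (\<lambda>i. Const a * Var i) p) m = lookup p m * (a::'a::comm_ring_1) ^ mdeg m"
proof -
  have "sub (\<lambda>i. Const a * Var i) p = (\<Sum>m\<in>keys p. single m (lookup p m * a ^ mdeg m))"
    by (simp add: eval_with_mon mon_eval_mult mon_eval_const single_eq_Const_mon Const_mult Const_power mult_ac)
  then show ?thesis by (simp add: lookup_sum lookup_single when_def in_keys_iff)
qed

lemma ev_homogeneous:
  assumes "degs_in {e} p" shows "ev (\<lambda>i. t * v i) p = t ^ e * ev v p"
  using assms by (simp add: eval_with_mon mon_eval_mult mon_eval_const degs_in_def sum_distrib_left mult_ac)

lemma noninv_data_linear_part:
  assumes D: "noninv_data k n d K F M G" and K: "1 \<le> K" and i: "i < n"
  shows "degs_in {2..} (G i - Var i)"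
proof -
  have F: "degs_in {2..} (F i - Var i)" "F i \<in> poly_ring n" and sG: "degs_in {Suc K..} (sub G (F i) - Var i)"
    using D i by (auto simp: noninv_data_def)
  have "sub G (F i - Var i) \<in> {p. degs_in {2..} p}"
    using D F i by (intro filtration_eval[OF filtration_order, of _ n] poly_ring_diff)
      (auto simp: noninv_data_def)
  moreover have "degs_in {2..} (sub G (F i) - Var i)" by (rule degs_in_mono[OF sG]) (use K in auto)
  ultimately have "degs_in {2..} ((sub G (F i) - Var i) - sub G (F i - Var i))"
    by (simp add: degs_in_diff)
  then show ?thesis by (simp add: sub_simps)
qed

lemma Rats_common_denominator:
  assumes "finite S" "S \<subseteq> (\<rat> :: 'a::field_char_0 set)"
  shows "\<exists>N::nat. 0 < N \<and> (\<forall>s\<in>S. s * of_nat N \<in> \<int>)"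
  using assms
proof (induction S rule: finite_induct)
  case (insert x S)
  then obtain N where N: "0 < N" "\<forall>s\<in>S. s * of_nat N \<in> \<int>" by auto
  from insert have "x \<in> \<rat>" by simp
  then obtain r where x: "x = of_rat r" by (auto elim: Rats_cases)
  obtain a b where ab: "r = Rat.Fract a b" "b > 0" by (cases r) auto
  have x': "x * of_nat (nat b) = of_int a"
    using ab by (simp add: x of_rat_rat)
  have "x * of_nat (N * nat b) = of_int (a * int N)"
    using x' by (metis mult.commute mult.left_commute of_int_mult of_int_of_nat_eq of_nat_mult)
  then have "x * of_nat (N * nat b) \<in> \<int>" by (metis Ints_of_int)
  moreover have "s * of_nat (N * nat b) \<in> \<int>" if "s \<in> S" for s
  proof -
    have "s * of_nat (N * nat b) = (s * of_nat N) * of_nat (nat b)" by (simp add: mult.assoc)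
    then show ?thesis using N(2) that by (metis Ints_mult Ints_of_nat)
  qed
  ultimately show ?case using N(1) ab(2) by (intro exI[of _ "N * nat b"]) auto
qed (auto intro: exI[of _ 1])

text \<open>Conjugation by the scaling X -> N X multiplies a coefficient of degree e of
  \<open>F\<close> and \<open>G\<close> by N^(e-1). In degree 1 both maps are the identity, and from
  degree 2 on at least one factor N is available to clear the denominator.\<close>

lemma noninv_data_int:
  assumes D: "noninv_data (\<rat> :: complex set) n d K F M G" and K: "1 \<le> K"
  shows "\<exists>F' M' G'. noninv_data (UNIV :: int set) n d K F' M' G'"
proof -
  note D' = noninv_dataD[OF D] and M = noninv_data_jacobian[OF D]
  obtain S where fin: "finite S" and "S \<subseteq> \<rat>" and DS: "noninv_data S n d K F M G"
    using noninv_data_finite_coeffs[OF D] by blast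
  then obtain N :: nat where N0: "0 < N" and N: "\<And>s. s \<in> S \<Longrightarrow> s * of_nat N \<in> \<int>"
    using Rats_common_denominator[OF fin] by blast
  note inS = overD[OF noninv_dataD(1)[OF DS]] overD[OF noninv_dataD(2)[OF DS]]
    overD[OF noninv_data_jacobian(1)[OF DS]]
  have N_pow: "s * of_nat N ^ e \<in> \<int>" if s: "s \<in> S" and e: "1 \<le> e" for s e
  proof -
    obtain e' where "e = Suc e'" using e by (cases e) auto
    then have "s * of_nat N ^ e = (s * of_nat N) * of_nat N ^ e'" by simp
    also have "\<dots> \<in> \<int>" by (intro Ints_mult Ints_power N s) simp
    finally show ?thesis .
  qed
  let ?N = "of_nat N :: complex"
  have N1: "?N \<noteq> 0" using N0 by simp
  define Z where "Z i = Const ?N * Var i" for i :: nat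
  have Z1: "degs_in {1} (Z i)" for i
    unfolding Z_def by (intro degs_in_mult[of "{0}" _ "{1}"]) auto
  have Zr: "Z i \<in> poly_ring n" if "i < n" for i
    unfolding Z_def using that by (intro poly_ring_mult) auto
  have lookupZ: "lookup (sub Z p) m = lookup p m * ?N ^ mdeg m" for p m
    using lookup_scale[of ?N p m] by (simp add: Z_def[abs_def])
  have subr: "sub Z p \<in> poly_ring n" if "p \<in> poly_ring n" for p
    using poly_ring_eval[OF that Zr, where h = "\<lambda>a. a"] by simp
  have subd: "degs_in S p \<Longrightarrow> degs_in S (sub Z p)" for p S
    by (auto simp: degs_in_alt lookupZ)
  have cN: "Const (1 / ?N) * Const ?N = 1" 
    using N1 by (simp flip: Const_mult)
  define F' where "F' i = Const (1 / ?N) * sub Z (F i)" for i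
  define G' where "G' i = Const (1 / ?N) * sub Z (G i)" for i
  define M' where "M' i s = sub Z (M i s)" for i s
  have ZG': "Const ?N * G' i = sub Z (G i)" for i
    using cN by (simp add: G'_def mult.commute[of "Const ?N"] flip: mult.assoc)
  have cd: "degs_in S (Const a * p)" if "degs_in S p" for S and a :: complex and p
    by (rule degs_in_mult[of "{0}" _ S]) (use that in auto)
  have ZV: "Const (1 / ?N) * sub Z (Var i) = Var i" for i
    using cN by (simp add: Z_def sub_simps flip: mult.assoc)
  have int1: "over \<int> (Const (1 / ?N) * sub Z p)"
    if p: "\<And>m. lookup p m \<in> S" "degs_in {2..} (p - Var i)" for p i
    unfolding over_def
  proof
    fix m
    have L: "lookup (Const (1 / ?N) * sub Z p) m = lookup p m * ?N ^ mdeg m / ?N"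
      by (simp add: lookup_Const_mult lookupZ)
    show "lookup (Const (1 / ?N) * sub Z p) m \<in> \<int>"
    proof (cases "2 \<le> mdeg m")
      case True
      then obtain e where e: "mdeg m = Suc e" "1 \<le> e" by (cases "mdeg m") auto
      have "lookup p m * ?N ^ mdeg m / ?N = lookup p m * ?N ^ e" using N1 by (simp add: e)
      then show ?thesis using N_pow[OF p(1) e(2)] by (simp add: L)
    next
      case False
      then have "lookup p m = lookup (Var i) m"
        using p(2) by (auto simp: degs_in_alt lookup_minus)
      then show ?thesis using N1 by (auto simp: L Var_def lookup_single when_def)
    qed
  qed
  have oF: "over \<int> (F' i)" and oG: "over \<int> (G' i)" if "i < n" for i
    unfolding F'_def G'_def using inS that D'(5) noninv_data_linear_part[OF D K] by (blast intro: int1)+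
  \<comment> \<open>\<open>M'\<close> gains the factor N^e in degree e, hence nothing in degree 0;
    there the Jacobian identity at the origin shows that \<open>M\<close> is the unit
    matrix.\<close>
  have M0: "lookup (M i s) 0 = (if i = s then 1 else 0)" if "i < n" "s < n" for i s
  proof -
    have "lookup (partial_deriv j (F i)) 0 = (if i = j then 1 else 0)" for j
    proof -
      have "lookup (F i - Var i) (single j 1) = 0"
        using D'(5)[OF that(1)] by (simp add: degs_in_alt)
      then show ?thesis by (auto simp: lookup_partial_deriv lookup_minus Var_def lookup_single when_def)
    qed
    moreover have "ev (\<lambda>i. 0) (\<Sum>j<n. partial_deriv j (F i) * M j s) =
        (\<Sum>j<n. lookup (partial_deriv j (F i)) 0 * lookup (M j s) 0)"
      by (simp add: ev_simps flip: ev_at_zero)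
    ultimately have "ev (\<lambda>i. 0) (\<Sum>j<n. partial_deriv j (F i) * M j s) = lookup (M i s) 0"
      using that by (simp add: if_distrib[of "\<lambda>a. a * _"] cong: if_cong)
    then show ?thesis using M(3)[OF that] by (auto simp: ev_at_zero split: if_splits)
  qed
  have oM: "over \<int> (M' i s)" if "i < n" "s < n" for i s
    unfolding over_def
  proof
    fix m
    show "lookup (M' i s) m \<in> \<int>"
    proof (cases "1 \<le> mdeg m")
      case True
      then show ?thesis using N_pow inS(3) that by (simp add: M'_def lookupZ)
    next
      case False
      then have "m = 0" using mdeg_eq_0_iff[of m] by simp
      then show ?thesis using M0[OF that] by (simp add: M'_def lookupZ)
    qed
  qed
  have jac: "(\<Sum>j<n. partial_deriv j (F' i) * M' j s) = (if i = s then 1 else 0)" if "i < n" "s < n" for i s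
  proof -
    have "partial_deriv j (F' i) = sub Z (partial_deriv j (F i))" if "j < n" for j
    proof -
      have "partial_deriv j (Z l) = (if l = j then Const ?N else 0)" for l
        by (simp add: Z_def partial_deriv_mult)
      then have "partial_deriv j (F' i) = Const (1 / ?N) * (sub Z (partial_deriv j (F i)) * Const ?N)"
        using that by (simp add: F'_def partial_deriv_mult chain_rule_sub[OF D'(3)[OF \<open>i < n\<close>]]
          if_distrib[of "\<lambda>a. _ * a"] cong: if_cong)
      then show ?thesis using cN by (simp add: mult.left_commute mult.commute)
    qed
    then have "(\<Sum>j<n. partial_deriv j (F' i) * M' j s) = sub Z (\<Sum>j<n. partial_deriv j (F i) * M j s)"
      by (simp add: M'_def sub_simps)
    then show ?thesis using M(3)[OF that] by (simp add: sub_simps)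
  qed
  have sG: "degs_in {Suc K..} (sub G' (F' i) - Var i)" if "i < n" for i
  proof -
    have "sub G' (sub Z (F i)) = sub (\<lambda>i. sub Z (G i)) (F i)"
      by (simp add: sub_sub) (simp add: Z_def sub_simps ZG')
    then have "sub G' (F' i) - Var i = Const (1 / ?N) * (sub Z (sub G (F i)) - sub Z (Var i))"
      by (simp add: F'_def sub_simps sub_sub right_diff_distrib) (simp add: ZV[simplified sub_simps])
    also have "\<dots> = Const (1 / ?N) * sub Z (sub G (F i) - Var i)" by (simp add: sub_simps)
    finally show ?thesis using cd subd[OF D'(8)[OF that]] by simp
  qed
  have FV: "degs_in {2..} (F' i - Var i)" if "i < n" for i
  proof -
    have "F' i - Var i = Const (1 / ?N) * (sub Z (F i) - sub Z (Var i))"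
      unfolding right_diff_distrib ZV F'_def ..
    also have "\<dots> = Const (1 / ?N) * sub Z (F i - Var i)" by (simp add: sub_simps)
    finally show ?thesis using cd subd[OF D'(5)[OF that]] by simp
  qed
  obtain i0 m0 where i0: "i0 < n" "mdeg m0 = K" "lookup (G i0) m0 \<noteq> 0"
    using D by (auto simp: noninv_data_def)
  have nz: "lookup (G' i0) m0 \<noteq> 0"
    using i0 N1 by (simp add: G'_def lookup_Const_mult lookupZ)
  have D2: "noninv_data (\<int> :: complex set) n d K F' M' G'"
    unfolding noninv_data_def
  proof (intro conjI allI impI oF oG oM jac sG FV)
    fix i assume i: "i < n"
    show "F' i \<in> poly_ring n" "G' i \<in> poly_ring n"
      unfolding F'_def G'_def by (intro poly_ring_mult poly_ring_Const subr D' i)+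
    show "degs_in {..d} (F' i)" "degs_in {1..} (G' i)"
      unfolding F'_def G'_def by (intro cd subd D' i)+
    show "M' i s \<in> poly_ring n" if "s < n" for s
      unfolding M'_def by (intro subr M i that)
  next
    show "\<exists>i<n. \<exists>m. mdeg m = K \<and> lookup (G' i) m \<noteq> 0"
      using i0(1,2) nz by (intro exI[of _ i0] exI[of _ m0] conjI)
  qed
  \<comment> \<open>On the integers inside the complex numbers this inverts \<open>of_int\<close>;
    it moves the certificate to the type \<open>int\<close>.\<close>
  define h where "h z = \<lfloor>Re z\<rfloor>" for z
  have h_int: "h (of_int z) = z" for z by (simp add: h_def)
  have hom: "hom_on \<int> h"
    unfolding hom_on_def subring_def
    by (auto simp: h_def elim!: Ints_cases simp flip: of_int_add of_int_mult)
  have "lookup (G' i0) m0 \<in> \<int>" using oG[OF i0(1)] by (simp add: over_def)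
  then have "h (lookup (G' i0) m0) \<noteq> 0" using nz by (auto simp: h_int elim!: Ints_cases)
  then have "noninv_data (UNIV :: int set) n d K (\<lambda>i. coeff_map h (F' i)) (\<lambda>i j. coeff_map h (M' i j)) (\<lambda>i. coeff_map h (G' i))"
    by (intro noninv_data_hom[OF hom _ _ D2]) (use i0 in auto)
  then show ?thesis by blast
qed

lemma ev_coeff_map_of_int: 
  "ev (\<lambda>i. of_int (x i)) (coeff_map of_int p) = (of_int (ev x p) :: 'a::{comm_ring_1,ring_char_0})"
proof -
  have "keys (coeff_map (of_int :: int \<Rightarrow> 'a) p) \<subseteq> keys p" by (rule keys_coeff_map_subset) simp
  then have "ev (\<lambda>i. of_int (x i) :: 'a) (coeff_map of_int p) =
    (\<Sum>m\<in>keys p. lookup (coeff_map of_int p) m * mon_eval (\<lambda>i. of_int (x i)) m)"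
    by (intro eval_with_superset) auto
  also have "\<dots> = of_int (ev x p)"
    by (simp add: eval_with_mon lookup_coeff_map mon_eval_def)
  finally show ?thesis .
qed

text \<open>The equation is that of the homogenized curve at t = c, multiplied by c. The bound on
  \<open>K\<close> makes it exceed the growth exponent n D furnished by the algebraic
  relation.\<close>

lemma no_integral_points:
  fixes F :: "nat \<Rightarrow> int mpoly"
  assumes D: "noninv_data UNIV n d K F M G" and K: "n * ((n * d + 2) ^ n + 1) < K"
  shows "\<exists>v. \<exists>N0. \<forall>c z. N0 \<le> \<bar>c\<bar> \<longrightarrow> (\<forall>i<n. ev (\<lambda>i. c * z i) (F i) = c\<^sup>2 * v i) \<longrightarrow> False"
proof -
  have F: "F i \<in> poly_ring n" "degs_in {..d} (F i)" "degs_in {2..} (F i - Var i)"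
    "G i \<in> poly_ring n" "degs_in {1..} (G i)" "degs_in {Suc K..} (sub G (F i) - Var i)" if "i < n" for i
    using D that by (auto simp: noninv_data_def)
  obtain i0 m0 where i0: "i0 < n" "mdeg m0 = K" "lookup (G i0) m0 \<noteq> 0"
    using D by (auto simp: noninv_data_def)
  define D where "D = (n * d + 2) ^ n + 1"
  let ?c = "of_int :: int \<Rightarrow> complex"
  let ?cm = "coeff_map ?c"
  have "\<exists>P. (\<forall>j<D. P j \<in> poly_ring n \<and> degs_in {..n * D} (P j)) \<and> (\<exists>j<D. P j \<noteq> 0) \<and>
    (\<Sum>j<D. sub (\<lambda>i. ?cm (F i)) (P j) * Var i0 ^ j) = 0"
    by (rule algebraic_relation[OF _ _ i0(1) D_def]) (simp_all add: poly_ring_coeff_map degs_in_coeff_map F)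
  then obtain P where P: "\<And>j. j < D \<Longrightarrow> P j \<in> poly_ring n" "\<And>j. j < D \<Longrightarrow> degs_in {..n * D} (P j)"
    and Pnz: "\<exists>j<D. P j \<noteq> 0" and rel: "(\<Sum>j<D. sub (\<lambda>i. ?cm (F i)) (P j) * Var i0 ^ j) = 0"
    by blast
  obtain j1 where j1: "j1 < D" "P j1 \<noteq> 0" using Pnz by blast
  define Gh where "Gh e = deg_filter {e} (G i0)" for e
  have "lookup (?cm (Gh K)) m0 \<noteq> 0" using i0 by (simp add: lookup_coeff_map Gh_def lookup_deg_filter)
  then have "?cm (Gh K) \<noteq> 0" by auto
  \<comment> \<open>A point where the product is nonzero serves two ends: the relation stays
    nontrivial on the line through \<open>v\<close>, and the component of degree \<open>K\<close> of
    the inverse does not vanish at \<open>v\<close>.\<close>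
  then have "P j1 * ?cm (Gh K) \<noteq> 0" using j1 by simp
  moreover have "P j1 * ?cm (Gh K) \<in> poly_ring n"
    unfolding Gh_def by (intro poly_ring_mult P j1 poly_ring_coeff_map poly_ring_deg_filter F i0) simp
  ultimately obtain v :: "nat \<Rightarrow> int" where "ev (\<lambda>i. ?c (v i)) (P j1 * ?cm (Gh K)) \<noteq> 0"
    using ex_int_point_nonzero by blast
  then have vP: "ev (\<lambda>i. ?c (v i)) (P j1) \<noteq> 0" and vG: "ev v (Gh K) \<noteq> 0"
    by (auto simp: ev_simps ev_coeff_map_of_int)
  define q where "q j = (\<Sum>m\<in>keys (P j). Polynomial.monom (lookup (P j) m * mon_eval (\<lambda>i. ?c (v i)) m) (mdeg m))" for j
  have poly_q: "poly (q j) t = ev (\<lambda>i. t * ?c (v i)) (P j)" for j t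
    by (simp add: q_def poly_sum poly_monom eval_with_mon mon_eval_mult mon_eval_const mult_ac)
  have deg_q: "degree (q j) \<le> n * D" if "j < D" for j
    unfolding q_def using P(2)[OF that]
    by (intro degree_sum_le order_trans[OF degree_monom_le]) (auto simp: degs_in_def)
  have "poly (q j1) 1 \<noteq> 0" using vP by (simp add: poly_q)
  then have "\<exists>j<D. q j \<noteq> 0" using j1 by (intro exI[of _ j1]) auto
  then obtain C t0 where C: "0 \<le> C" "\<And>t y. t0 \<le> cmod t \<Longrightarrow> (\<Sum>j<D. poly (q j) t * y ^ j) = 0 \<Longrightarrow> cmod y \<le> C * cmod t ^ (n * D)"
    using root_bound[of D q "n * D"] deg_q by blast
  define g where "g e = ev v (Gh e)" for e
  define A where "A = C + (\<Sum>e<K. \<bar>real_of_int (g e)\<bar>)"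
  define N0 where "N0 = max 1 (max \<lceil>t0\<rceil> (max (\<lceil>A\<rceil> + 1) (\<bar>g K\<bar> + 1)))"
  have "False" if c: "N0 \<le> \<bar>c\<bar>" and eq: "\<forall>i<n. ev (\<lambda>i. c * z i) (F i) = c\<^sup>2 * v i" for c z
  proof -
    define \<tau> where "\<tau> = c\<^sup>2"
    have N0: "1 \<le> N0" "\<lceil>t0\<rceil> \<le> N0" "\<lceil>A\<rceil> + 1 \<le> N0" "\<bar>g K\<bar> + 1 \<le> N0" by (auto simp: N0_def)
    have c1: "1 \<le> \<bar>c\<bar>" using c N0(1) by linarith
    have "\<bar>c\<bar> * 1 \<le> \<bar>c\<bar> * \<bar>c\<bar>" using c1 by (intro mult_left_mono) auto
    then have "\<bar>c\<bar> \<le> \<tau>" by (simp add: \<tau>_def power2_eq_square)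
    then have tN: "N0 \<le> \<tau>" using c by simp
    then have t1: "1 \<le> \<tau>" and tt0: "t0 \<le> \<tau>" and tA: "A < \<tau>" and tg: "\<bar>g K\<bar> < \<tau>"
      using N0 by linarith+
    define x where "x i = c * z i" for i
    define y where "y i = ev (\<lambda>i. \<tau> * v i) (G i)" for i
    have Fx: "ev x (F i) = \<tau> * v i" if "i < n" for i using eq that by (simp add: x_def[abs_def] \<tau>_def)
    have "(\<Sum>j<D. poly (q j) (of_int \<tau>) * of_int (x i0) ^ j) = 0"
    proof -
      let ?x = "\<lambda>i. ?c (x i)"
      have "ev ?x (sub (\<lambda>i. ?cm (F i)) (P j)) = poly (q j) (of_int \<tau>)" if "j < D" for j
        unfolding ev_sub poly_q ev_coeff_map_of_int
        by (rule eval_with_cong[OF P(1)[OF that]]) (simp_all add: Fx)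
      moreover have "ev ?x (\<Sum>j<D. sub (\<lambda>i. ?cm (F i)) (P j) * Var i0 ^ j) = 0"
        unfolding rel by (simp add: ev_simps)
      ultimately show ?thesis by (simp add: ev_simps eval_with_power[OF hom_on_id over_UNIV])
    qed
    then have "cmod (of_int (x i0)) \<le> C * cmod (of_int \<tau>) ^ (n * D)"
      using tt0 t1 by (intro C(2)) auto
    then have x_le: "\<bar>real_of_int (x i0)\<bar> \<le> C * real_of_int \<tau> ^ (n * D)"
      using t1 by simp
    \<comment> \<open>Hensel uniqueness: \<open>x\<close> and the approximate solution \<open>y\<close> agree modulo ever higher powers of \<open>c\<close>.\<close>
    let ?I = "\<lambda>a. {w::int. c ^ a dvd w}"
    note I = filtration_dvd[of c]
    have x1: "x i \<in> ?I 1" for i by (simp add: x_def)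
    have y1: "y i \<in> ?I 1" if "i < n" for i
      unfolding y_def using F(4,5)[OF that]
      by (intro filtration_eval[OF I, of _ n]) (auto simp: \<tau>_def power2_eq_square)
    have Fy: "\<tau> ^ Suc K dvd ev y (F i) - \<tau> * v i" if "i < n" for i
    proof -
      have "ev y (F i) - \<tau> * v i = ev (\<lambda>i. \<tau> * v i) (sub G (F i) - Var i)"
        by (simp add: ev_simps ev_sub y_def[abs_def])
      moreover have "ev (\<lambda>i. \<tau> * v i) (sub G (F i) - Var i) \<in> {w. \<tau> ^ Suc K dvd w}"
        using F(6)[OF that] poly_ring_eval[OF F(1)[OF that] F(4), where h = "\<lambda>a. a"] that
        by (intro filtration_eval[OF filtration_dvd, of _ n] poly_ring_diff) auto
      ultimately show ?thesis by simp
    qed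
    \<comment> \<open>Each round gains one power of \<open>c\<close>. The range ends at 2 (K + 1),
      because \<open>y\<close> solves the equation only modulo \<tau>^(K+1) = c^(2K+2).\<close>
    have cong: "\<forall>i<n. x i - y i \<in> ?I (Suc a)" if "Suc a \<le> 2 * Suc K" for a
      using that
    proof (induction a)
      case 0
      then show ?case using x1 y1 by (auto intro: dvd_diff)
    next
      case (Suc a)
      show ?case
      proof (intro allI impI)
        fix i assume i: "i < n"
        have "ev x (F i - Var i) - ev y (F i - Var i) \<in> ?I (a + 2)"
          using Suc F(3)[OF i] x1 y1 F(1)[OF i] i
          by (intro filtration_eval_diff[OF I, of _ n]) (auto intro: poly_ring_diff)
        moreover have "c ^ (a + 2) dvd ev y (F i) - \<tau> * v i"
        proof (rule dvd_trans[OF _ Fy[OF i]])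
          have "\<tau> ^ Suc K = c ^ (2 * Suc K)" unfolding \<tau>_def by (simp only: power_mult)
          then show "c ^ (a + 2) dvd \<tau> ^ Suc K" using Suc.prems by (simp only:) (intro le_imp_power_dvd, simp)
        qed
        moreover have "x i - y i = - (ev y (F i) - \<tau> * v i) - (ev x (F i - Var i) - ev y (F i - Var i))"
          by (simp add: ev_simps Fx[OF i])
        ultimately show "x i - y i \<in> ?I (Suc (Suc a))"
          by (metis (no_types, lifting) add_2_eq_Suc' dvd_diff dvd_minus_iff mem_Collect_eq)
      qed
    qed
    have "c ^ Suc (2 * K + 1) dvd x i0 - y i0" using cong[of "2 * K + 1"] i0(1) by simp
    moreover have "c ^ Suc (2 * K + 1) = \<tau> ^ Suc K"
    proof -
      have "Suc (2 * K + 1) = 2 * Suc K" by simp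
      then show ?thesis unfolding \<tau>_def by (simp only: power_mult)
    qed
    ultimately have xy: "\<tau> ^ Suc K dvd x i0 - y i0" by simp
    have y_expand: "\<tau> ^ Suc K dvd y i0 - (\<Sum>e\<le>K. \<tau> ^ e * g e)"
    proof -
      define R where "R = G i0 - (\<Sum>e\<le>K. Gh e)"
      have "lookup R m = 0" if "mdeg m < Suc K" for m
        using that by (simp add: R_def lookup_minus lookup_sum Gh_def lookup_deg_filter)
      then have "degs_in {Suc K..} R" by (auto simp: degs_in_alt)
      moreover have "R \<in> poly_ring n"
        unfolding R_def Gh_def by (intro poly_ring_diff poly_ring_sum poly_ring_deg_filter F i0)
      ultimately have "ev (\<lambda>i. \<tau> * v i) R \<in> {w. \<tau> ^ Suc K dvd w}"
        by (intro filtration_eval[OF filtration_dvd, of _ n]) auto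
      moreover have "ev (\<lambda>i. \<tau> * v i) (Gh e) = \<tau> ^ e * g e" for e
        unfolding g_def by (rule ev_homogeneous) (simp add: degs_in_alt Gh_def lookup_deg_filter)
      ultimately show ?thesis by (simp add: R_def ev_simps y_def)
    qed
    \<comment> \<open>\<open>w\<close> is divisible by \<tau>^K, but its size is at most A
      \<tau>^(K-1) with A < \<tau>, so it is 0. Then \<tau> divides \<open>g K\<close>, which is
      nonzero and smaller than \<tau> in absolute value.\<close>
    define w where "w = x i0 - (\<Sum>e<K. \<tau> ^ e * g e)"
    have dvd: "\<tau> ^ Suc K dvd w - \<tau> ^ K * g K"
      using dvd_add[OF xy y_expand] by (simp add: w_def algebra_simps flip: lessThan_Suc_atMost)
    then have "\<tau> ^ K dvd w - \<tau> ^ K * g K" by (rule dvd_trans[rotated]) simp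
    then have wdvd: "\<tau> ^ K dvd w" using dvd_add[of "\<tau> ^ K" "w - \<tau> ^ K * g K" "\<tau> ^ K * g K"] by simp
    have K1: "n * D \<le> K - 1" "0 < K" using K by (auto simp: D_def)
    have "\<bar>real_of_int w\<bar> \<le> \<bar>real_of_int (x i0)\<bar> + \<bar>\<Sum>e<K. real_of_int \<tau> ^ e * real_of_int (g e)\<bar>"
      by (simp add: w_def)
    also have "\<bar>\<Sum>e<K. real_of_int \<tau> ^ e * real_of_int (g e)\<bar> \<le> (\<Sum>e<K. real_of_int \<tau> ^ (K - 1) * \<bar>real_of_int (g e)\<bar>)"
      using t1 by (intro order_trans[OF sum_abs] sum_mono) (auto simp: abs_mult intro!: mult_right_mono power_increasing)
    also have "\<dots> = (\<Sum>e<K. \<bar>real_of_int (g e)\<bar>) * real_of_int \<tau> ^ (K - 1)"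
      by (simp add: sum_distrib_left mult.commute)
    also have "\<bar>real_of_int (x i0)\<bar> \<le> C * real_of_int \<tau> ^ (K - 1)"
      using K1 t1 C(1) by (intro order_trans[OF x_le] mult_left_mono power_increasing) auto
    finally have "\<bar>real_of_int w\<bar> \<le> A * real_of_int \<tau> ^ (K - 1)" by (simp add: A_def distrib_right)
    also have "\<dots> < real_of_int \<tau> * real_of_int \<tau> ^ (K - 1)"
      using tA t1 by (intro mult_strict_right_mono) auto
    also have "\<dots> = real_of_int (\<tau> ^ K)" using K1(2) by (cases K) simp_all
    finally have "\<bar>w\<bar> < \<tau> ^ K" by linarith
    then have "w = 0" using wdvd dvd_imp_le_int[of w "\<tau> ^ K"] t1 by fastforce
    then have "\<tau> ^ K * \<tau> dvd \<tau> ^ K * g K" using dvd by (simp add: mult.commute)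
    then have "\<tau> dvd g K" using t1 by simp
    moreover have "g K \<noteq> 0" using vG by (simp add: g_def)
    ultimately show False using tg t1 dvd_imp_le_int[of "g K" \<tau>] by simp
  qed
  then show ?thesis by blast
qed

section \<open>Reduction to degree three\<close>

text \<open>Monomials are written as words in the variables, so that factoring a monomial amounts to
  splitting a list.\<close>

definition wprod :: "(nat \<Rightarrow> 'a::comm_ring_1) \<Rightarrow> nat list \<Rightarrow> 'a" where
  "wprod x w = prod_list (map x w)"

lemma wprod_simps [simp]:
  "wprod x [] = 1" "wprod x (a # w) = x a * wprod x w" "wprod x (u @ w) = wprod x u * wprod x w"
  "wprod x (replicate e a) = x a ^ e"
  by (simp_all add: wprod_def prod_list_replicate)

lemma wprod_map: "wprod x (map f w) = wprod (\<lambda>i. x (f i)) w"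
  by (induction w) simp_all

lemma wprod_cong: "(\<And>i. i \<in> set w \<Longrightarrow> x i = y i) \<Longrightarrow> wprod x w = wprod y w"
  by (induction w) simp_all

lemma wprod_zero: "(\<And>i. i \<in> set w \<Longrightarrow> x i = 0) \<Longrightarrow> w \<noteq> [] \<Longrightarrow> wprod x w = 0"
  by (cases w) simp_all

text \<open>The derivative at \<open>x\<close>, in direction \<open>h\<close>, of the monomial given
  by a word; the recursion is the product rule.\<close>

primrec dword :: "nat list \<Rightarrow> (nat \<Rightarrow> 'a::comm_ring_1) \<Rightarrow> (nat \<Rightarrow> 'a) \<Rightarrow> 'a" where
  "dword [] x h = 0"
| "dword (a # w) x h = h a * wprod x w + x a * dword w x h"

lemma dword_append: "dword (u @ w) x h = dword u x h * wprod x w + wprod x u * dword w x h"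
  by (induction u) (simp_all add: algebra_simps)

lemma dword_add: "dword w x (\<lambda>i. h i + h' i) = dword w x h + dword w x h'"
  by (induction w) (simp_all add: algebra_simps)

lemma dword_cong:
  "(\<And>i. i \<in> set w \<Longrightarrow> x i = y i \<and> h i = h' i) \<Longrightarrow> dword w x h = dword w y h'"
  by (induction w) (simp_all add: wprod_cong[of _ x y])

lemma dword_map: "dword (map f w) x h = dword w (\<lambda>i. x (f i)) (\<lambda>i. h (f i))"
  by (induction w) (simp_all add: wprod_map)

lemma dword_replicate_zero: "h a = 0 \<Longrightarrow> dword (replicate e a) x h = 0"
  by (induction e) simp_all

lemma wprod_scale: "wprod (\<lambda>i. t * x i) w = t ^ length w * wprod x w"
  by (induction w) (simp_all add: mult_ac)

lemma dword_scale: "w \<noteq> [] \<Longrightarrow> dword w (\<lambda>i. t * x i) h = t ^ (length w - 1) * dword w x h"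
proof (induction w)
  case (Cons a w)
  show ?case
  proof (cases w)
    case (Cons b w')
    then have "length w = Suc (length w - 1)" by simp
    then have "t ^ length w = t * t ^ (length w - 1)" by (metis power_Suc)
    then show ?thesis using Cons.IH Cons by (simp add: wprod_scale algebra_simps)
  qed simp
qed simp

text \<open>
  A list of terms \<open>(k, a, w)\<close> encodes the polynomial map whose \<open>i\<close>-th component is \<open>X_i\<close>
  plus the sum of the \<open>a * X_w\<close> over the terms with \<open>k = i\<close>.
\<close>

definition term_map :: "(nat \<times> int \<times> nat list) list \<Rightarrow> (nat \<Rightarrow> int) \<Rightarrow> nat \<Rightarrow> int" where
  "term_map T x i = x i + (\<Sum>(k, a, w)\<leftarrow>T. if k = i then a * wprod x w else 0)"

definition term_deriv :: "(nat \<times> int \<times> nat list) list \<Rightarrow> (nat \<Rightarrow> int) \<Rightarrow> (nat \<Rightarrow> int) \<Rightarrow> nat \<Rightarrow> int" where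
  "term_deriv T x h i = h i + (\<Sum>(k, a, w)\<leftarrow>T. if k = i then a * dword w x h else 0)"

definition terms_in :: "nat \<Rightarrow> (nat \<times> int \<times> nat list) list \<Rightarrow> bool" where
  "terms_in n T \<longleftrightarrow> (\<forall>k a w. (k, a, w) \<in> set T \<longrightarrow> k < n \<and> set w \<subseteq> {..<n} \<and> 2 \<le> length w)"

text \<open>The invariant of the reductions. Surjectivity of the derivative at every integral point
  stands in for the Keller condition; the last clause is the absence of nonzero points, divisible by
  a large number, over the line spanned by \<open>v\<close>. The normalization
  \<open>v 0 = 1\<close> lets c be recovered from the point c v of the line.\<close>

definition rigid :: "nat \<Rightarrow> (nat \<times> int \<times> nat list) list \<Rightarrow> (nat \<Rightarrow> int) \<Rightarrow> int \<Rightarrow> bool" where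
  "rigid n T v N0 \<longleftrightarrow> 0 < n \<and> v 0 = 1 \<and> terms_in n T \<and>
    (\<forall>x y. \<exists>h. \<forall>i<n. term_deriv T x h i = y i) \<and>
    (\<forall>N x c. N0 \<le> N \<longrightarrow> (\<forall>i<n. N dvd x i) \<longrightarrow> (\<forall>i<n. term_map T x i = c * v i) \<longrightarrow> (\<forall>i<n. x i = 0))"

text \<open>Splitting a word of length l > 3 creates words of length l - 1 and l - 2 besides some of
  length at most 3, and 3^(l-1) + 3^(l-2) < 3^l.\<close>

definition excess :: "(nat \<times> int \<times> nat list) list \<Rightarrow> nat" where
  "excess T = (\<Sum>(k, a, w)\<leftarrow>T. if length w \<le> 3 then 0 else 3 ^ length w)"

lemma terms_in_Nil [simp]: "terms_in n []"
  by (simp add: terms_in_def)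

lemma terms_in_Cons [simp]:
  "terms_in n ((k, a, w) # T) \<longleftrightarrow> k < n \<and> set w \<subseteq> {..<n} \<and> 2 \<le> length w \<and> terms_in n T"
  unfolding terms_in_def list.set insert_iff prod.inject by blast

lemma terms_in_append [simp]: "terms_in n (S @ T) \<longleftrightarrow> terms_in n S \<and> terms_in n T"
  unfolding terms_in_def set_append Un_iff by blast

lemma terms_inD:
  "terms_in n T \<Longrightarrow> (k, a, w) \<in> set T \<Longrightarrow> k < n \<and> set w \<subseteq> {..<n} \<and> 2 \<le> length w"
  by (simp add: terms_in_def)

lemma terms_in_mono: "terms_in n T \<Longrightarrow> n \<le> n' \<Longrightarrow> terms_in n' T"
  unfolding terms_in_def by (meson lessThan_subset_iff less_le_trans subset_trans)

lemma term_map_outside: "terms_in n T \<Longrightarrow> n \<le> i \<Longrightarrow> term_map T x i = x i"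
  unfolding term_map_def by (induction T) auto

lemma term_deriv_outside: "terms_in n T \<Longrightarrow> n \<le> i \<Longrightarrow> term_deriv T x h i = h i"
  unfolding term_deriv_def by (induction T) auto

lemma term_deriv_cong:
  assumes "terms_in n T" "\<And>i. i < n \<Longrightarrow> h i = h' i" "i < n"
  shows "term_deriv T x h i = term_deriv T x h' i"
proof -
  have "dword w x h = dword w x h'" if "(k, a, w) \<in> set T" for k a w
    using terms_inD[OF assms(1) that] assms(2) by (intro dword_cong) auto
  then have "(\<Sum>(k, a, w)\<leftarrow>T. if k = i then a * dword w x h else 0) =
      (\<Sum>(k, a, w)\<leftarrow>T. if k = i then a * dword w x h' else 0)"
    by (intro arg_cong[of _ _ sum_list] map_cong) auto
  then show ?thesis using assms(2,3) by (simp add: term_deriv_def)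
qed

lemma rigidI:
  assumes "0 < n" "v 0 = 1" "terms_in n T" "\<And>x y. \<exists>h. \<forall>i<n. term_deriv T x h i = y i"
    and "\<And>N x c i. N0 \<le> N \<Longrightarrow> \<forall>i<n. N dvd x i \<Longrightarrow> \<forall>i<n. term_map T x i = c * v i \<Longrightarrow> i < n \<Longrightarrow> x i = 0"
  shows "rigid n T v N0"
  unfolding rigid_def using assms(4) by (intro conjI assms(1-3)) (blast intro: assms(5))+

text \<open>
  The new map arises from \<open>F\<close> by adding two variables \<open>Y\<close>, \<open>Z\<close>, precomposing with
  \<open>(Y, Z) \<mapsto> (Y + X_p, Z + X_q)\<close> and postcomposing with \<open>U_k \<mapsto> U_k - a * Y * Z\<close>.
\<close>

lemma rigid_step:
  assumes R: "rigid n (A @ (k, a, p @ q) # B) v N0" and p: "length p = 2" and q: "2 \<le> length q"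
  shows "rigid (n + 2) ((k, - a, [n, Suc n]) # (k, - a, n # q) # (k, - a, Suc n # p) #
      (n, 1, p) # (Suc n, 1, q) # A @ B) (\<lambda>i. if i < n then v i else 0) N0"
    (is "rigid _ ?T' ?v' _")
proof -
  let ?T = "A @ (k, a, p @ q) # B"
  have n: "0 < n" "v 0 = 1" and T: "terms_in n ?T"
    and surj: "\<And>x y. \<exists>h. \<forall>i<n. term_deriv ?T x h i = y i"
    and pts: "\<And>N x c. N0 \<le> N \<Longrightarrow> (\<forall>i<n. N dvd x i) \<Longrightarrow> (\<forall>i<n. term_map ?T x i = c * v i) \<Longrightarrow> (\<forall>i<n. x i = 0)"
    using R unfolding rigid_def by blast+
  have k: "k < n" and pn: "set p \<subseteq> {..<n}" and qn: "set q \<subseteq> {..<n}"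
    using T by auto
  have AB: "terms_in n (A @ B)" using T by simp
  have "set p \<subseteq> {..<n + 2}" "set q \<subseteq> {..<n + 2}" using pn qn by auto
  then have terms: "terms_in (n + 2) ?T'"
    using terms_in_mono[OF AB, of "n + 2"] k p q by simp
  have map_lt: "term_map ?T' x i = term_map ?T x i -
      (if i = k then a * (x n + wprod x p) * (x (Suc n) + wprod x q) else 0)" if "i < n" for x i
    using that by (simp add: term_map_def algebra_simps)
  have map_n: "term_map ?T' x n = x n + wprod x p" for x
    using term_map_outside[OF AB, of n x] k by (simp add: term_map_def)
  have map_Suc: "term_map ?T' x (Suc n) = x (Suc n) + wprod x q" for x
    using term_map_outside[OF AB, of "Suc n" x] k by (simp add: term_map_def)
  have deriv_lt: "term_deriv ?T' x h i = term_deriv ?T x h i -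
      (if i = k then a * ((h n + dword p x h) * (x (Suc n) + wprod x q) +
        (x n + wprod x p) * (h (Suc n) + dword q x h)) else 0)" if "i < n" for x h i
    using that by (simp add: term_deriv_def dword_append algebra_simps)
  have deriv_n: "term_deriv ?T' x h n = h n + dword p x h" for x h
    using term_deriv_outside[OF AB, of n x h] k by (simp add: term_deriv_def)
  have deriv_Suc: "term_deriv ?T' x h (Suc n) = h (Suc n) + dword q x h" for x h
    using term_deriv_outside[OF AB, of "Suc n" x h] k by (simp add: term_deriv_def)
  have lt: "i < n + 2 \<longleftrightarrow> i < n \<or> i = n \<or> i = Suc n" for i by auto
  have surj': "\<exists>h. \<forall>i<n + 2. term_deriv ?T' x h i = y i" for x y
  proof -
    \<comment> \<open>The equations for the two new variables prescribe the derivatives of Y + X_p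
      and Z + X_q. Their effect on component \<open>k\<close> is thus known in advance and is added
      to the target before the old derivative is inverted.\<close>
    define y' where "y' = y(k := y k + a * (y n * (x (Suc n) + wprod x q) + (x n + wprod x p) * y (Suc n)))"
    obtain h0 where h0: "\<forall>i<n. term_deriv ?T x h0 i = y' i" using surj by blast
    define h where "h = h0(n := y n - dword p x h0, Suc n := y (Suc n) - dword q x h0)"
    have eq: "h i = h0 i" if "i < n" for i using that by (simp add: h_def)
    have dp: "dword p x h = dword p x h0" and dq: "dword q x h = dword q x h0"
      using pn qn eq by (auto intro!: dword_cong)
    have "term_deriv ?T x h i = y' i" if "i < n" for i
      using term_deriv_cong[OF T eq that] h0 that by simp
    then have "term_deriv ?T' x h i = y i" if "i < n" for i
      using that by (simp only: deriv_lt) (simp add: y'_def dp dq, simp add: h_def)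
    moreover have "term_deriv ?T' x h n = y n" "term_deriv ?T' x h (Suc n) = y (Suc n)"
      unfolding deriv_n deriv_Suc dp dq by (simp_all add: h_def)
    ultimately show ?thesis unfolding lt by blast
  qed
  have pts': "x i = 0" if N: "N0 \<le> N" "\<forall>i<n + 2. N dvd x i"
    and eq: "\<forall>i<n + 2. term_map ?T' x i = c * ?v' i" and i: "i < n + 2" for N x c i
  proof -
    \<comment> \<open>The new coordinates of the target vector are 0, so both factors of the
      correction in component \<open>k\<close> vanish and the old equations reappear.\<close>
    have xn: "x n + wprod x p = 0" and xS: "x (Suc n) + wprod x q = 0"
      using eq[rule_format, of n] eq[rule_format, of "Suc n"] unfolding map_n map_Suc by simp_all
    have "term_map ?T x i = c * v i" if "i < n" for i
      using eq[rule_format, of i] that unfolding map_lt[OF that] xn mult_zero_right mult_zero_left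
      by (cases "i = k") simp_all
    then have 0: "\<forall>i<n. x i = 0" using pts[OF N(1), of x c] N(2) by simp
    have "wprod x p = 0" "wprod x q = 0"
      using 0 pn qn p q by (auto intro!: wprod_zero)
    with xn xS 0 i show ?thesis unfolding lt by auto
  qed
  show ?thesis
    by (rule rigidI, (use n in simp), (use n in simp), rule terms, rule surj', erule (3) pts')
qed

lemma rigid_reduce:
  "rigid n T v N0 \<Longrightarrow> \<exists>n' T' v'. rigid n' T' v' N0 \<and> (\<forall>(k, a, w)\<in>set T'. length w \<le> 3)"
proof (induction "excess T" arbitrary: n T v rule: less_induct)
  case less
  show ?case
  proof (cases "\<forall>(k, a, w)\<in>set T. length w \<le> 3")
    case False
    then obtain k a w where w: "(k, a, w) \<in> set T" "3 < length w" by auto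
    obtain A B where T: "T = A @ (k, a, w) # B" using split_list[OF w(1)] by blast
    define p where "p = take 2 w"
    define q where "q = drop 2 w"
    have pq: "w = p @ q" "length p = 2" "2 \<le> length q" "length w = 2 + length q"
      using w(2) by (auto simp: p_def q_def)
    let ?T' = "(k, - a, [n, Suc n]) # (k, - a, n # q) # (k, - a, Suc n # p) #
      (n, 1, p) # (Suc n, 1, q) # A @ B"
    have rig: "rigid (n + 2) ?T' (\<lambda>i. if i < n then v i else 0) N0"
      using rigid_step[of n A k a p q B v N0] less.prems pq T by simp
    have "excess ?T' < excess T"
      using pq by (simp add: excess_def T)
    from less.hyps[OF this rig] show ?thesis .
  qed (use less.prems in blast)
qed

section \<open>The homogenized map as a list of terms\<close>

definition mword :: "(nat \<Rightarrow>\<^sub>0 nat) \<Rightarrow> nat list" where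
  "mword m = concat (map (\<lambda>i. replicate (lookup m i) i) (sorted_list_of_set (keys m)))"

lemma set_mword: "set (mword m) \<subseteq> keys m"
  by (auto simp: mword_def)

lemma length_mword: "length (mword m) = mdeg m"
  by (simp add: mword_def length_concat comp_def sum_list_distinct_conv_sum_set mdeg_def)

lemma wprod_mword: "wprod x (mword m) = mon_eval x m"
proof -
  have "wprod x (concat (map (\<lambda>i. replicate (lookup m i) i) l)) = (\<Prod>i\<leftarrow>l. x i ^ lookup m i)" for l
    by (induction l) simp_all
  then show ?thesis
    using prod.distinct_set_conv_list[of "sorted_list_of_set (keys m)" "\<lambda>i. x i ^ lookup m i"]
    by (simp add: mword_def mon_eval_def)
qed

lemma dword_partial_deriv:
  assumes "set w \<subseteq> {..<n}"
  shows "(\<Sum>j<n. ev x (partial_deriv j (wprod Var w)) * h j) = dword w x h"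
  using assms
proof (induction w)
  case (Cons a w)
  have "ev x (wprod Var w) = wprod x w" for w
    by (induction w) (simp_all add: ev_simps)
  then have "(\<Sum>j<n. ev x (partial_deriv j (wprod Var (a # w))) * h j) =
    (\<Sum>j<n. (if j = a then wprod x w * h j else 0) + x a * (ev x (partial_deriv j (wprod Var w)) * h j))"
    by (intro sum.cong refl) (simp add: ev_simps partial_deriv_mult algebra_simps)
  then show ?case
    using Cons by (simp add: sum.distrib mult.commute flip: sum_distrib_left)
qed (simp add: ev_simps)

lemma partial_deriv_dword:
  assumes "p \<in> poly_ring n"
  shows "(\<Sum>j<n. ev x (partial_deriv j p) * h j) = (\<Sum>m\<in>keys p. lookup p m * dword (mword m) x h)"
proof -
  have p: "p = (\<Sum>m\<in>keys p. Const (lookup p m) * wprod Var (mword m))"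
    by (subst (1) sum_singles) (simp add: single_eq_Const_mon wprod_mword)
  have "partial_deriv j p = (\<Sum>m\<in>keys p. Const (lookup p m) * partial_deriv j (wprod Var (mword m)))" for j
    by (subst (1) p) (simp add: partial_deriv_sum partial_deriv_mult)
  then have "(\<Sum>j<n. ev x (partial_deriv j p) * h j) =
    (\<Sum>m\<in>keys p. lookup p m * (\<Sum>j<n. ev x (partial_deriv j (wprod Var (mword m))) * h j))"
    by (simp add: ev_simps sum_distrib_right sum_distrib_left mult.assoc) (rule sum.swap)
  also have "\<dots> = (\<Sum>m\<in>keys p. lookup p m * dword (mword m) x h)"
  proof (intro sum.cong refl)
    fix m assume "m \<in> keys p"
    then have "set (mword m) \<subseteq> {..<n}" using set_mword[of m] assms by (auto dest: poly_ringD)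
    then show "lookup p m * (\<Sum>j<n. ev x (partial_deriv j (wprod Var (mword m))) * h j) =
      lookup p m * dword (mword m) x h" by (simp add: dword_partial_deriv)
  qed
  finally show ?thesis .
qed

text \<open>Variable 0 is t, and a monomial of degree e in F - X receives the factor t^(e-1), which
  produces t^(-1) F(t z) without any division. The new vector is (1, v).\<close>

lemma ex_rigid:
  fixes F :: "nat \<Rightarrow> int mpoly"
  assumes D: "noninv_data UNIV n d K F M G" and K: "n * ((n * d + 2) ^ n + 1) < K"
  shows "\<exists>T v N0. rigid (Suc n) T v N0"
proof -
  have F: "F i \<in> poly_ring n" "degs_in {2..} (F i - Var i)" if "i < n" for i
    using D that by (auto simp: noninv_data_def)
  have M: "(\<Sum>j<n. partial_deriv j (F i) * M j s) = (if i = s then 1 else 0)" if "i < n" "s < n" for i s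
    using D that by (auto simp: noninv_data_def)
  obtain v N0 where nopts: "\<And>c z. N0 \<le> \<bar>c\<bar> \<Longrightarrow> (\<forall>i<n. ev (\<lambda>i. c * z i) (F i) = c\<^sup>2 * v i) \<Longrightarrow> False"
    using no_integral_points[OF D K] by blast
  define H where "H i = F i - Var i" for i
  have Hr: "H i \<in> poly_ring n" if "i < n" for i using F that by (auto simp: H_def intro: poly_ring_diff)
  have H2: "2 \<le> mdeg m" if "i < n" "m \<in> keys (H i)" for i m
    using F(2)[OF that(1)] that(2) by (auto simp: H_def degs_in_def)
  have "\<forall>i. \<exists>l. set l = keys (H i) \<and> distinct l" by (simp add: finite_distinct_list)
  then obtain ks where ks: "\<And>i. set (ks i) = keys (H i)" "\<And>i. distinct (ks i)" by metis
  define W where "W m = replicate (mdeg m - 1) 0 @ map Suc (mword m)" for m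
  define T where "T = concat (map (\<lambda>i. map (\<lambda>m. (Suc i, lookup (H i) m, W m)) (ks i)) [0..<n])"
  define v' where "v' i = (case i of 0 \<Rightarrow> 1 | Suc j \<Rightarrow> v j)" for i
  have sum_T: "(\<Sum>(k, a, w)\<leftarrow>T. if k = Suc i then a * f w else 0) = (\<Sum>m\<in>keys (H i). lookup (H i) m * f (W m))"
    if "i < n" for i and f :: "nat list \<Rightarrow> int"
  proof -
    have 1: "(\<Sum>m\<leftarrow>ks l. if l = i then lookup (H l) m * f (W m) else 0) =
      (if l = i then \<Sum>m\<in>keys (H i). lookup (H i) m * f (W m) else 0)" for l
      using sum_list_distinct_conv_sum_set[OF ks(2), of "\<lambda>m. lookup (H l) m * f (W m)" l] ks(1)
      by (cases "l = i") (simp_all add: sum_list_0)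
    have 2: "(\<Sum>(k, a, w)\<leftarrow>concat (map (\<lambda>i. map (\<lambda>m. (Suc i, lookup (H i) m, W m)) (ks i)) l).
        if k = Suc i then a * f w else 0) =
      (\<Sum>l\<leftarrow>l. \<Sum>m\<leftarrow>ks l. if l = i then lookup (H l) m * f (W m) else 0)" for l
      by (induction l) (simp_all add: comp_def)
    show ?thesis
      unfolding T_def 2 1 using that by (simp add: sum_list_distinct_conv_sum_set atLeast0LessThan)
  qed
  have sum_T0: "(\<Sum>(k, a, w)\<leftarrow>T. if k = 0 then a * f w else 0) = 0" for f :: "nat list \<Rightarrow> int"
  proof -
    have "(\<Sum>(k, a, w)\<leftarrow>T. if k = 0 then a * f w else 0) = (\<Sum>t\<leftarrow>T. 0)"
      by (intro arg_cong[of _ _ sum_list] map_cong) (auto simp: T_def)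
    then show ?thesis by simp
  qed
  have wW: "wprod X (W m) = X 0 ^ (mdeg m - 1) * mon_eval (\<lambda>i. X (Suc i)) m" for X :: "nat \<Rightarrow> int" and m
    by (simp add: W_def wprod_map wprod_mword)
  have map0: "term_map T X 0 = X 0" for X
    using sum_T0[of "wprod X"] by (simp add: term_map_def)
  have deriv0: "term_deriv T X h 0 = h 0" for X h
    using sum_T0[of "\<lambda>w. dword w X h"] by (simp add: term_deriv_def)
  have mapS: "term_map T X (Suc i) = X (Suc i) +
      (\<Sum>m\<in>keys (H i). lookup (H i) m * (X 0 ^ (mdeg m - 1) * mon_eval (\<lambda>i. X (Suc i)) m))" if "i < n" for X i
    using sum_T[OF that, of "wprod X"] by (simp add: term_map_def wW)
  have derivS: "term_deriv T X h (Suc i) = h (Suc i) + (\<Sum>m\<in>keys (H i). lookup (H i) m * dword (W m) X h)"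
    if "i < n" for X h i
    using sum_T[OF that, of "\<lambda>w. dword w X h"] by (simp add: term_deriv_def)
  have terms: "terms_in (Suc n) T"
  proof -
    have "set (W m) \<subseteq> {..<Suc n} \<and> 2 \<le> length (W m)" if "i < n" "m \<in> keys (H i)" for i m
      using set_mword[of m] Hr[OF that(1)] that H2[OF that]
      by (auto simp: W_def length_mword dest: poly_ringD)
    then have "l < Suc n" "2 \<le> length (W m)" if "i < n" "m \<in> keys (H i)" "l \<in> set (W m)" for i m l
      using that by blast+
    with \<open>\<And>i m. \<lbrakk>i < n; m \<in> keys (H i)\<rbrakk> \<Longrightarrow> set (W m) \<subseteq> {..<Suc n} \<and> 2 \<le> length (W m)\<close>
    show ?thesis using ks(1) by (auto simp: terms_in_def T_def)
  qed
  have surj: "\<exists>h. \<forall>i<Suc n. term_deriv T X h i = y i" for X y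
  proof -
    let ?t = "X 0" and ?z = "\<lambda>i. X (Suc i)"
    \<comment> \<open>The direction is split: \<open>ha\<close> is responsible for the t-component,
      \<open>hb\<close> for the others. In the z-variables the derivative is that of
      \<open>F\<close> at t z, which \<open>M\<close> inverts.\<close>
    define ha where "ha = (\<lambda>i::nat. if i = 0 then y 0 else 0)"
    define A where "A i = (\<Sum>m\<in>keys (H i). lookup (H i) m * dword (W m) X ha)" for i
    define \<zeta> where "\<zeta> j = (\<Sum>s<n. ev (\<lambda>i. ?t * ?z i) (M j s) * (y (Suc s) - A s))" for j
    define hb where "hb i = (case i of 0 \<Rightarrow> 0 | Suc j \<Rightarrow> \<zeta> j)" for i
    have hb_Suc: "hb (Suc j) = \<zeta> j" for j by (simp add: hb_def)
    have "term_deriv T X (\<lambda>i. ha i + hb i) (Suc i) = y (Suc i)" if i: "i < n" for i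
    proof -
      have db: "dword (W m) X hb = dword (mword m) (\<lambda>i. ?t * ?z i) \<zeta>" if "m \<in> keys (H i)" for m
      proof -
        have "mword m \<noteq> []" using H2[OF i that] length_mword[of m] by auto
        then show ?thesis
          by (simp add: W_def dword_append dword_replicate_zero dword_map dword_scale hb_def length_mword)
      qed
      have "(\<Sum>m\<in>keys (H i). lookup (H i) m * dword (W m) X hb) =
        (\<Sum>j<n. ev (\<lambda>i. ?t * ?z i) (partial_deriv j (H i)) * \<zeta> j)"
        by (simp add: db partial_deriv_dword[OF Hr[OF i]])
      also have "\<dots> = (\<Sum>j<n. ev (\<lambda>i. ?t * ?z i) (partial_deriv j (F i)) * \<zeta> j) - \<zeta> i"
        using i by (simp add: H_def partial_deriv_diff ev_simps left_diff_distrib sum_subtractf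
          if_distrib[of "eval_with _ _"] if_distrib[of "\<lambda>a. a * _"] cong: if_cong)
      also have "(\<Sum>j<n. ev (\<lambda>i. ?t * ?z i) (partial_deriv j (F i)) * \<zeta> j) =
        (\<Sum>s<n. ev (\<lambda>i. ?t * ?z i) (\<Sum>j<n. partial_deriv j (F i) * M j s) * (y (Suc s) - A s))"
        unfolding \<zeta>_def sum_distrib_left
        by (subst sum.swap) (simp add: ev_simps sum_distrib_right mult.assoc)
      also have "\<dots> = (\<Sum>s<n. if i = s then y (Suc s) - A s else 0)"
        using M[OF i] by (intro sum.cong refl) (simp add: ev_simps)
      also have "\<dots> = y (Suc i) - A i" using i by simp
      finally have b: "(\<Sum>m\<in>keys (H i). lookup (H i) m * dword (W m) X hb) = y (Suc i) - A i - \<zeta> i" .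
      have "term_deriv T X (\<lambda>i. ha i + hb i) (Suc i) = \<zeta> i + A i + (\<Sum>m\<in>keys (H i). lookup (H i) m * dword (W m) X hb)"
        unfolding derivS[OF i] dword_add by (simp add: ha_def hb_Suc A_def distrib_left sum.distrib)
      with b show ?thesis by simp
    qed
    moreover have "term_deriv T X (\<lambda>i. ha i + hb i) 0 = y 0" unfolding deriv0 by (simp add: ha_def hb_def)
    ultimately have "\<forall>i<Suc n. term_deriv T X (\<lambda>i. ha i + hb i) i = y i"
      using less_Suc_eq_0_disj by auto
    then show ?thesis by blast
  qed
  have pts: "X i = 0" if N: "max 1 N0 \<le> N" "\<forall>i<Suc n. N dvd X i"
    and eq: "\<forall>i<Suc n. term_map T X i = c * v' i" and i: "i < Suc n" for N X c i
  proof -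
    have c: "c = X 0" using eq[rule_format, of 0] by (simp add: map0 v'_def)
    have eqS: "term_map T X (Suc i) = X 0 * v i" if "i < n" for i
      using eq[rule_format, of "Suc i"] that by (simp add: v'_def c)
    \<comment> \<open>A nonzero \<open>X 0\<close> is divisible by N and hence large, which
      \<open>nopts\<close> excludes. At t = 0 the map is the identity in z and the target is 0, so
      the remaining coordinates vanish as well.\<close>
    have 0: "X 0 = 0"
    proof (rule ccontr)
      assume "X 0 \<noteq> 0"
      then have big: "N0 \<le> \<bar>X 0\<bar>" using N dvd_imp_le_int[of "X 0" N] by auto
      have "ev (\<lambda>i. X 0 * X (Suc i)) (F i) = (X 0)\<^sup>2 * v i" if i: "i < n" for i
      proof -
        have "ev (\<lambda>i. X 0 * X (Suc i)) (H i) =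
          X 0 * (\<Sum>m\<in>keys (H i). lookup (H i) m * (X 0 ^ (mdeg m - 1) * mon_eval (\<lambda>i. X (Suc i)) m))"
          unfolding eval_with_mon sum_distrib_left
        proof (intro sum.cong refl)
          fix m assume m: "m \<in> keys (H i)"
          obtain e where "mdeg m = Suc e" using H2[OF i m] by (cases "mdeg m") auto
          then show "lookup (H i) m * mon_eval (\<lambda>i. X 0 * X (Suc i)) m =
            X 0 * (lookup (H i) m * (X 0 ^ (mdeg m - 1) * mon_eval (\<lambda>i. X (Suc i)) m))"
            by (simp add: mon_eval_mult mon_eval_const mult_ac)
        qed
        then have "ev (\<lambda>i. X 0 * X (Suc i)) (F i) = X 0 * term_map T X (Suc i)"
          unfolding mapS[OF that] distrib_left by (simp add: H_def ev_simps)
        then show ?thesis using eqS[OF that] by (simp add: power2_eq_square)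
      qed
      then show False using nopts[OF big, of "\<lambda>i. X (Suc i)"] by simp
    qed
    show ?thesis
    proof (cases i)
      case (Suc j)
      then have j: "j < n" using i by simp
      have "(\<Sum>m\<in>keys (H j). lookup (H j) m * (X 0 ^ (mdeg m - 1) * mon_eval (\<lambda>i. X (Suc i)) m)) = 0"
        using H2[OF j] 0 by (intro sum.neutral ballI) (force simp: power_0_left)
      then have "term_map T X (Suc j) = X (Suc j)" unfolding mapS[OF j] by simp
      then show ?thesis using eqS[OF j] 0 Suc by simp
    qed (use 0 in simp)
  qed
  have "rigid (Suc n) T v' (max 1 N0)"
    by (rule rigidI, simp, simp add: v'_def, rule terms, rule surj, erule (3) pts)
  then show ?thesis by blast
qed

section \<open>Reduction to powers of linear forms\<close>

lemma ev_nonzero_int: "p \<noteq> 0 \<Longrightarrow> \<exists>v. ev v (p :: int mpoly) \<noteq> 0"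
  using ex_poly_ring[of p] ex_int_point_nonzero[of p] by auto

lemma comm_ring_hom_ev: "comm_ring_hom (ev x :: 'a::comm_ring_1 mpoly \<Rightarrow> 'a)"
  by unfold_locales (simp_all add: ev_simps)

text \<open>Surjectivity at an integral point provides an integral right inverse of the matrix
  there, so the determinant takes a value 1 or -1. Its square is then 1 at all integral points,
  hence identically; this leaves two constants, and the origin decides.\<close>

lemma det_eq_1:
  fixes J :: "int mpoly mat"
  assumes J: "J \<in> carrier_mat n n" and J0: "map_mat (ev (\<lambda>i. 0)) J = 1\<^sub>m n"
    and surj: "\<And>x w. \<exists>h. \<forall>i<n. (\<Sum>j<n. ev x (J $$ (i, j)) * h j) = w i"
  shows "det J = 1"
proof -
  have ev_det: "det (map_mat (ev x) J) = ev x (det J)" for x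
    by (rule comm_ring_hom.hom_det[OF comm_ring_hom_ev])
  have sq: "ev x (det J) * ev x (det J) = 1" for x
  proof -
    let ?A = "map_mat (ev x) J"
    have "\<forall>s. \<exists>h. \<forall>i<n. (\<Sum>j<n. ev x (J $$ (i, j)) * h j) = (if i = s then 1 else 0)"
      by (intro allI surj)
    from choice[OF this] obtain h
      where h: "\<forall>s. \<forall>i<n. (\<Sum>j<n. ev x (J $$ (i, j)) * h s j) = (if i = s then 1 else 0)" ..
    define B where "B = mat n n (\<lambda>(l, s). h s l)"
    have "?A * B = 1\<^sub>m n"
      using J h by (intro eq_matI) (auto simp: B_def scalar_prod_def atLeast0LessThan)
    then have "det ?A * det B = 1"
      using det_mult[of ?A n B] J by (simp add: B_def)
    then have "ev x (det J) dvd 1" unfolding ev_det by (metis dvd_triv_left)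
    then have "\<bar>ev x (det J)\<bar> = 1" by simp
    then show ?thesis by (metis abs_mult_self_eq mult_1)
  qed
  have "ev x (det J * det J - 1) = 0" for x
    using sq by (simp add: ev_simps)
  then have "det J * det J - 1 = 0" using ev_nonzero_int by blast
  then have "(det J - 1) * (det J + 1) = 0" by (simp add: algebra_simps)
  then have "det J = 1 \<or> det J = - 1"
    by (simp only: mult_eq_0_iff right_minus_eq eq_neg_iff_add_eq_0)
  moreover have "ev (\<lambda>i. 0) (det J) = 1" using ev_det[of "\<lambda>i. 0"] J0 by simp
  moreover have "ev (\<lambda>i. 0) (- 1 :: int mpoly) = - 1"
    using eval_with_uminus[OF hom_on_id over_UNIV, of "\<lambda>i. 0 :: int" 1] by (simp add: ev_simps)
  ultimately show ?thesis by auto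
qed

lemma partial_deriv_power:
  "partial_deriv j (p ^ e) = of_nat e * p ^ (e - 1) * partial_deriv j (p :: 'a::comm_ring_1 mpoly)"
proof (induction e)
  case (Suc e)
  then show ?case by (cases e) (simp_all add: partial_deriv_mult algebra_simps)
qed simp

text \<open>
  Pairing: if \<open>F(x) = x + C (B x)^d\<close>, then \<open>f(y) = y + (B C y)^d\<close> satisfies \<open>F(C y) = C f(y)\<close>.
  The columns of \<open>C\<close> are \<open>col m\<close>, the rows of \<open>B\<close> are \<open>b m\<close>.
\<close>

lemma pairing:
  fixes col b :: "nat \<Rightarrow> nat \<Rightarrow> int" and d :: "nat \<Rightarrow> nat" and v :: "nat \<Rightarrow> int" and n N :: nat
  defines "dot \<equiv> \<lambda>m x. \<Sum>j<n. b m j * x j"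
  assumes n: "0 < n" "v 0 = 1" and N: "1 < N" and d: "\<And>m. m < N \<Longrightarrow> d m \<in> {2, 3}"
    and V: "\<And>i. i < n \<Longrightarrow> (\<Sum>m<N. col m i) = v i"
    and pts: "\<And>x c. (\<forall>i<n. x i + (\<Sum>m<N. col m i * dot m x ^ d m) = c * v i) \<Longrightarrow> (\<forall>i<n. x i = 0)"
    and surj: "\<And>x y. \<exists>h. \<forall>i<n. h i + (\<Sum>m<N. col m i * (int (d m) * dot m x ^ (d m - 1) * dot m h)) = y i"
  shows "\<exists>F :: int mpoly vec. keller_map N F \<and> quadratic_cubic_linear_form N F \<and>
    (\<forall>x \<in> diagonal_curve N F. x = 0\<^sub>v N)"
proof -
  define a where "a m = vec N (\<lambda>l. \<Sum>j<n. b m j * col l j)" for m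
  define L where "L m = linear_form (a m)" for m
  define F where "F = vec N (\<lambda>m. Var m + L m ^ d m)"
  define C where "C y i = (\<Sum>l<N. col l i * y l)" for y i
  have a_dot: "(\<Sum>l<N. (a m $ l) * y l) = dot m (C y)" for m y
  proof -
    have "(\<Sum>l<N. (a m $ l) * y l) = (\<Sum>l<N. \<Sum>j<n. b m j * (col l j * y l))"
      by (simp add: a_def sum_distrib_right mult.assoc)
    also have "\<dots> = dot m (C y)"
      unfolding dot_def C_def sum_distrib_left by (rule sum.swap)
    finally show ?thesis .
  qed
  have L: "L m = (\<Sum>l<N. Const (a m $ l) * Var l)" for m
    by (simp add: L_def linear_form_def a_def)
  have evL: "ev y (L m) = dot m (C y)" for y m
    by (simp add: L ev_simps a_dot)
  have dL: "partial_deriv l (L m) = Const (a m $ l)" if "l < N" for l m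
    using that by (simp add: L partial_deriv_sum partial_deriv_mult if_distrib[of "\<lambda>a. _ * a"] cong: if_cong)
  have Lr: "L m \<in> poly_ring N" for m
    unfolding L by (intro poly_ring_sum poly_ring_mult) auto
  have Fm: "F $ m = Var m + L m ^ d m" if "m < N" for m using that by (simp add: F_def)
  define J where "J = jacobian N F"
  have J: "J \<in> carrier_mat N N" by (simp add: J_def jacobian_def)
  have Jml: "J $$ (m, l) = (if l = m then 1 else 0) + of_nat (d m) * L m ^ (d m - 1) * Const (a m $ l)"
    if "m < N" "l < N" for m l
    using that by (simp add: J_def jacobian_def Fm partial_deriv_add partial_deriv_power dL)
  have ev_nat: "ev x (of_nat k) = int k" for x k
    by (induction k) (simp_all add: ev_simps)
  have evJ: "ev x (J $$ (m, l)) = (if l = m then 1 else 0) + int (d m) * dot m (C x) ^ (d m - 1) * (a m $ l)"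
    if "m < N" "l < N" for x m l
    using that by (simp add: Jml ev_simps ev_nat eval_with_power[OF hom_on_id over_UNIV] evL)
  have "keller_map N F"
    unfolding keller_map_def
  proof
    have "F $ m \<in> poly_ring N" if "m < N" for m
      unfolding Fm[OF that] using that by (intro poly_ring_add poly_ring_power Lr) auto
    then show "F \<in> poly_maps N" by (simp add: poly_maps_def) (simp add: F_def)
    have "det J = 1"
    proof (rule det_eq_1[OF J])
      have "dot m (C (\<lambda>i. 0)) = 0" for m by (simp add: dot_def C_def)
      moreover have "(0::int) ^ (d m - 1) = 0" if "m < N" for m using d[OF that] by auto
      ultimately show "map_mat (ev (\<lambda>i. 0)) J = 1\<^sub>m N"
        using J by (intro eq_matI) (auto simp: evJ)
      fix x w
      \<comment> \<open>The derivative of the small map at C x is inverted on the right-hand side C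
        w. Correcting w by means of the solution h' gives an h with C h = h', so the linear forms
        take the required values.\<close>
      obtain h' where h': "\<And>i. i < n \<Longrightarrow>
          h' i + (\<Sum>m<N. col m i * (int (d m) * dot m (C x) ^ (d m - 1) * dot m h')) = C w i"
        using surj[of "C x" "C w"] by blast
      define h where "h m = w m - int (d m) * dot m (C x) ^ (d m - 1) * dot m h'" for m
      have "C h i = h' i" if "i < n" for i
        using h'[OF that] by (simp add: C_def h_def right_diff_distrib sum_subtractf)
      then have dh: "dot m (C h) = dot m h'" for m by (simp add: dot_def)
      have "(\<Sum>j<N. ev x (J $$ (i, j)) * h j) = w i" if "i < N" for i
      proof -
        have "(\<Sum>j<N. ev x (J $$ (i, j)) * h j) =
          (\<Sum>j<N. (if j = i then h j else 0)) + int (d i) * dot i (C x) ^ (d i - 1) * (\<Sum>j<N. (a i $ j) * h j)"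
          unfolding sum_distrib_left sum.distrib[symmetric]
          using that by (intro sum.cong refl) (simp add: evJ algebra_simps)
        then show ?thesis using that by (simp add: a_dot dh) (simp add: h_def)
      qed
      then show "\<exists>h. \<forall>i<N. (\<Sum>j<N. ev x (J $$ (i, j)) * h j) = w i" by blast
    qed
    then show "det (jacobian N F) = 1" by (simp add: J_def)
  qed
  moreover have "quadratic_cubic_linear_form N F"
    unfolding quadratic_cubic_linear_form_def
    using d by (intro exI[of _ a] exI[of _ d]) (simp add: F_def L_def a_def)
  moreover have "x = 0\<^sub>v N" if x: "x \<in> diagonal_curve N F" for x
  proof -
    have xc: "x \<in> carrier_vec N" and xe: "\<And>i j. i < N \<Longrightarrow> j < N \<Longrightarrow> eval_at x (F $ i) = eval_at x (F $ j)"
      using x unfolding diagonal_curve_def by blast+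
    define y where "y i = x $ i" for i
    define c where "c = eval_at x (F $ 0)"
    have fm: "y m + dot m (C y) ^ d m = c" if "m < N" for m
    proof -
      have "y m + dot m (C y) ^ d m = eval_at x (F $ m)"
        by (simp add: eval_at_def Fm[OF that] ev_simps eval_with_power[OF hom_on_id over_UNIV] evL flip: y_def)
      also have "\<dots> = c" unfolding c_def using N by (intro xe that) simp
      finally show ?thesis .
    qed
    \<comment> \<open>On the diagonal curve, f(y) is c times the vector of ones, whose image under C
      is c v by the assumption on the sums \<open>V\<close>.\<close>
    have "C y i + (\<Sum>m<N. col m i * dot m (C y) ^ d m) = c * v i" if "i < n" for i
    proof -
      have "C y i + (\<Sum>m<N. col m i * dot m (C y) ^ d m) = (\<Sum>m<N. col m i * (y m + dot m (C y) ^ d m))"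
        by (simp add: C_def distrib_left sum.distrib)
      also have "\<dots> = (\<Sum>m<N. col m i) * c" by (simp add: fm sum_distrib_right)
      finally show ?thesis using V[OF that] by simp
    qed
    then have C0: "\<forall>i<n. C y i = 0" using pts[of "C y" c] by blast
    then have "dot m (C y) = 0" for m by (simp add: dot_def)
    \<comment> \<open>As C y = 0, the map f fixes y, so y itself is c times the vector of ones; then
      C y = c v vanishes, and \<open>v 0 = 1\<close> gives c = 0.\<close>
    then have yc: "y m = c" if "m < N" for m using fm[OF that] d[OF that] by (auto simp: power_0_left)
    have "C y 0 = (\<Sum>m<N. col m 0) * c" by (simp add: C_def yc sum_distrib_right)
    then have "c = 0" using C0 V[of 0] n by simp
    then show ?thesis using xc yc by (intro eq_vecI) (auto simp: y_def)
  qed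
  ultimately show ?thesis by blast
qed

text \<open>The three contributions are added rather than distinguished by cases, since
  \<open>p\<close>, \<open>q\<close>, \<open>r\<close> may coincide.\<close>

definition ternary_form :: "int \<Rightarrow> nat \<Rightarrow> int \<Rightarrow> nat \<Rightarrow> int \<Rightarrow> nat \<Rightarrow> nat \<Rightarrow> int" where
  "ternary_form s p t q u r j = (if j = p then s else 0) + (if j = q then t else 0) + (if j = r then u else 0)"

lemma sum_ternary_form:
  "p < n \<Longrightarrow> q < n \<Longrightarrow> r < n \<Longrightarrow> (\<Sum>j<n. ternary_form s p t q u r j * x j) = s * x p + t * x q + u * x r"
  by (simp add: ternary_form_def distrib_right sum.distrib if_distrib[of "\<lambda>a. a * _"] cong: if_cong)

text \<open>
  After rescaling by \<open>24 M\<close>, monomials of degree \<open>2\<close> and \<open>3\<close> become integral combinations of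
  powers of linear forms, by \<open>4 x y = (x + y)^2 - (x - y)^2\<close> and
  \<open>24 x y z = (x + y + z)^3 - (x + y - z)^3 - (x - y + z)^3 - (- x + y + z)^3\<close>.
\<close>

definition powers :: "int \<Rightarrow> nat \<times> int \<times> nat list \<Rightarrow> (nat \<times> int \<times> (nat \<Rightarrow> int) \<times> nat) list" where
  "powers M = (\<lambda>(k, a, w). case w of
     [p, q] \<Rightarrow> [(k, 6 * M * a, ternary_form 1 p 1 q 0 p, 2), (k, - (6 * M * a), ternary_form 1 p (- 1) q 0 p, 2)]
   | [p, q, r] \<Rightarrow> [(k, 24 * M * M * a, ternary_form 1 p 1 q 1 r, 3), (k, - (24 * M * M * a), ternary_form 1 p 1 q (- 1) r, 3),
       (k, - (24 * M * M * a), ternary_form 1 p (- 1) q 1 r, 3), (k, - (24 * M * M * a), ternary_form (- 1) p 1 q 1 r, 3)]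
   | _ \<Rightarrow> [])"

text \<open>Rescaling by 24 M multiplies the coefficient of a quadratic term by 24 M = 4 * 6 M and
  that of a cubic term by (24 M)^2 = 24 * 24 M^2, which accounts for the constants in
  \<open>powers\<close>. The derivatives are treated alongside, because the Keller condition is kept
  as surjectivity.\<close>

lemma powers_term:
  assumes "set w \<subseteq> {..<n}" "length w = 2 \<or> length w = 3"
  shows "(\<Sum>(k', c, b, d)\<leftarrow>powers M (k, a, w). if k' = i then c * (\<Sum>j<n. b j * x j) ^ d else 0) =
      (if k = i then a * ((24 * M) ^ (length w - 1) * wprod x w) else 0)"
    and "(\<Sum>(k', c, b, d)\<leftarrow>powers M (k, a, w).
        if k' = i then c * (int d * (\<Sum>j<n. b j * x j) ^ (d - 1) * (\<Sum>j<n. b j * h j)) else 0) =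
      (if k = i then a * ((24 * M) ^ (length w - 1) * dword w x h) else 0)"
    and "\<forall>(k', c, b, d)\<in>set (powers M (k, a, w)). d \<in> {2, 3}"
proof -
  consider p q where "w = [p, q]" | p q r where "w = [p, q, r]"
    using assms(2) by (auto simp: length_Suc_conv numeral_2_eq_2 numeral_3_eq_3)
  note cases = this
  show "(\<Sum>(k', c, b, d)\<leftarrow>powers M (k, a, w). if k' = i then c * (\<Sum>j<n. b j * x j) ^ d else 0) =
      (if k = i then a * ((24 * M) ^ (length w - 1) * wprod x w) else 0)"
    by (cases rule: cases) (use assms(1) in \<open>simp_all add: powers_def sum_ternary_form,
      simp_all add: power2_eq_square power3_eq_cube algebra_simps\<close>)
  show "(\<Sum>(k', c, b, d)\<leftarrow>powers M (k, a, w).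
        if k' = i then c * (int d * (\<Sum>j<n. b j * x j) ^ (d - 1) * (\<Sum>j<n. b j * h j)) else 0) =
      (if k = i then a * ((24 * M) ^ (length w - 1) * dword w x h) else 0)"
    by (cases rule: cases) (use assms(1) in \<open>simp_all add: powers_def sum_ternary_form,
      simp_all add: power2_eq_square power3_eq_cube algebra_simps\<close>)
  show "\<forall>(k', c, b, d)\<in>set (powers M (k, a, w)). d \<in> {2, 3}"
    by (cases rule: cases) (simp_all add: powers_def)
qed

lemma sum_list_concat_map:
  "(\<And>t. t \<in> set T \<Longrightarrow> sum_list (map g (f t)) = h t) \<Longrightarrow> sum_list (map g (concat (map f T))) = sum_list (map h T)"
  by (induction T) auto

text \<open>The map is conjugated by the scaling with 24 M, where 24 M is at least
  \<open>N0\<close>. Integral points of the scaled map become points of the old one divisible by 24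
  M, so rigidity now excludes all nonzero integral points over the line.\<close>

lemma rigid_imp_quadratic_cubic:
  assumes R: "rigid n T v N0" and le: "\<forall>(k, a, w)\<in>set T. length w \<le> 3"
  shows "\<exists>N>1. \<exists>F :: int mpoly vec. keller_map N F \<and> quadratic_cubic_linear_form N F \<and>
    (\<forall>x \<in> diagonal_curve N F. x = 0\<^sub>v N)"
proof -
  have n: "0 < n" "v 0 = 1" and T: "terms_in n T"
    and surj: "\<And>x y. \<exists>h. \<forall>i<n. term_deriv T x h i = y i"
    and pts: "\<And>N x c. N0 \<le> N \<Longrightarrow> (\<forall>i<n. N dvd x i) \<Longrightarrow> (\<forall>i<n. term_map T x i = c * v i) \<Longrightarrow> (\<forall>i<n. x i = 0)"
    using R unfolding rigid_def by blast+
  define M where "M = max 1 N0"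
  have M: "M \<noteq> 0" "N0 \<le> 24 * M" by (auto simp: M_def)
  have w: "set w \<subseteq> {..<n}" "length w = 2 \<or> length w = 3" "w \<noteq> []" if "(k, a, w) \<in> set T" for k a w
    using terms_inD[OF T that] le that by fastforce+
  define L where "L = concat (map (powers M) T)"
  define R where "R = length L"
  \<comment> \<open>The first \<open>R\<close> columns carry the coefficients. Column
    \<open>R\<close> brings the sum of all columns to \<open>v\<close>; its row in \<open>b\<close>
    is zero, so the map is unchanged. Column \<open>R + 1\<close> is zero and makes the dimension
    exceed 1 even if \<open>R\<close> is 0.\<close>
  define col where "col m i = (if m < R then (case L ! m of (k, c, b, d) \<Rightarrow> if k = i then c else 0) else
    if m = R then v i - (\<Sum>m<R. case L ! m of (k, c, b, d) \<Rightarrow> if k = i then c else 0) else 0)" for m i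
  define b where "b m = (if m < R then (case L ! m of (k, c, b, d) \<Rightarrow> b) else (\<lambda>_. 0))" for m
  define d where "d m = (if m < R then (case L ! m of (k, c, b, d) \<Rightarrow> d) else 2)" for m
  have sum_L: "(\<Sum>m<R + 2. col m i * g (b m) (d m)) = (\<Sum>(k, c, b, d)\<leftarrow>L. if k = i then c * g b d else 0)"
    if "g (\<lambda>_. 0) 2 = 0" for g :: "(nat \<Rightarrow> int) \<Rightarrow> nat \<Rightarrow> int" and i
  proof -
    have "(\<Sum>m<R + 2. col m i * g (b m) (d m)) = (\<Sum>m<R. col m i * g (b m) (d m))"
      using that by (simp add: b_def d_def)
    also have "\<dots> = (\<Sum>m<R. case L ! m of (k, c, b, d) \<Rightarrow> if k = i then c * g b d else 0)"
      by (intro sum.cong refl) (auto simp: col_def b_def d_def split: prod.splits)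
    also have "\<dots> = (\<Sum>(k, c, b, d)\<leftarrow>L. if k = i then c * g b d else 0)"
      by (simp add: sum_list_sum_nth R_def atLeast0LessThan)
    finally show ?thesis .
  qed
  have map_eq: "24 * M * (x i + (\<Sum>m<R + 2. col m i * (\<Sum>j<n. b m j * x j) ^ d m)) = term_map T (\<lambda>i. 24 * M * x i) i"
    for x i
  proof -
    have "(\<Sum>m<R + 2. col m i * (\<Sum>j<n. b m j * x j) ^ d m) =
      (\<Sum>(k, c, b, d)\<leftarrow>L. if k = i then c * (\<Sum>j<n. b j * x j) ^ d else 0)"
      by (rule sum_L[where g = "\<lambda>b d. (\<Sum>j<n. b j * x j) ^ d"]) simp
    also have "\<dots> = (\<Sum>(k, a, w)\<leftarrow>T. if k = i then a * ((24 * M) ^ (length w - 1) * wprod x w) else 0)"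
      unfolding L_def
    proof (rule sum_list_concat_map)
      fix t assume t: "t \<in> set T"
      obtain k a w' where t': "t = (k, a, w')" by (cases t)
      show "sum_list (map (\<lambda>(k, c, b, d). if k = i then c * (\<Sum>j<n. b j * x j) ^ d else 0) (powers M t)) =
        (case t of (k, a, w) \<Rightarrow> if k = i then a * ((24 * M) ^ (length w - 1) * wprod x w) else 0)"
        unfolding t' prod.case by (rule powers_term(1)[OF w(1,2)[OF t[unfolded t']]])
    qed
    also have "24 * M * \<dots> = (\<Sum>(k, a, w)\<leftarrow>T. if k = i then a * wprod (\<lambda>i. 24 * M * x i) w else 0)"
      unfolding sum_list_const_mult[symmetric]
    proof (intro arg_cong[of _ _ sum_list] map_cong refl)
      fix t assume t: "t \<in> set T"
      obtain k a w' where t': "t = (k, a, w')" by (cases t)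
      obtain e where e: "length w' = Suc e" using w(3)[OF t[unfolded t']] by (cases w') auto
      show "24 * M * (case t of (k, a, w) \<Rightarrow> if k = i then a * ((24 * M) ^ (length w - 1) * wprod x w) else 0) =
        (case t of (k, a, w) \<Rightarrow> if k = i then a * wprod (\<lambda>i. 24 * M * x i) w else 0)"
        unfolding t' prod.case wprod_scale e by simp
    qed
    finally show ?thesis by (simp add: term_map_def distrib_left)
  qed
  have deriv_eq: "h i + (\<Sum>m<R + 2. col m i * (int (d m) * (\<Sum>j<n. b m j * x j) ^ (d m - 1) * (\<Sum>j<n. b m j * h j)))
      = term_deriv T (\<lambda>i. 24 * M * x i) h i" for x h i
  proof -
    have "(\<Sum>m<R + 2. col m i * (int (d m) * (\<Sum>j<n. b m j * x j) ^ (d m - 1) * (\<Sum>j<n. b m j * h j))) =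
      (\<Sum>(k, c, b, d)\<leftarrow>L. if k = i then
        c * (int d * (\<Sum>j<n. b j * x j) ^ (d - 1) * (\<Sum>j<n. b j * h j)) else 0)"
      by (rule sum_L[where g = "\<lambda>b d. int d * (\<Sum>j<n. b j * x j) ^ (d - 1) * (\<Sum>j<n. b j * h j)"]) simp
    also have "\<dots> = (\<Sum>(k, a, w)\<leftarrow>T. if k = i then a * ((24 * M) ^ (length w - 1) * dword w x h) else 0)"
      unfolding L_def
    proof (rule sum_list_concat_map)
      fix t assume t: "t \<in> set T"
      obtain k a w' where t': "t = (k, a, w')" by (cases t)
      show "sum_list (map (\<lambda>(k, c, b, d). if k = i then c * (int d * (\<Sum>j<n. b j * x j) ^ (d - 1) * (\<Sum>j<n. b j * h j)) else 0) (powers M t)) =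
        (case t of (k, a, w) \<Rightarrow> if k = i then a * ((24 * M) ^ (length w - 1) * dword w x h) else 0)"
        unfolding t' prod.case by (rule powers_term(2)[OF w(1,2)[OF t[unfolded t']]])
    qed
    also have "\<dots> = (\<Sum>(k, a, w)\<leftarrow>T. if k = i then a * dword w (\<lambda>i. 24 * M * x i) h else 0)"
      by (intro arg_cong[of _ _ sum_list] map_cong refl) (auto simp: dword_scale w(3))
    finally show ?thesis by (simp add: term_deriv_def)
  qed
  have "\<exists>F :: int mpoly vec. keller_map (R + 2) F \<and> quadratic_cubic_linear_form (R + 2) F \<and>
    (\<forall>x \<in> diagonal_curve (R + 2) F. x = 0\<^sub>v (R + 2))"
  proof (rule pairing[where n = n and v = v and col = col and b = b and d = d])
    show "d m \<in> {2, 3}" for m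
    proof (cases "m < R")
      case True
      then have "L ! m \<in> set L" by (simp add: R_def)
      then obtain t where t: "t \<in> set T" "L ! m \<in> set (powers M t)" by (auto simp: L_def)
      obtain k a w' where t': "t = (k, a, w')" by (cases t)
      show ?thesis
        using bspec[OF powers_term(3)[OF w(1,2)[OF t(1)[unfolded t']]] t(2)[unfolded t']] True
        by (simp add: d_def split: prod.splits)
    qed (simp add: d_def)
    show "(\<Sum>m<R + 2. col m i) = v i" for i
      by (simp add: col_def)
    show "\<forall>i<n. x i = 0" if "\<forall>i<n. x i + (\<Sum>m<R + 2. col m i * (\<Sum>j<n. b m j * x j) ^ d m) = c * v i" for x c
    proof -
      have eqT: "term_map T (\<lambda>i. 24 * M * x i) i = (24 * M * c) * v i" if "i < n" for i
        unfolding map_eq[symmetric] using \<open>\<forall>i<n. _\<close> that by simp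
      have "\<forall>i<n. 24 * M * x i = 0"
        by (rule pts[OF M(2), where c = "24 * M * c"]) (simp, intro allI impI eqT)
      then show ?thesis using M(1) by simp
    qed
    show "\<exists>h. \<forall>i<n. h i + (\<Sum>m<R + 2. col m i *
        (int (d m) * (\<Sum>j<n. b m j * x j) ^ (d m - 1) * (\<Sum>j<n. b m j * h j))) = y i" for x y
      unfolding deriv_eq by (rule surj)
  qed (use n in simp_all)
  then show ?thesis by (intro exI[of _ "R + 2"]) auto
qed

theorem theoremB:
  assumes "\<not> jacobian_conjecture TYPE(complex)"
  shows "\<exists>n>1. \<exists>F :: int mpoly vec.
    keller_map n F \<and> quadratic_cubic_linear_form n F \<and>
    (\<forall>x \<in> diagonal_curve n F. x = 0\<^sub>v n)"
proof -
  obtain n d and cs :: "complex list" where "noninv (adjoin_list cs) n d"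
    using not_JC_noninv[OF assms] by blast
  then obtain n where "noninv (\<rat> :: complex set) n d" using noninv_Rats by blast
  \<comment> \<open>\<open>n\<close> and \<open>d\<close> are settled before \<open>K\<close> is
    chosen. The bound 1 is for the passage to the integers, the other one for the growth
    estimate.\<close>
  then obtain K F M G where K: "max 1 (n * ((n * d + 2) ^ n + 1)) < K"
    and "noninv_data (\<rat> :: complex set) n d K F M G"
    unfolding noninv_def by blast
  then obtain F M G where "noninv_data (UNIV :: int set) n d K F M G"
    using noninv_data_int[of n d K F M G] by auto
  then obtain T v N0 where "rigid (Suc n) T v N0" using ex_rigid[of n d K F M G] K by auto
  then obtain n T v where "rigid n T v N0" "\<forall>(k, a, w)\<in>set T. length w \<le> 3"
    using rigid_reduce by blast
  then show ?thesis by (rule rigid_imp_quadratic_cubic)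
qed

end
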